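(* Let $1<\beta<2$. There is an open neighborhood $U\subset(0,1)$ of $1/\beta$ such that for each $x\in[0,1]$ the map $p\in U\mapsto F_p(x)\in[0,1]$ is real-analytic. Set $$G(x)=\frac1\beta\left.\frac{\partial F_p(x)}{\partial p}\right|_{p=1/\beta}$$ for $x\in[0,1]$. Then the function $G$ is continuous but nowhere differentiable on $[0,1]$.
   Context: For $1<\beta<2$, $\tau_\beta(x)=\beta x-[\beta x]$ on $[0,1]$ and $g_n(x)=[\beta\tau_\beta^{n-1}(x)]$ are the greedy digits of $x$. $\{0,1\}^{\mathbb N}$ carries the product topology, the lexicographic order $\preceq$ and the left shift $\sigma$. $\underline0=000\cdots$ and $\underline1=(q_n(1))_{n\ge1}:=\lim_{y\nearrow1}(g_n(y))_{n\ge1}$ (quasi-greedy expansion of $1$). The beta-shift is $X_\beta=\{\underline x\in\{0,1\}^{\mathbb N}:\sigma^n(\underline x)\preceq\underline1\ \forall n\ge0\}$ with the map $\sigma$; $[\underline a,\underline b]=\{\underline x\in X_\beta:\underline a\preceq\underline x\preceq\underline b\}$. $C_1=\{(x_i)\in X_\beta:x_1=1\}$ and $\chi_{C_1}$ is its indicator function. For $\underline x=(x_i)\in X_\beta$: $H_0(t,\underline x)=1$, $H_n(t,\underline x)=\exp(t\sum_{i=1}^nx_i)$. For $t\in\mathbb R$, $\mathcal L_tf(x)=\sum_{y:\sigma(y)=x}e^{t\chi_{C_1}(y)}f(y)$ and $\lambda_t>1$ is its leading eigenvalue (on the closure, in functions of bounded variation on the ordered space $X_\beta$ modulo functions vanishing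 off a countable set, of the span of indicators of intervals). Equivalently, $\lambda_t^{-1}$ is the unique positive zero of $1-\sum_{n\ge1}q_n(1)H_{n-1}(t,\underline1)z^n$. $\nu_t$ is the Borel probability measure on $X_\beta$ which is the eigenmeasure for $\lambda_t$, i.e. $\int\mathcal L_tf\,d\nu_t=\lambda_t\int f\,d\nu_t$ for all finite linear combinations $f$ of indicators of intervals; it is non-atomic and given by $\nu_t([\underline0,\underline a])=\sum_{n\ge1}a_nH_{n-1}(t,\underline a)\lambda_t^{-n}$ for $\underline a=(a_n)\in X_\beta$. $\pi_\beta:X_\beta\to[0,1]$, $\pi_\beta((a_i)_{i\ge1})=\sum_{i\ge1}a_i\beta^{-i}$; $D_t(x)=\nu_t(\pi_\beta^{-1}([0,x]))$ for $x\in[0,1]$. The function $t\mapsto1/\lambda_t$ is a strictly decreasing bijection from $\mathbb R$ onto $(0,1)$; $f:(0,1)\to\mathbb R$ denotes its inverse, so $p=1/\lambda_{f(p)}$. $F_p(x)=D_{f(p)}(x)$ for $p\in(0,1)$, $x\in[0,1]$. Differentiability at the endpoints $0,1$ is one-sided. *)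

theory Defs
  imports "HOL-Probability.Probability"
begin

text \<open>
  Sequences are indexed from 0, so the entry \<open>x i\<close> is the digit usually written $x_{i+1}$.
  The space \<open>nat \<Rightarrow> nat\<close> carries the product of the discrete topologies.
\<close>

type_synonym digits = "nat \<Rightarrow> nat"

definition beta_map :: "real \<Rightarrow> real \<Rightarrow> real" where
  "beta_map \<beta> x = \<beta> * x - of_int \<lfloor>\<beta> * x\<rfloor>"

definition greedy :: "real \<Rightarrow> real \<Rightarrow> digits" where
  "greedy \<beta> x = (\<lambda>i. nat \<lfloor>\<beta> * (beta_map \<beta> ^^ i) x\<rfloor>)"

definition quasi_greedy_one :: "real \<Rightarrow> digits" where
  "quasi_greedy_one \<beta> = (THE q. (greedy \<beta> \<longlongrightarrow> q) (at_left 1))"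

definition shift :: "digits \<Rightarrow> digits" where
  "shift x = (\<lambda>i. x (Suc i))"

definition lex_le :: "digits \<Rightarrow> digits \<Rightarrow> bool" (infix "\<preceq>" 50) where
  "x \<preceq> y \<longleftrightarrow> x = y \<or> (\<exists>n. (\<forall>i<n. x i = y i) \<and> x n < y n)"

definition beta_shift :: "real \<Rightarrow> digits set" where
  "beta_shift \<beta> = {x. (\<forall>i. x i \<in> {0, 1}) \<and> (\<forall>n. (shift ^^ n) x \<preceq> quasi_greedy_one \<beta>)}"

definition seq_interval :: "real \<Rightarrow> digits \<Rightarrow> digits \<Rightarrow> digits set" where
  "seq_interval \<beta> a b = {x \<in> beta_shift \<beta>. a \<preceq> x \<and> x \<preceq> b}"

definition cyl1 :: "real \<Rightarrow> digits set" where
  "cyl1 \<beta> = {x \<in> beta_shift \<beta>. x 0 = 1}"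

text \<open>
  Finite linear combinations of indicators of intervals. The beta-shift is compact and hence
  order complete, so all its intervals have endpoints; the half-open and open ones are obtained
  from the closed ones because \<open>seq_interval \<beta> a a\<close> is a singleton.
\<close>

definition interval_span :: "real \<Rightarrow> (digits \<Rightarrow> complex) set" where
  "interval_span \<beta> = {f. \<exists>S c. finite S \<and> S \<subseteq> beta_shift \<beta> \<times> beta_shift \<beta> \<and>
     f = (\<lambda>x. \<Sum>(a, b)\<in>S. c a b * indicator (seq_interval \<beta> a b) x)}"

definition transfer_op :: "real \<Rightarrow> real \<Rightarrow> (digits \<Rightarrow> complex) \<Rightarrow> digits \<Rightarrow> complex" where
  "transfer_op \<beta> t f x =
     (\<Sum>y \<in> {y \<in> beta_shift \<beta>. shift y = x}. of_real (exp (t * indicator (cyl1 \<beta>) y)) * f y)"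

definition eq_mod_countable ::
    "real \<Rightarrow> (digits \<Rightarrow> complex) \<Rightarrow> (digits \<Rightarrow> complex) \<Rightarrow> bool" where
  "eq_mod_countable \<beta> f g \<longleftrightarrow> countable {x \<in> beta_shift \<beta>. f x \<noteq> g x}"

definition total_variation :: "real \<Rightarrow> (digits \<Rightarrow> complex) \<Rightarrow> ennreal" where
  "total_variation \<beta> f =
     (SUP xs \<in> {xs. set xs \<subseteq> beta_shift \<beta> \<and> sorted_wrt (\<preceq>) xs}.
        \<Sum>i < length xs - 1. ennreal (norm (f (xs ! Suc i) - f (xs ! i))))"

definition sup_norm :: "real \<Rightarrow> (digits \<Rightarrow> complex) \<Rightarrow> ennreal" where
  "sup_norm \<beta> f = (SUP x \<in> beta_shift \<beta>. ennreal (norm (f x)))"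

text \<open>
  The quotient norm of the functions of bounded variation modulo the functions vanishing off a
  countable set; it is infinite if \<open>f\<close> agrees with no function of bounded variation up to a
  countable set.
\<close>

definition bv_norm :: "real \<Rightarrow> (digits \<Rightarrow> complex) \<Rightarrow> ennreal" where
  "bv_norm \<beta> f = (INF g \<in> {g. eq_mod_countable \<beta> f g}. sup_norm \<beta> g + total_variation \<beta> g)"

definition bv_closure :: "real \<Rightarrow> (digits \<Rightarrow> complex) set" where
  "bv_closure \<beta> = {f. \<forall>\<epsilon>>0. \<exists>s\<in>interval_span \<beta>. bv_norm \<beta> (\<lambda>x. f x - s x) < \<epsilon>}"

definition transfer_eigenvalue :: "real \<Rightarrow> real \<Rightarrow> complex \<Rightarrow> bool" where
  "transfer_eigenvalue \<beta> t \<mu> \<longleftrightarrow>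
     (\<exists>f\<in>bv_closure \<beta>. \<not> eq_mod_countable \<beta> f (\<lambda>_. 0) \<and>
        eq_mod_countable \<beta> (transfer_op \<beta> t f) (\<lambda>x. \<mu> * f x))"

definition leading_eigenvalue :: "real \<Rightarrow> real \<Rightarrow> real" where
  "leading_eigenvalue \<beta> t =
     (THE l. transfer_eigenvalue \<beta> t (of_real l) \<and>
        (\<forall>\<mu>. transfer_eigenvalue \<beta> t \<mu> \<longrightarrow> norm \<mu> \<le> l))"

definition eigenmeasure :: "real \<Rightarrow> real \<Rightarrow> digits measure" where
  "eigenmeasure \<beta> t =
     (THE \<nu>. prob_space \<nu> \<and> sets \<nu> = sets (restrict_space borel (beta_shift \<beta>)) \<and>
        (\<forall>f\<in>interval_span \<beta>.
           (LINT x|\<nu>. transfer_op \<beta> t f x)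
             = of_real (leading_eigenvalue \<beta> t) * (LINT x|\<nu>. f x)))"

definition beta_proj :: "real \<Rightarrow> digits \<Rightarrow> real" where
  "beta_proj \<beta> a = (\<Sum>i. real (a i) / \<beta> ^ Suc i)"

definition distr_fun :: "real \<Rightarrow> real \<Rightarrow> real \<Rightarrow> real" where
  "distr_fun \<beta> t x = measure (eigenmeasure \<beta> t) {a \<in> beta_shift \<beta>. beta_proj \<beta> a \<in> {0..x}}"

definition param :: "real \<Rightarrow> real \<Rightarrow> real" where
  "param \<beta> = the_inv (\<lambda>t. 1 / leading_eigenvalue \<beta> t)"

definition F :: "real \<Rightarrow> real \<Rightarrow> real \<Rightarrow> real" where
  "F \<beta> p x = distr_fun \<beta> (param \<beta> p) x"

definition G :: "real \<Rightarrow> real \<Rightarrow> real" where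
  "G \<beta> x = 1 / \<beta> * deriv (\<lambda>p. F \<beta> p x) (1 / \<beta>)"

definition real_analytic_on :: "(real \<Rightarrow> real) \<Rightarrow> real set \<Rightarrow> bool" where
  "real_analytic_on f U \<longleftrightarrow> (\<forall>p\<in>U. \<exists>A. (\<lambda>h. f (p + h)) has_fps_expansion A)"

end

(*
  Put w = exp t and p = 1/lambda_t, and let q be the quasi-greedy expansion of 1. Then w and p are
  related by sum_n q_n w^(q_1 + ... + q_(n-1)) p^n = 1.

  On the spectral side, h(x) = sum_n p^(n+1) H_n(t, q) 1[x <= sigma^n q] satisfies L_t h = h / p and is
  bounded below by p on the beta-shift. Hence an eigenfunction for mu with |f| <= M h off a
  countable set satisfies |f| <= M/(p |mu|) h off a countable set, which bounds all eigenvalues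
  by 1/p. The eigenmeasure is the image of Lebesgue measure under the itineraries of the map
  u -> u/p for u < p, u -> (u/p - 1)/w for u >= p; it gives F_p(x) = sum_n a_n H_(n-1)(t, a) p^n
  with the greedy expansion a of x.

  For p near 1/beta the relation is solved for w by a holomorphic function of p. So F_p(x) is
  analytic in p and G(x) = K(a) with
    K(a) = sum_n a_n beta^(-n) (n + kappa (a_1 + ... + a_(n-1))),  K(q) = 0.
  The digit sequence has different one-sided limits u0q and u1000... at the numbers with finite
  expansion, but K(q) = 0 makes the values of K at the two limits agree, whence continuity.
  If u is a word that every element of the beta-shift may follow, then the slopes of G between
  the points u000... and u1000... and between u000... and u01000... differ by exactly 1. There
  are such words of arbitrary length near every x, so the difference quotients cannot converge.
*)
theory Submission
  imports Defs "HOL-Complex_Analysis.Complex_Analysis"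
begin

text \<open>The quasi-greedy expansion, the leading eigenvalue, the eigenmeasure and the inverse
  \<open>param\<close> are definite descriptions, so each needs a uniqueness proof besides a
  construction. Since \<open>param\<close> inverts a function of all real t, the leading eigenvalue
  is computed for every t, which requires a root p in (0,1) of the relation for every w > 0. The
  obstacle is that the series might stay below 1 up to its radius of convergence and diverge beyond
  it. Self-admissibility of q excludes this: lowering a 1 of an admissible sequence to 0 lets any
  admissible sequence follow, so admissible words fall into blocks that copy q and break off at a 1.
  The same block structure bounds all values by 1 and provides the words u used against
  differentiability. The eigenmeasure is treated for w p < 1, where weights decay geometrically and
  remainders vanish; near p = 1/beta this holds because w = 1 there. The constant kappa is p w'(p)
  at p = 1/beta, and K(q) = 0 is the relation between w and p, differentiated there.\<close>

section \<open>Lexicographic order and admissible sequences\<close>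

lemma shift_funpow: "(shift ^^ n) x = (\<lambda>i. x (i + n))"
  by (induction n) (auto simp: shift_def fun_eq_iff)

lemma neq_first_diff:
  fixes x y :: digits
  assumes "x \<noteq> y"
  obtains n where "\<forall>i<n. x i = y i" "x n \<noteq> y n"
proof -
  from assms obtain k where "x k \<noteq> y k" by (auto simp: fun_eq_iff)
  then show ?thesis
    using that exists_least_iff[of "\<lambda>n. x n \<noteq> y n"] by blast
qed

lemma lex_less_asym:
  fixes x y :: digits
  assumes "\<forall>i<n. x i = y i" "x n < y n" "\<forall>i<m. x i = y i" "y m < x m"
  shows False
  using assms by (cases m n rule: linorder_cases) auto

lemma not_lex_le_iff: "\<not> x \<preceq> y \<longleftrightarrow> (\<exists>n. (\<forall>i<n. x i = y i) \<and> y n < x n)"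
proof
  assume le: "\<not> x \<preceq> y"
  then have "x \<noteq> y" by (auto simp: lex_le_def)
  then obtain n where n: "\<forall>i<n. x i = y i" "x n \<noteq> y n"
    by (rule neq_first_diff)
  moreover have "\<not> x n < y n" using le n(1) by (auto simp: lex_le_def)
  ultimately show "\<exists>n. (\<forall>i<n. x i = y i) \<and> y n < x n"
    by (intro exI[of _ n]) auto
next
  assume "\<exists>n. (\<forall>i<n. x i = y i) \<and> y n < x n"
  then show "\<not> x \<preceq> y"
    using lex_less_asym[of _ x y] unfolding lex_le_def by blast
qed

lemma lex_less_imp_le: "(\<forall>i<n. x i = y i) \<Longrightarrow> x n < y n \<Longrightarrow> x \<preceq> y"
  by (auto simp: lex_le_def)

lemma lex_le_refl [simp]: "x \<preceq> x"
  by (simp add: lex_le_def)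

lemma lex_le_linear: "x \<preceq> y \<or> y \<preceq> x"
proof (cases "x \<preceq> y")
  case False
  then obtain n where "\<forall>i<n. x i = y i" "y n < x n" by (auto simp: not_lex_le_iff)
  then show ?thesis by (intro disjI2 lex_less_imp_le[of n]) auto
qed simp

lemma lex_le_antisym:
  assumes "x \<preceq> y" "y \<preceq> x"
  shows "x = y"
proof (rule ccontr)
  assume "x \<noteq> y"
  with assms(1) obtain n where "\<forall>i<n. x i = y i" "x n < y n" by (auto simp: lex_le_def)
  then have "\<forall>i<n. y i = x i" "x n < y n" by auto
  then have "\<not> y \<preceq> x" unfolding not_lex_le_iff by blast
  with assms(2) show False by simp
qed

lemma lex_le_trans [trans]: "x \<preceq> y \<Longrightarrow> y \<preceq> z \<Longrightarrow> x \<preceq> z"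
proof -
  assume xy: "x \<preceq> y" and yz: "y \<preceq> z"
  show "x \<preceq> z"
  proof (cases "x = y \<or> y = z")
    case False
    with xy yz obtain m n where m: "\<forall>i<m. x i = y i" "x m < y m"
      and n: "\<forall>i<n. y i = z i" "y n < z n" by (auto simp: lex_le_def)
    show ?thesis
    proof (rule lex_less_imp_le)
      show "\<forall>i<min m n. x i = z i" using m n by auto
      show "x (min m n) < z (min m n)"
        using m n by (cases m n rule: linorder_cases) (auto simp: min_def)
    qed
  qed (use xy yz in auto)
qed

lemma lex_le_Suc: "x \<preceq> y \<longleftrightarrow> x 0 < y 0 \<or> x 0 = y 0 \<and> shift x \<preceq> shift y"
proof -
  have ex: "(\<exists>n. P n) \<longleftrightarrow> P 0 \<or> (\<exists>n. P (Suc n))" for P :: "nat \<Rightarrow> bool"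
    by (safe, case_tac n) auto
  have "x = y \<longleftrightarrow> x 0 = y 0 \<and> shift x = shift y"
    using ex[of "\<lambda>n. x n \<noteq> y n"] by (auto simp: fun_eq_iff shift_def)
  then show ?thesis
    unfolding lex_le_def ex[of "\<lambda>n. (\<forall>i<n. x i = y i) \<and> x n < y n"]
    by (auto simp: shift_def All_less_Suc2)
qed

section \<open>Counting ones, concatenation and admissibility\<close>

definition ones :: "digits \<Rightarrow> nat \<Rightarrow> nat" where
  "ones a n = (\<Sum>i<n. a i)"

lemma ones_0 [simp]: "ones a 0 = 0"
  by (simp add: ones_def)

lemma ones_Suc: "ones a (Suc n) = ones a n + a n"
  by (simp add: ones_def)

lemma ones_add: "ones a (m + n) = ones a m + ones (\<lambda>i. a (i + m)) n"
  by (induction n) (auto simp: ones_Suc add.commute)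

lemma ones_cong: "(\<And>i. i < n \<Longrightarrow> a i = b i) \<Longrightarrow> ones a n = ones b n"
  by (simp add: ones_def)

lemma ones_le: "(\<And>i. a i \<le> 1) \<Longrightarrow> ones a n \<le> n"
proof (induction n)
  case (Suc n)
  then have "ones a n \<le> n" by blast
  moreover have "a n \<le> 1" by fact
  ultimately show ?case by (simp add: ones_Suc)
qed simp

definition cat :: "nat \<Rightarrow> digits \<Rightarrow> digits \<Rightarrow> digits" where
  "cat n a b = (\<lambda>i. if i < n then a i else b (i - n))"

text \<open>The beta-shift with its bounding sequence as a parameter, so that its combinatorics can
  be developed before \<open>quasi_greedy_one\<close> is identified.\<close>

definition adm :: "digits \<Rightarrow> digits set" where
  "adm q = {x. (\<forall>i. x i \<in> {0, 1}) \<and> (\<forall>n. (\<lambda>i. x (i + n)) \<preceq> q)}"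

lemma beta_shift_eq_adm: "beta_shift \<beta> = adm (quasi_greedy_one \<beta>)"
  by (auto simp: beta_shift_def adm_def shift_funpow)

lemma adm_digit: "x \<in> adm q \<Longrightarrow> x i = 0 \<or> x i = 1"
  by (auto simp: adm_def)

lemma adm_digit_le: "x \<in> adm q \<Longrightarrow> x i \<le> 1"
  using adm_digit[of x q i] by auto

lemma adm_le: "x \<in> adm q \<Longrightarrow> x \<preceq> q"
  by (auto simp: adm_def dest: spec[of _ 0])

lemma adm_shift: "x \<in> adm q \<Longrightarrow> (\<lambda>i. x (i + n)) \<in> adm q"
  by (auto simp: adm_def add.assoc)

lemma adm_first_diff:
  assumes "x \<in> adm q" "y \<in> adm r" "x \<preceq> y" "x \<noteq> y"
  obtains n where "\<And>i. i < n \<Longrightarrow> x i = y i" "x n = 0" "y n = 1"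
proof -
  obtain n where n: "\<forall>i<n. x i = y i" "x n < y n"
    using assms by (auto simp: lex_le_def)
  with adm_digit[OF assms(1), of n] adm_digit[OF assms(2), of n] show ?thesis
    by (intro that[of n]) auto
qed

locale self_admissible =
  fixes q :: digits
  assumes q_adm: "q \<in> adm q"
    and q_0: "q 0 = 1"
    and q_inf: "\<And>m. \<exists>n\<ge>m. q n = 1"
begin

abbreviation "X \<equiv> adm q"

lemma zero_adm: "(\<lambda>_. 0) \<in> X"
  using q_0 by (auto simp: adm_def lex_le_def intro: exI[of _ 0])

lemma zero_lex_le: "(\<lambda>_. 0) \<preceq> x"
proof -
  have "\<not> (\<exists>n. (\<forall>i<n. 0 = x i) \<and> x n < (0::nat))" by auto
  then show ?thesis using not_lex_le_iff[of "\<lambda>_. 0" x] by auto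
qed

text \<open>A shift starting at or before \<open>k\<close> becomes strictly smaller than the same
  shift of \<open>c\<close>, whatever follows position \<open>k\<close>; later shifts are shifts of
  \<open>b\<close>. All block decompositions rest on this freedom behind a lowered digit.\<close>

lemma adm_drop_digit:
  assumes c: "c \<in> X" and k: "c k = 1" and b: "b \<in> X"
  shows "cat (Suc k) (c(k := 0)) b \<in> X"
proof -
  let ?d = "cat (Suc k) (c(k := 0)) b"
  have "(\<lambda>i. ?d (i + n)) \<preceq> q" for n
  proof (cases "n \<le> k")
    case True
    have "(\<lambda>i. ?d (i + n)) \<preceq> (\<lambda>i. c (i + n))"
      using True k by (intro lex_less_imp_le[of "k - n"]) (auto simp: cat_def)
    also have "\<dots> \<preceq> q" using c by (auto simp: adm_def)
    finally show ?thesis .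
  next
    case False
    then have "(\<lambda>i. ?d (i + n)) = (\<lambda>i. b (i + (n - Suc k)))"
      by (auto simp: cat_def fun_eq_iff)
    then show ?thesis using b by (auto simp: adm_def)
  qed
  moreover have "?d i \<in> {0, 1}" for i
    using c b by (auto simp: adm_def cat_def)
  ultimately show ?thesis by (simp add: adm_def)
qed

lemma case_nat_0_adm: "x \<in> X \<Longrightarrow> case_nat 0 x \<in> X"
proof -
  assume "x \<in> X"
  then have "cat (Suc 0) (q(0 := 0)) x \<in> X"
    by (rule adm_drop_digit[OF q_adm q_0])
  also have "cat (Suc 0) (q(0 := 0)) x = case_nat 0 x"
    by (auto simp: cat_def fun_eq_iff split: nat.split)
  finally show ?thesis .
qed

lemma shift_adm: "x \<in> X \<Longrightarrow> shift x \<in> X"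
  using adm_shift[of x q 1] by (simp add: shift_def)

lemma shift_case_nat [simp]: "shift (case_nat d x) = x"
  by (simp add: shift_def)

lemma case_nat_shift [simp]: "case_nat (x 0) (shift x) = x"
  by (auto simp: shift_def split: nat.split)

lemma case_nat_1_adm_iff: "x \<in> X \<Longrightarrow> case_nat 1 x \<in> X \<longleftrightarrow> x \<preceq> shift q"
proof
  assume x: "x \<in> X" and le: "x \<preceq> shift q"
  have "case_nat 1 x \<preceq> q" using le q_0 by (subst lex_le_Suc) simp
  moreover have "(\<lambda>i. case_nat (1::nat) x (i + Suc n)) \<preceq> q" for n
    using x by (auto simp: adm_def)
  ultimately have "(\<lambda>i. case_nat (1::nat) x (i + n)) \<preceq> q" for n
    by (cases n) (auto simp del: One_nat_def)
  then show "case_nat 1 x \<in> X"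
    using x by (auto simp: adm_def simp del: One_nat_def split: nat.split)
next
  assume "case_nat 1 x \<in> X"
  then have "case_nat 1 x \<preceq> q" by (rule adm_le)
  then show "x \<preceq> shift q" using q_0 by (subst (asm) lex_le_Suc) simp
qed

end

section \<open>The quasi-greedy expansion of 1\<close>

lemma tendsto_fun_iff:
  fixes f :: "'b \<Rightarrow> 'a \<Rightarrow> 'c::topological_space"
  shows "(f \<longlongrightarrow> l) A \<longleftrightarrow> (\<forall>i. ((\<lambda>x. f x i) \<longlongrightarrow> l i) A)"
proof -
  have "(f \<longlongrightarrow> l) A \<longleftrightarrow> limitin euclidean f l A" by (simp add: limitin_canonical_iff)
  also have "\<dots> \<longleftrightarrow> (\<forall>i. ((\<lambda>x. f x i) \<longlongrightarrow> l i) A)"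
    by (subst euclidean_product_topology[symmetric], subst limitin_componentwise)
       (auto simp: limitin_canonical_iff)
  finally show ?thesis .
qed

section \<open>The left-continuous beta-map and its digits\<close>

locale beta_base =
  fixes \<beta> :: real
  assumes beta_gt: "1 < \<beta>" and beta_lt: "\<beta> < 2"
begin

text \<open>The left-continuous version of the beta-map: points where \<open>\<beta> * x\<close> is
  an integer go to 1 instead of 0, so (0,1] is mapped into itself. Besides \<open>q\<close>, its
  digit sequences also give the left limits of the greedy digits at every x.\<close>

definition lmap :: "real \<Rightarrow> real" where
  "lmap x = \<beta> * x - (of_int \<lceil>\<beta> * x\<rceil> - 1)"

definition ldigits :: "real \<Rightarrow> digits" where
  "ldigits x n = nat (\<lceil>\<beta> * (lmap ^^ n) x\<rceil> - 1)"

definition q :: digits where "q = ldigits 1"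

lemma lmap_bounds: "0 < lmap x" "lmap x \<le> 1"
  unfolding lmap_def by linarith+

lemma lmap_funpow_bounds:
  assumes "0 < x" "x \<le> 1"
  shows "0 < (lmap ^^ n) x" "(lmap ^^ n) x \<le> 1"
  using assms lmap_bounds by (induction n) auto

lemma ceiling_beta:
  assumes "0 < x" "x \<le> 1"
  shows "\<lceil>\<beta> * x\<rceil> = (if \<beta> * x > 1 then 2 else 1)"
proof -
  have "0 < \<beta> * x" using assms beta_gt by simp
  moreover have "\<beta> * x < 2" using assms beta_gt beta_lt mult_left_le[of x \<beta>] by linarith
  ultimately show ?thesis by (auto simp: ceiling_eq_iff)
qed

lemma ldigits_eq:
  assumes "0 < x" "x \<le> 1"
  shows "ldigits x n = (if \<beta> * (lmap ^^ n) x > 1 then 1 else 0)"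
  using ceiling_beta[OF lmap_funpow_bounds[OF assms, of n]] by (simp add: ldigits_def)

lemma lmap_Suc:
  assumes "0 < x" "x \<le> 1"
  shows "(lmap ^^ Suc n) x = \<beta> * (lmap ^^ n) x - real (ldigits x n)"
  using ceiling_beta[OF lmap_funpow_bounds[OF assms, of n]]
  by (simp add: ldigits_def lmap_def)

lemma ldigits_expansion:
  assumes "0 < x" "x \<le> 1"
  shows "x = (\<Sum>i<n. real (ldigits x i) / \<beta> ^ Suc i) + (lmap ^^ n) x / \<beta> ^ n"
proof (induction n)
  case (Suc n)
  have "(lmap ^^ n) x / \<beta> ^ n = real (ldigits x n) / \<beta> ^ Suc n + (lmap ^^ Suc n) x / \<beta> ^ Suc n"
    using beta_gt unfolding lmap_Suc[OF assms, of n] by (simp add: field_simps)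
  with Suc show ?case by simp
qed simp

text \<open>Just to the left of \<open>x\<close> the floor is constant, so \<open>beta_map\<close>
  is affine and increasing there and sends left neighbourhoods to left neighbourhoods of
  \<open>lmap x\<close>. Keeping the side of approach is what permits iteration.\<close>

lemma filterlim_beta_map_left:
  assumes "0 < x"
  shows "filterlim (beta_map \<beta>) (at_left (lmap x)) (at_left x)"
    and "eventually (\<lambda>y. \<lfloor>\<beta> * y\<rfloor> = \<lceil>\<beta> * x\<rceil> - 1) (at_left x)"
proof -
  define c where "c = \<lceil>\<beta> * x\<rceil>"
  have c: "of_int c - 1 < \<beta> * x" "\<beta> * x \<le> of_int c" unfolding c_def by linarith+
  then have "(of_int c - 1) / \<beta> < x" using beta_gt by (simp add: field_simps)
  then have "eventually (\<lambda>y. y \<in> {(of_int c - 1) / \<beta><..<x}) (at_left x)"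
    by (rule eventually_at_left_real)
  then have ev: "eventually (\<lambda>y. \<lfloor>\<beta> * y\<rfloor> = c - 1 \<and> y < x) (at_left x)"
  proof eventually_elim
    case (elim y)
    then have "of_int c - 1 < \<beta> * y" "\<beta> * y < \<beta> * x"
      using beta_gt by (auto simp: field_simps)
    with c elim show ?case by (auto simp: floor_eq_iff)
  qed
  then show "eventually (\<lambda>y. \<lfloor>\<beta> * y\<rfloor> = \<lceil>\<beta> * x\<rceil> - 1) (at_left x)"
    by eventually_elim (simp add: c_def)
  have "((\<lambda>y. \<beta> * y - (of_int c - 1)) \<longlongrightarrow> lmap x) (at_left x)"
    unfolding lmap_def c_def by (intro tendsto_intros)
  moreover have ev': "eventually (\<lambda>y. beta_map \<beta> y = \<beta> * y - (of_int c - 1) \<and> y < x) (at_left x)"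
    using ev by eventually_elim (simp add: beta_map_def)
  ultimately have "(beta_map \<beta> \<longlongrightarrow> lmap x) (at_left x)"
    by (elim Lim_transform_eventually) (auto elim: eventually_mono)
  moreover have "eventually (\<lambda>y. beta_map \<beta> y \<in> {..<lmap x} \<and> beta_map \<beta> y \<noteq> lmap x) (at_left x)"
    using ev' by eventually_elim (use beta_gt in \<open>auto simp: lmap_def c_def\<close>)
  ultimately show "filterlim (beta_map \<beta>) (at_left (lmap x)) (at_left x)"
    by (simp add: filterlim_at)
qed

lemma greedy_at_left:
  assumes "0 < x" "x \<le> 1"
  shows "eventually (\<lambda>y. greedy \<beta> y n = ldigits x n) (at_left x)"
proof -
  have "filterlim (beta_map \<beta> ^^ n) (at_left ((lmap ^^ n) x)) (at_left x)"
  proof (induction n)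
    case (Suc n)
    have "filterlim (\<lambda>y. beta_map \<beta> ((beta_map \<beta> ^^ n) y)) (at_left (lmap ((lmap ^^ n) x))) (at_left x)"
      using filterlim_beta_map_left(1)[OF lmap_funpow_bounds(1)[OF assms]] Suc
      by (rule filterlim_compose)
    then show ?case by (simp add: o_def)
  qed (simp add: filterlim_ident)
  then have "eventually (\<lambda>y. \<lfloor>\<beta> * (beta_map \<beta> ^^ n) y\<rfloor> = \<lceil>\<beta> * (lmap ^^ n) x\<rceil> - 1) (at_left x)"
    using filterlim_beta_map_left(2)[OF lmap_funpow_bounds(1)[OF assms]] 
    by (rule eventually_compose_filterlim[rotated])
  then show ?thesis
    by eventually_elim (simp add: greedy_def ldigits_def)
qed

lemma quasi_greedy_one_eq: "quasi_greedy_one \<beta> = q"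
  unfolding quasi_greedy_one_def
proof (rule the_equality)
  have ev: "eventually (\<lambda>y. greedy \<beta> y i = q i) (at_left 1)" for i
    unfolding q_def by (rule greedy_at_left) auto
  then show *: "(greedy \<beta> \<longlongrightarrow> q) (at_left 1)"
    by (auto simp: tendsto_fun_iff intro: tendsto_eventually)
  fix p assume p: "(greedy \<beta> \<longlongrightarrow> p) (at_left 1)"
  show "p = q"
  proof
    fix i
    show "p i = q i"
      using p * tendsto_unique[OF trivial_limit_at_left_real, of "\<lambda>y. greedy \<beta> y i" "p i" 1 "q i"]
      by (simp add: tendsto_fun_iff)
  qed
qed

abbreviation r :: "nat \<Rightarrow> real" where "r n \<equiv> (lmap ^^ n) 1"

lemma r_bounds: "0 < r n" "r n \<le> 1"
  using lmap_funpow_bounds[of 1 n] by auto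

lemma q_eq: "q n = (if \<beta> * r n > 1 then 1 else 0)"
  unfolding q_def by (rule ldigits_eq) auto

lemma r_Suc: "r (Suc n) = \<beta> * r n - real (q n)"
  unfolding q_def by (rule lmap_Suc) auto

text \<open>On a tail of zeros the remainder \<open>r\<close> would be multiplied by \<beta> at
  every step, yet it stays in (0,1].\<close>

lemma q_infinitely_many_ones: "\<exists>n\<ge>m. q n = 1"
proof (rule ccontr)
  assume "\<not> ?thesis"
  then have 0: "q n = 0" if "n \<ge> m" for n
    using that q_eq[of n] by (auto split: if_splits)
  have "r (m + k) = \<beta> ^ k * r m" for k
  proof (induction k)
    case (Suc k)
    have "r (m + Suc k) = \<beta> * r (m + k)" using r_Suc[of "m + k"] 0[of "m + k"] by simp
    then show ?case using Suc by simp
  qed simp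
  then have "\<beta> ^ k * r m \<le> 1" for k
    using r_bounds(2)[of "m + k"] by simp
  moreover obtain k where "1 / r m < \<beta> ^ k"
    using real_arch_pow[OF beta_gt] by blast
  ultimately show False
    using r_bounds(1)[of m] by (simp add: field_simps not_less[symmetric])
qed

text \<open>If a shift of \<open>q\<close> exceeded \<open>q\<close> at position k, the common
  prefix and \<open>r n \<le> 1\<close> would give \<open>r (k + n) \<le> r k\<close> for the
  remainders behind it. Digits are monotone in the remainder, a contradiction.\<close>

lemma q_adm: "q \<in> adm q"
  unfolding adm_def
proof (safe)
  fix n
  show "(\<lambda>i. q (i + n)) \<preceq> q"
  proof (rule ccontr)
    assume "\<not> ?thesis"
    then obtain k where k: "\<forall>i<k. q (i + n) = q i" "q k < q (k + n)"
      by (auto simp: not_lex_le_iff)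
    have "r n = (\<Sum>i<j. real (q (i + n)) / \<beta> ^ Suc i) + r (j + n) / \<beta> ^ j" for j
    proof (induction j)
      case (Suc j)
      show ?case unfolding Suc add_Suc r_Suc using beta_gt by (simp add: field_simps)
    qed simp
    from this[of k] have "r n = (\<Sum>i<k. real (q i) / \<beta> ^ Suc i) + r (k + n) / \<beta> ^ k"
      using k(1) by simp
    moreover have "1 = (\<Sum>i<k. real (q i) / \<beta> ^ Suc i) + r k / \<beta> ^ k"
      using ldigits_expansion[of 1 k] by (simp add: q_def)
    moreover have "r n \<le> 1" by (rule r_bounds)
    ultimately have "r (k + n) / \<beta> ^ k \<le> r k / \<beta> ^ k" by linarith
    then have "r (k + n) \<le> r k" using beta_gt by (simp add: divide_le_cancel)
    then have "\<beta> * r (k + n) \<le> \<beta> * r k" using beta_gt by simp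
    with k(2) show False by (auto simp: q_eq split: if_splits)
  qed
qed (auto simp: q_eq split: if_splits)

lemma q_sums: "(\<lambda>n. real (q n) / \<beta> ^ Suc n) sums 1"
proof -
  have "(\<lambda>n. r n * (1 / \<beta>) ^ n) \<longlonglongrightarrow> 0"
  proof (rule Lim_null_comparison)
    show "eventually (\<lambda>n. norm (r n * (1 / \<beta>) ^ n) \<le> (1 / \<beta>) ^ n) sequentially"
      using r_bounds beta_gt by (intro always_eventually allI) (auto simp: abs_mult less_imp_le divide_right_mono power_one_over)
    show "(\<lambda>n. (1 / \<beta>) ^ n) \<longlonglongrightarrow> 0"
      using beta_gt by (intro LIMSEQ_power_zero) auto
  qed
  then have "(\<lambda>n. 1 - r n * (1 / \<beta>) ^ n) \<longlonglongrightarrow> 1 - 0"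
    by (intro tendsto_intros)
  moreover have "1 - r n * (1 / \<beta>) ^ n = (\<Sum>i<n. real (q i) / \<beta> ^ Suc i)" for n
    using ldigits_expansion[of 1 n] by (simp add: q_def power_one_over)
  ultimately show ?thesis by (simp add: sums_def)
qed

sublocale self_admissible q
proof
  show "q \<in> adm q" by (rule q_adm)
  show "q 0 = 1" using beta_gt by (simp add: q_eq)
  show "\<exists>n\<ge>m. q n = 1" for m by (rule q_infinitely_many_ones)
qed

lemma beta_shift_eq: "beta_shift \<beta> = X"
  by (simp add: beta_shift_eq_adm quasi_greedy_one_eq)

end

section \<open>Weighted expansions\<close>

text \<open>With w = exp t and z = 1/\<lambda> this is the summand a_n H_(n-1)(t, a) \<lambda>^(-n),
  with indices from 0. The field is general because the sums are needed over the reals for the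
  measure and over the complex numbers for analyticity.\<close>

definition bterm :: "'a::real_normed_field \<Rightarrow> 'a \<Rightarrow> digits \<Rightarrow> nat \<Rightarrow> 'a" where
  "bterm w z a n = of_nat (a n) * (w ^ ones a n * z ^ Suc n)"

text \<open>The factor by which the first \<open>n\<close> digits scale the contribution of
  everything behind them.\<close>

definition wt :: "'a::real_normed_field \<Rightarrow> 'a \<Rightarrow> digits \<Rightarrow> nat \<Rightarrow> 'a" where
  "wt w z a n = w ^ ones a n * z ^ n"

lemma bterm_cong: "(\<And>i. i \<le> n \<Longrightarrow> a i = b i) \<Longrightarrow> bterm w z a n = bterm w z b n"
  unfolding bterm_def using ones_cong[of n a b] by simp

lemma wt_cong: "(\<And>i. i < n \<Longrightarrow> a i = b i) \<Longrightarrow> wt w z a n = wt w z b n"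
  unfolding wt_def using ones_cong[of n a b] by simp

lemma wt_0 [simp]: "wt w z a 0 = 1"
  by (simp add: wt_def)

lemma wt_add: "wt w z a (m + n) = wt w z a m * wt w z (\<lambda>i. a (i + m)) n"
  by (simp add: wt_def ones_add power_add mult_ac)

lemma bterm_add: "bterm w z a (m + n) = wt w z a m * bterm w z (\<lambda>i. a (i + m)) n"
  by (simp add: wt_def bterm_def ones_add power_add mult_ac add.commute[of n m])

lemma sum_bterm_add:
  "(\<Sum>i<m + n. bterm w z a i) =
     (\<Sum>i<m. bterm w z a i) + wt w z a m * (\<Sum>i<n. bterm w z (\<lambda>i. a (i + m)) i)"
proof (induction n)
  case (Suc n)
  then show ?case by (simp add: bterm_add distrib_left)
qed simp

text \<open>A linear recursion for the weights driven by the summands of the series: bounds on the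
  series carry over to the sum of the weights.\<close>

lemma wt_Suc: "a n \<le> 1 \<Longrightarrow> wt w z a (Suc n) = z * wt w z a n + (w - 1) * bterm w z a n"
  by (cases "a n") (auto simp: wt_def bterm_def ones_Suc algebra_simps)

lemma wt_pos: "0 < w \<Longrightarrow> 0 < z \<Longrightarrow> 0 < wt w (z::real) a n"
  by (simp add: wt_def)

lemma bterm_nonneg: "0 < w \<Longrightarrow> 0 < z \<Longrightarrow> 0 \<le> bterm w (z::real) a n"
  by (simp add: bterm_def)

lemma bterm_eq_wt: "bterm w z a n = of_nat (a n) * (z * wt w z a n)"
  by (simp add: bterm_def wt_def)

section \<open>Comparison of admissible words with \<open>q\<close>\<close>

context self_admissible
begin

lemma first_diff_q:
  assumes "x \<in> X" "\<not> (\<forall>i<n. x i = q i)"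
  obtains k where "k < n" "\<And>i. i < k \<Longrightarrow> x i = q i" "x k = 0" "q k = 1"
proof -
  have "x \<preceq> q" "x \<noteq> q" using assms adm_le by auto
  then obtain k where k: "\<And>i. i < k \<Longrightarrow> x i = q i" "x k = 0" "q k = 1"
    using adm_first_diff[OF assms(1) q_adm] by metis
  moreover have "k < n" using k(1) assms(2) by (meson less_le_trans not_le)
  ultimately show ?thesis using that by blast
qed

text \<open>At the first deviation \<open>x\<close> has 0 where \<open>q\<close> has 1, so the word
  up to and including that position has weight \<open>bterm w z q k\<close>, which is at most 1; the
  rest is a shorter admissible word.\<close>

lemma wt_bound:
  fixes w z C :: real
  assumes wz: "0 < w" "0 < z" and "x \<in> X"
    and C: "\<And>k. k \<le> n \<Longrightarrow> wt w z q k \<le> C"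
    and B: "\<And>k. k < n \<Longrightarrow> bterm w z q k \<le> 1"
  shows "wt w z x n \<le> C"
  using assms(3-)
proof (induction n arbitrary: x rule: less_induct)
  case (less n)
  show ?case
  proof (cases "\<forall>i<n. x i = q i")
    case True
    then show ?thesis using wt_cong[of n x q w z] less.prems(2)[of n] by simp
  next
    case False
    then obtain k where k: "k < n" "\<And>i. i < k \<Longrightarrow> x i = q i" "x k = 0" "q k = 1"
      using first_diff_q[OF less.prems(1)] by metis
    have "wt w z x (Suc k + (n - Suc k)) = wt w z x (Suc k) * wt w z (\<lambda>i. x (i + Suc k)) (n - Suc k)"
      by (rule wt_add)
    moreover have "wt w z x (Suc k) = bterm w z q k"
      using k wt_cong[of k x q w z] ones_cong[of k x q]
      by (simp add: bterm_def wt_def ones_Suc)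
    moreover have "wt w z (\<lambda>i. x (i + Suc k)) (n - Suc k) \<le> C"
      by (rule less.IH[OF _ adm_shift[OF less.prems(1)]])
         (use k(1) less.prems(2,3) in \<open>simp_all del: One_nat_def\<close>)
    moreover have "bterm w z q k * wt w z (\<lambda>i. x (i + Suc k)) (n - Suc k) \<le> 1 * C"
      using calculation(3) less.prems(3)[OF k(1)] wt_pos[OF wz, of "\<lambda>i. x (i + Suc k)" "n - Suc k"]
      by (intro mult_mono) auto
    ultimately show ?thesis using k(1) by simp
  qed
qed

text \<open>At the first deviation the term that \<open>x\<close> misses equals the weight
  multiplying its remaining sum. That sum is at most 1, so the missing term pays for it.\<close>

lemma sum_bterm_le:
  fixes w z :: real
  assumes wz: "0 < w" "0 < z" and q1: "\<And>n. (\<Sum>i<n. bterm w z q i) \<le> 1" and "x \<in> X"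
  shows "(\<Sum>i<n. bterm w z x i) \<le> (\<Sum>i<n. bterm w z q i)"
  using assms(4)
proof (induction n arbitrary: x rule: less_induct)
  case (less n)
  show ?case
  proof (cases "\<forall>i<n. x i = q i")
    case True
    then have "(\<Sum>i<n. bterm w z x i) = (\<Sum>i<n. bterm w z q i)"
      by (intro sum.cong bterm_cong) auto
    then show ?thesis by simp
  next
    case False
    then obtain k where k: "k < n" "\<And>i. i < k \<Longrightarrow> x i = q i" "x k = 0" "q k = 1"
      using first_diff_q[OF less.prems(1)] by metis
    let ?y = "\<lambda>i. x (i + Suc k)"
    have "(\<Sum>i<Suc k + (n - Suc k). bterm w z x i) =
        (\<Sum>i<Suc k. bterm w z x i) + wt w z x (Suc k) * (\<Sum>i<n - Suc k. bterm w z ?y i)"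
      by (rule sum_bterm_add)
    moreover have "wt w z x (Suc k) = bterm w z q k"
      using k wt_cong[of k x q w z] ones_cong[of k x q]
      by (simp add: bterm_def wt_def ones_Suc)
    moreover have "(\<Sum>i<Suc k. bterm w z x i) = (\<Sum>i<k. bterm w z q i)"
    proof -
      have "(\<Sum>i<Suc k. bterm w z x i) = (\<Sum>i<k. bterm w z x i)"
        using k(3) by (simp add: bterm_def)
      also have "\<dots> = (\<Sum>i<k. bterm w z q i)"
        using k(2) by (intro sum.cong bterm_cong) auto
      finally show ?thesis .
    qed
    moreover have "(\<Sum>i<n - Suc k. bterm w z ?y i) \<le> 1"
    proof -
      have "(\<Sum>i<n - Suc k. bterm w z ?y i) \<le> (\<Sum>i<n - Suc k. bterm w z q i)"
        by (rule less.IH[OF _ adm_shift[OF less.prems(1)]]) (use k(1) in simp)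
      then show ?thesis using q1[of "n - Suc k"] by linarith
    qed
    then have "bterm w z q k * (\<Sum>i<n - Suc k. bterm w z ?y i) \<le> bterm w z q k * 1"
      using bterm_nonneg[OF wz] by (intro mult_left_mono)
    ultimately have "(\<Sum>i<n. bterm w z x i) \<le> (\<Sum>i<Suc k. bterm w z q i)"
      using k(1) by simp
    also have "\<dots> \<le> (\<Sum>i<n. bterm w z q i)"
      using k(1) bterm_nonneg[OF wz] by (intro sum_mono2) auto
    finally show ?thesis .
  qed
qed

text \<open>\<open>wt_Suc\<close> gives S(n+1) \<le> 1 + z S(n) + |w - 1| for the partial sums S,
  and z < 1 turns this into a uniform bound.\<close>

lemma wt_summable:
  fixes w z :: real
  assumes wz: "0 < w" "0 < z" "z < 1" and q1: "\<And>n. (\<Sum>i<n. bterm w z q i) \<le> 1"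
  shows "summable (wt w z q)"
proof (rule summableI_nonneg_bounded)
  show "0 \<le> wt w z q n" for n using wt_pos[OF wz(1,2)] by (simp add: less_imp_le)
  define S where "S n = (\<Sum>i<n. wt w z q i)" for n
  have "S n * (1 - z) \<le> 1 + \<bar>w - 1\<bar>" for n
  proof -
    have "S (Suc n) = 1 + (\<Sum>i<n. wt w z q (Suc i))"
      unfolding S_def sum.lessThan_Suc_shift by simp
    also have "(\<Sum>i<n. wt w z q (Suc i)) = z * S n + (w - 1) * (\<Sum>i<n. bterm w z q i)"
      using wt_Suc[of q _ w z, OF adm_digit_le[OF q_adm]]
      by (simp add: S_def sum.distrib sum_distrib_left)
    also have "(w - 1) * (\<Sum>i<n. bterm w z q i) \<le> \<bar>w - 1\<bar> * 1"
      using q1[of n] bterm_nonneg[OF wz(1,2)]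
      by (intro mult_mono) (auto intro: sum_nonneg)
    finally have "S (Suc n) \<le> 1 + z * S n + \<bar>w - 1\<bar>" by simp
    moreover have "S n \<le> S (Suc n)" unfolding S_def using wt_pos[OF wz(1,2), of q n] by simp
    ultimately show ?thesis by (simp add: algebra_simps)
  qed
  then show "(\<Sum>i<n. wt w z q i) \<le> (1 + \<bar>w - 1\<bar>) / (1 - z)" for n
    using wz by (simp add: S_def field_simps)
qed

text \<open>If the value at \<open>z\<close> is less than 1, then the weights stay bounded slightly beyond \<open>z\<close>:
  a long prefix of \<open>q\<close> is a prefix of small weight followed by an admissible word, and the latter
  decomposes into blocks that break off from \<open>q\<close> and have weight at most 1.\<close>

lemma wt_bounded_beyond:
  fixes w z :: real
  assumes wz: "0 < w" "0 < z" "z < 1" and q1: "\<And>n. (\<Sum>i<n. bterm w z q i) \<le> 1"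
    and less: "\<And>n. bterm w z q n < 1"
  obtains y C where "z < y" "y < 1" "\<And>n. wt w y q n \<le> C"
proof -
  have sm: "summable (wt w z q)" by (rule wt_summable) fact+
  then have lim: "wt w z q \<longlonglongrightarrow> 0" by (rule summable_LIMSEQ_zero)
  then have "Bseq (wt w z q)" by (intro convergent_imp_Bseq) (auto simp: convergent_def)
  then obtain K where K: "\<And>n. norm (wt w z q n) \<le> K" by (auto simp: Bseq_def)
  define C where "C = K + 1"
  have K_less: "wt w z q n < C" for n using K[of n] by (simp add: C_def)
  have C1: "C > 1" using K_less[of 0] by simp
  \<comment> \<open>The threshold 1/C lets a prefix of length \<open>N\<close> cancel the bound C
    for the word behind it.\<close>
  have "eventually (\<lambda>n. wt w z q n < 1 / C) sequentially"
    using lim C1 by (intro order_tendstoD) auto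
  then obtain N where N: "wt w z q N < 1 / C" by (auto simp: eventually_sequentially)
  have tends: "((\<lambda>y. wt w y q n) \<longlongrightarrow> wt w z q n) (at_right z)"
     "((\<lambda>y. bterm w y q n) \<longlongrightarrow> bterm w z q n) (at_right z)" for n
    unfolding wt_def bterm_def by (intro tendsto_intros)+
  have ev: "eventually (\<lambda>y. wt w y q n < C) (at_right z)"
    "eventually (\<lambda>y. bterm w y q n < 1) (at_right z)"
    "eventually (\<lambda>y. wt w y q N < 1 / C) (at_right z)" for n
    using order_tendstoD(2)[OF tends(1) K_less] order_tendstoD(2)[OF tends(2) less]
      order_tendstoD(2)[OF tends(1) N] by simp_all
  \<comment> \<open>Finitely many strict inequalities are imposed, so by continuity they all hold at
    some y > z.\<close>
  have "eventually (\<lambda>y. (\<forall>n\<in>{..<N}. wt w y q n < C) \<and> (\<forall>n\<in>{..<N}. bterm w y q n < 1) \<and>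
      wt w y q N < 1 / C \<and> y \<in> {z<..<1}) (at_right z)"
    using wz(3) by (intro eventually_conj eventually_ball_finite ballI ev eventually_at_right_real) auto
  then obtain y where y: "\<And>n. n < N \<Longrightarrow> wt w y q n < C" "\<And>n. n < N \<Longrightarrow> bterm w y q n < 1"
      "wt w y q N < 1 / C" "z < y" "y < 1"
    by (auto dest!: eventually_happens)
  have y0: "0 < y" using y wz by simp
  have "wt w y q n \<le> C \<and> bterm w y q n \<le> 1" for n
  proof (induction n rule: less_induct)
    case (less n)
    show ?case
    proof (cases "n < N")
      case True
      then show ?thesis using y by (auto simp: less_imp_le)
    next
      case False
      have 1: "wt w y q n \<le> 1"
      proof (cases "N = 0")
        case True
        with y(3) C1 show ?thesis by (simp add: field_simps)
      next
        case N0: False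
        have "wt w y q (N + (n - N)) = wt w y q N * wt w y (\<lambda>i. q (i + N)) (n - N)"
          by (rule wt_add)
        moreover have "wt w y (\<lambda>i. q (i + N)) (n - N) \<le> C"
          by (rule wt_bound[OF wz(1) y0 adm_shift[OF q_adm]])
             (use less.IH N0 False in \<open>simp_all del: One_nat_def\<close>)
        then have "wt w y q N * wt w y (\<lambda>i. q (i + N)) (n - N) \<le> (1 / C) * C"
          using y(3) C1 wt_pos[OF wz(1) y0, of "\<lambda>i. q (i + N)"] 
          by (intro mult_mono) (auto simp: less_imp_le)
        ultimately show ?thesis using False C1 by simp
      qed
      moreover have "bterm w y q n \<le> 1"
      proof -
        have "bterm w y q n \<le> 1 * (y * wt w y q n)"
          unfolding bterm_eq_wt using adm_digit_le[OF q_adm, of n] y0 wt_pos[OF wz(1) y0, of q n]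
          by (intro mult_right_mono) auto
        also have "\<dots> \<le> 1 * (1 * 1)"
          using 1 y y0 wt_pos[OF wz(1) y0, of q n] by (intro mult_mono) auto
        finally show ?thesis by simp
      qed
      ultimately show ?thesis using C1 by auto
    qed
  qed
  then show ?thesis using that y by blast
qed

text \<open>The root is the supremum of the z at which all partial sums are at most 1. If the sum
  were less than 1 there, the series would converge beyond z and be continuous at z, so the supremum
  could be enlarged.\<close>

lemma ex_root:
  fixes w :: real
  assumes w: "0 < w"
  obtains z where "0 < z" "z < 1" "bterm w z q sums 1"
proof -
  define S where "S = {z. 0 < z \<and> z < 1 \<and> (\<forall>n. (\<Sum>i<n. bterm w z q i) \<le> 1)}"
  define z where "z = Sup S"
  have bdd: "bdd_above S" by (auto simp: S_def intro!: bdd_aboveI[of _ 1])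
  \<comment> \<open>At this point the i-th term is at most (1/2)^(i+1), whatever the size of
    w.\<close>
  have ne: "1 / (2 * max 1 w) \<in> S"
  proof -
    define m where "m = max 1 w"
    have m: "1 \<le> m" "w \<le> m" by (auto simp: m_def)
    have "bterm w (1 / (2 * m)) q i \<le> (1/2) ^ Suc i" for i
    proof -
      have "bterm w (1 / (2 * m)) q i \<le> 1 * (m ^ ones q i * (1 / (2 * m)) ^ Suc i)"
        unfolding bterm_def using adm_digit_le[OF q_adm, of i] m w
        by (intro mult_mono power_mono) auto
      also have "m ^ ones q i \<le> m ^ Suc i"
        using m ones_le[of q i] adm_digit_le[OF q_adm] by (intro power_increasing) (auto simp: le_SucI)
      then have "1 * (m ^ ones q i * (1 / (2 * m)) ^ Suc i) \<le> 1 * (m ^ Suc i * (1 / (2 * m)) ^ Suc i)"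
        using m by (intro mult_mono) auto
      also have "\<dots> = (1/2) ^ Suc i"
        using m by (simp flip: power_mult_distrib del: power_Suc)
      finally show ?thesis .
    qed
    then have "(\<Sum>i<n. bterm w (1 / (2 * m)) q i) \<le> (\<Sum>i<n. (1/2) ^ Suc i)" for n
      by (rule sum_mono)
    moreover have "(\<Sum>i<n. (1/2::real) ^ Suc i) \<le> 1" for n
      using sum_le_suminf[of "\<lambda>i. (1/2::real) ^ Suc i" "{..<n}"] power_half_series
      by (auto simp: sums_iff)
    ultimately have "(\<Sum>i<n. bterm w (1 / (2 * m)) q i) \<le> 1" for n by (meson order_trans)
    then show ?thesis using m unfolding S_def m_def[symmetric] by auto
  qed
  have z0: "0 < z"
  proof -
    have "0 < 1 / (2 * max 1 w)" by (intro divide_pos_pos) auto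
    also have "\<dots> \<le> z" unfolding z_def using ne bdd by (rule cSup_upper)
    finally show ?thesis .
  qed
  have mono: "bterm w x q n \<le> bterm w y q n" if "0 < x" "x \<le> y" for x y n
    unfolding bterm_def using that w by (intro mult_left_mono power_mono) auto
  have in_S: "(\<Sum>i<n. bterm w y q i) \<le> 1" if "0 < y" "y < z" for y n
  proof -
    have "\<exists>x\<in>S. y < x" using less_cSup_iff[of S y] bdd that ne unfolding z_def by blast
    then obtain x where "x \<in> S" "y < x" by blast
    then have "(\<Sum>i<n. bterm w y q i) \<le> (\<Sum>i<n. bterm w x q i)"
      using that by (intro sum_mono mono) auto
    also have "\<dots> \<le> 1" using \<open>x \<in> S\<close> by (simp add: S_def)
    finally show ?thesis .
  qed
  have q1: "(\<Sum>i<n. bterm w z q i) \<le> 1" for n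
  proof (rule tendsto_upperbound)
    show "((\<lambda>y. \<Sum>i<n. bterm w y q i) \<longlongrightarrow> (\<Sum>i<n. bterm w z q i)) (at_left z)"
      unfolding bterm_def by (intro tendsto_intros)
    show "eventually (\<lambda>y. (\<Sum>i<n. bterm w y q i) \<le> 1) (at_left z)"
      using eventually_at_left_real[OF z0] by eventually_elim (auto intro: in_S)
  qed auto
  \<comment> \<open>A second 1 in \<open>q\<close> excludes z \<ge> 1, because the digit
    \<open>q 0\<close> alone contributes z.\<close>
  obtain m where m: "m \<ge> 1" "q m = 1" using q_inf by blast
  have two: "bterm w z q 0 + bterm w z q m \<le> 1" if "0 < z" "\<And>n. (\<Sum>i<n. bterm w z q i) \<le> 1" for z
  proof -
    have "(\<Sum>i\<in>{0,m}. bterm w z q i) \<le> (\<Sum>i<Suc m. bterm w z q i)"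
      using bterm_nonneg[OF w that(1)] by (intro sum_mono2) auto
    with that(2)[of "Suc m"] m show ?thesis by simp
  qed
  have "z < 1"
  proof (rule ccontr)
    assume "\<not> z < 1"
    then have "bterm w 1 q 0 + bterm w 1 q m \<le> 1"
      using mono[of 1 z 0] mono[of 1 z m] two[OF z0 q1] by linarith
    then show False using w m q_0 zero_less_power[OF w, of "ones q m"] by (simp add: bterm_def)
  qed
  have sm: "summable (bterm w z q)"
    using bterm_nonneg[OF w z0] q1 by (intro summableI_nonneg_bounded[of _ 1])
  have "suminf (bterm w z q) \<le> 1" by (rule suminf_le_const[OF sm q1])
  moreover have "\<not> suminf (bterm w z q) < 1"
  proof
    assume less: "suminf (bterm w z q) < 1"
    have "bterm w z q n < 1" for n
      using sum_le_suminf[OF sm, of "{n}"] bterm_nonneg[OF w z0] less by auto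
    then obtain y C where y: "z < y" "y < 1" "\<And>n. wt w y q n \<le> C"
      using wt_bounded_beyond[OF w z0 \<open>z < 1\<close> q1] by metis
    \<comment> \<open>The weights are bounded at y, so comparison with a geometric series gives
      convergence at the smaller point x, and hence continuity at z.\<close>
    define x where "x = (z + y) / 2"
    have x: "z < x" "x < y" using y by (auto simp: x_def)
    define c where "c n = of_nat (q n) * w ^ ones q n" for n
    have c0: "0 \<le> c n" for n using w by (simp add: c_def)
    have bc: "bterm w u q n = u * (c n * u ^ n)" for u n
      by (simp add: bterm_def c_def)
    have C0: "0 \<le> C" using y(3)[of 0] by simp
    have "summable (\<lambda>n. c n * x ^ n)"
    proof (rule summable_comparison_test')
      show "summable (\<lambda>n. C * (x / y) ^ n)"
        using x z0 by (intro summable_mult summable_geometric) auto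
      fix n
      have "c n * y ^ n \<le> 1 * wt w y q n"
        unfolding c_def wt_def mult.assoc using adm_digit_le[OF q_adm, of n] w x z0
        by (intro mult_right_mono) auto
      also have "\<dots> \<le> C" using y(3) by simp
      finally have "c n * y ^ n * (x / y) ^ n \<le> C * (x / y) ^ n"
        using x z0 by (intro mult_right_mono) auto
      moreover have "c n * y ^ n * (x / y) ^ n = c n * x ^ n"
        using x z0 by (simp add: power_divide)
      ultimately show "norm (c n * x ^ n) \<le> C * (x / y) ^ n"
        using c0[of n] x z0 by simp
    qed
    then have sx: "summable (\<lambda>n. c n * u ^ n)" and cont: "isCont (\<lambda>u. \<Sum>n. c n * u ^ n) u"
      if "0 < u" "u < x" for u
      using that by (auto intro: powser_inside isCont_powser)
    have "((\<lambda>u. u * (\<Sum>n. c n * u ^ n)) \<longlongrightarrow> z * (\<Sum>n. c n * z ^ n)) (at_right z)"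
      using cont[OF z0 x(1)] by (intro tendsto_intros) (auto simp: isCont_def intro: tendsto_within_subset)
    moreover have "z * (\<Sum>n. c n * z ^ n) < 1"
      using less sx[OF z0 x(1)] by (simp add: bc[abs_def] suminf_mult)
    ultimately have "eventually (\<lambda>u. u * (\<Sum>n. c n * u ^ n) < 1) (at_right z)"
      by (rule order_tendstoD)
    moreover have "eventually (\<lambda>u. u \<in> {z<..<x}) (at_right z)"
      using x by (intro eventually_at_right_real)
    ultimately have "eventually (\<lambda>u. u * (\<Sum>n. c n * u ^ n) < 1 \<and> u \<in> {z<..<x}) (at_right z)"
      by (rule eventually_conj)
    then obtain u where u: "u * (\<Sum>n. c n * u ^ n) < 1" "z < u" "u < x"
      by (auto dest!: eventually_happens)
    then have u0: "0 < u" using z0 by simp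
    have su: "summable (bterm w u q)" "suminf (bterm w u q) < 1"
      using sx[OF u0 u(3)] u(1) by (auto simp: bc[abs_def] suminf_mult intro: summable_mult)
    have "(\<Sum>i<n. bterm w u q i) \<le> 1" for n
      using sum_le_suminf[OF su(1), of "{..<n}"] bterm_nonneg[OF w u0] su(2) by simp
    then have "u \<in> S" using u x y u0 by (simp add: S_def)
    then have "u \<le> z" unfolding z_def using bdd by (rule cSup_upper)
    with u show False by simp
  qed
  ultimately have "bterm w z q sums 1"
    using sm by (simp add: sums_iff)
  then show ?thesis using that z0 \<open>z < 1\<close> by blast
qed

end

section \<open>Itineraries\<close>

text \<open>The condition \<open>w * z < 1\<close> makes the second branch of \<open>T\<close>
  expanding and lets the weights of all digit sequences decay at a common geometric rate.\<close>

locale weighted = self_admissible +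
  fixes w z :: real
  assumes w_pos: "0 < w" and z_pos: "0 < z" and z_less: "z < 1" and wz_less: "w * z < 1"
    and root: "bterm w z q sums 1"
begin

definition T :: "real \<Rightarrow> real" where
  "T u = (if u < z then u / z else (u / z - 1) / w)"

definition itin :: "real \<Rightarrow> digits" where
  "itin u n = (if (T ^^ n) u < z then 0 else 1)"

definition val :: "digits \<Rightarrow> real" where
  "val a = (\<Sum>n. bterm w z a n)"

lemma bterm_ge0 [simp]: "0 \<le> bterm w z a n"
  by (rule bterm_nonneg[OF w_pos z_pos])

lemma wt_gt0 [simp]: "0 < wt w z a n"
  by (rule wt_pos[OF w_pos z_pos])

lemma wt_ge0 [simp]: "0 \<le> wt w z a n"
  by (rule less_imp_le[OF wt_gt0])

text \<open>Behind every prefix of \<open>q\<close> another 1 follows. The strictness is what puts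
  the values of finite sequences below 1.\<close>

lemma sum_bterm_q_less: "(\<Sum>i<n. bterm w z q i) < 1"
proof -
  obtain m where m: "m \<ge> n" "q m = 1" using q_inf by blast
  have "(\<Sum>i<n. bterm w z q i) \<le> (\<Sum>i<m. bterm w z q i)"
    using m by (intro sum_mono2) auto
  also have "\<dots> < (\<Sum>i<Suc m. bterm w z q i)"
    using m z_pos by (simp add: bterm_eq_wt)
  also have "\<dots> \<le> 1"
    using root sum_le_suminf[of "bterm w z q" "{..<Suc m}"] by (simp add: sums_iff)
  finally show ?thesis .
qed

lemma sum_bterm_less: "a \<in> X \<Longrightarrow> (\<Sum>i<n. bterm w z a i) < 1"
  using sum_bterm_le[OF w_pos z_pos less_imp_le[OF sum_bterm_q_less], of a n] sum_bterm_q_less[of n]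
  by simp

lemma summable_bterm: "a \<in> X \<Longrightarrow> summable (bterm w z a)"
  by (rule summableI_nonneg_bounded[of _ 1]) (auto intro: less_imp_le sum_bterm_less)

lemma val_le_1: "a \<in> X \<Longrightarrow> val a \<le> 1"
  unfolding val_def by (intro suminf_le_const summable_bterm less_imp_le sum_bterm_less)

lemma val_ge_0: "a \<in> X \<Longrightarrow> 0 \<le> val a"
  unfolding val_def by (intro suminf_nonneg summable_bterm) auto

lemma val_q: "val q = 1"
  using root by (simp add: val_def sums_iff)

lemma val_split:
  assumes "a \<in> X"
  shows "val a = (\<Sum>i<n. bterm w z a i) + wt w z a n * val (\<lambda>i. a (i + n))"
proof -
  have "val a = (\<Sum>i. bterm w z a (i + n)) + (\<Sum>i<n. bterm w z a i)"
    unfolding val_def by (rule suminf_split_initial_segment[OF summable_bterm[OF assms]])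
  also have "(\<Sum>i. bterm w z a (i + n)) = wt w z a n * val (\<lambda>i. a (i + n))"
    unfolding val_def using bterm_add[of w z a n]
    by (subst suminf_mult[symmetric, OF summable_bterm[OF adm_shift[OF assms]]])
       (simp add: add.commute)
  finally show ?thesis by simp
qed

lemma wt_le_power: "(\<And>i. a i \<le> 1) \<Longrightarrow> wt w z a n \<le> (max 1 w * z) ^ n"
proof -
  assume a: "\<And>i. a i \<le> 1"
  have "w ^ ones a n \<le> max 1 w ^ ones a n"
    using w_pos by (intro power_mono) auto
  also have "\<dots> \<le> max 1 w ^ n"
    using ones_le[of a n] a by (intro power_increasing) auto
  finally show ?thesis
    unfolding wt_def power_mult_distrib using z_pos by (intro mult_right_mono) auto
qed

lemma wt_tendsto_0:
  assumes "\<And>i. a i \<le> 1"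
  shows "wt w z a \<longlonglongrightarrow> 0"
proof (rule Lim_null_comparison)
  show "eventually (\<lambda>n. norm (wt w z a n) \<le> (max 1 w * z) ^ n) sequentially"
    using wt_le_power[OF assms] by (auto intro: always_eventually)
  show "(\<lambda>n. (max 1 w * z) ^ n) \<longlonglongrightarrow> 0"
    using wz_less z_pos z_less by (intro LIMSEQ_power_zero) (auto simp: max_def)
qed

lemma T_bounds:
  assumes "0 \<le> u" "u < 1"
  shows "0 \<le> T u" "T u < 1"
proof -
  show "0 \<le> T u" using assms z_pos w_pos by (auto simp: T_def field_simps)
  \<comment> \<open>The second branch stays below 1 because 1 - z \<le> w z, which is read off from
    the value of \<open>q\<close> split after its first digit.\<close>
  have "1 = z + w * z * val (\<lambda>i. q (i + 1))"
    using val_split[OF q_adm, of 1] q_0 val_q by (simp add: bterm_def wt_def ones_Suc)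
  also have "\<dots> \<le> z + w * z * 1"
    using val_le_1[OF adm_shift[OF q_adm, of 1]] w_pos z_pos by (intro add_left_mono mult_left_mono) auto
  finally have "1 - z \<le> w * z" by simp
  then show "T u < 1" using assms z_pos w_pos by (auto simp: T_def field_simps)
qed

lemma T_funpow_bounds:
  assumes "0 \<le> u" "u < 1"
  shows "0 \<le> (T ^^ n) u" "(T ^^ n) u < 1"
  using assms T_bounds by (induction n) auto

lemma itin_digit: "itin u n = 0 \<or> itin u n = 1"
  by (simp add: itin_def)

lemma itin_shift: "(\<lambda>i. itin u (i + n)) = itin ((T ^^ n) u)"
  by (simp add: itin_def fun_eq_iff funpow_add)

lemma itin_expansion: "u = (\<Sum>i<n. bterm w z (itin u) i) + wt w z (itin u) n * (T ^^ n) u"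
proof (induction n)
  case (Suc n)
  have "wt w z (itin u) n * (T ^^ n) u = bterm w z (itin u) n + wt w z (itin u) (Suc n) * (T ^^ Suc n) u"
    using w_pos z_pos by (auto simp: bterm_def wt_def ones_Suc itin_def T_def field_simps)
  with Suc show ?case by simp
qed simp

lemma sum_bterm_itin_le: "0 \<le> u \<Longrightarrow> u < 1 \<Longrightarrow> (\<Sum>i<n. bterm w z (itin u) i) \<le> u"
  using itin_expansion[of u n] T_funpow_bounds(1)[of u n] wt_ge0[of "itin u" n]
  by (smt (verit) mult_nonneg_nonneg)

lemma itin_sums:
  assumes "0 \<le> u" "u < 1"
  shows "bterm w z (itin u) sums u"
proof -
  have "(\<lambda>n. wt w z (itin u) n * (T ^^ n) u) \<longlonglongrightarrow> 0"
  proof (rule Lim_null_comparison[OF _ wt_tendsto_0])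
    show "eventually (\<lambda>n. norm (wt w z (itin u) n * (T ^^ n) u) \<le> wt w z (itin u) n) sequentially"
      using T_funpow_bounds[OF assms]
      by (intro always_eventually allI) (auto simp: abs_mult mult_left_le less_imp_le)
  qed (auto simp: itin_def)
  then have "(\<lambda>n. u - wt w z (itin u) n * (T ^^ n) u) \<longlonglongrightarrow> u - 0"
    by (intro tendsto_intros)
  moreover have "u - wt w z (itin u) n * (T ^^ n) u = (\<Sum>i<n. bterm w z (itin u) i)" for n
    using itin_expansion[of u n] by linarith
  ultimately show ?thesis by (simp add: sums_def)
qed

lemma val_itin: "0 \<le> u \<Longrightarrow> u < 1 \<Longrightarrow> val (itin u) = u"
  using itin_sums by (simp add: val_def sums_iff)

text \<open>Tails have value at most 1, so a prefix followed by 0 is worth no more than the same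
  prefix followed by 1000... Monotonicity of \<open>val\<close> and admissibility of itineraries
  rest on this.\<close>

lemma val_le_at_0:
  assumes "a \<in> X" "a n = 0"
  shows "val a \<le> (\<Sum>i<n. bterm w z a i) + z * wt w z a n"
proof -
  have "val a = (\<Sum>i<Suc n. bterm w z a i) + wt w z a (Suc n) * val (\<lambda>i. a (i + Suc n))"
    by (rule val_split) fact
  also have "\<dots> = (\<Sum>i<n. bterm w z a i) + z * wt w z a n * val (\<lambda>i. a (i + Suc n))"
    using assms(2) by (simp add: bterm_def wt_def ones_Suc)
  also have "\<dots> \<le> (\<Sum>i<n. bterm w z a i) + z * wt w z a n * 1"
    using val_le_1[OF adm_shift[OF assms(1), of "Suc n"]] z_pos
    by (intro add_left_mono mult_left_mono) auto
  finally show ?thesis by simp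
qed

lemma sum_bterm_Suc_at_1:
  assumes "\<And>i. i < n \<Longrightarrow> a i = b i" "a n = 1"
  shows "(\<Sum>i<Suc n. bterm w z a i) = (\<Sum>i<n. bterm w z b i) + z * wt w z b n"
proof -
  have "(\<Sum>i<n. bterm w z a i) = (\<Sum>i<n. bterm w z b i)"
    using assms(1) by (intro sum.cong bterm_cong) auto
  moreover have "wt w z a n = wt w z b n" using assms(1) by (rule wt_cong)
  ultimately show ?thesis using assms(2) by (simp add: bterm_eq_wt)
qed

lemma val_mono:
  assumes "a \<in> X" "b \<in> X" "a \<preceq> b"
  shows "val a \<le> val b"
proof (cases "a = b")
  case False
  then obtain n where n: "\<And>i. i < n \<Longrightarrow> a i = b i" "a n = 0" "b n = 1"
    using adm_first_diff[OF assms] by metis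
  have "val a \<le> (\<Sum>i<n. bterm w z a i) + z * wt w z a n"
    using assms(1) n(2) by (rule val_le_at_0)
  also have "\<dots> = (\<Sum>i<Suc n. bterm w z b i)"
    using n by (subst sum_bterm_Suc_at_1[of n b a]) auto
  also have "\<dots> \<le> val b"
    unfolding val_def using assms(2) by (intro sum_le_suminf summable_bterm) auto
  finally show ?thesis .
qed simp

lemma itin_adm:
  assumes "0 \<le> u" "u < 1"
  shows "itin u \<in> X"
proof -
  have *: "itin u \<preceq> q" if u: "0 \<le> u" "u < 1" for u
  proof (rule ccontr)
    assume "\<not> itin u \<preceq> q"
    then obtain n where n: "\<forall>i<n. itin u i = q i" "q n < itin u n" 
      by (auto simp: not_lex_le_iff)
    then have n': "q n = 0" "itin u n = 1" using itin_digit[of u n] by auto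
    have "1 \<le> (\<Sum>i<n. bterm w z q i) + z * wt w z q n"
      using val_le_at_0[OF q_adm n'(1)] by (simp add: val_q)
    also have "\<dots> = (\<Sum>i<Suc n. bterm w z (itin u) i)"
      using n n' by (subst sum_bterm_Suc_at_1[of n "itin u" q]) auto
    also have "\<dots> \<le> u" using u by (rule sum_bterm_itin_le)
    finally show False using u by simp
  qed
  have "(\<lambda>i. itin u (i + n)) \<preceq> q" for n
    unfolding itin_shift by (rule *[OF T_funpow_bounds[OF assms]])
  then show ?thesis
    using itin_digit by (simp add: adm_def)
qed

text \<open>A sequence above \<open>itin u\<close> has value strictly greater than u, because
  \<open>T\<close> keeps the remainder strictly below 1. A second sequence of value u can therefore
  only lie below the itinerary.\<close>

lemma val_le_iff:
  assumes a: "a \<in> X" and u: "0 \<le> u" "u < 1"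
  shows "val a \<le> u \<longleftrightarrow> a \<preceq> itin u"
proof
  assume le: "val a \<le> u"
  show "a \<preceq> itin u"
  proof (rule ccontr)
    assume "\<not> a \<preceq> itin u"
    then have "itin u \<preceq> a" "itin u \<noteq> a" using lex_le_linear by auto
    then obtain n where n: "\<And>i. i < n \<Longrightarrow> itin u i = a i" "itin u n = 0" "a n = 1"
      using adm_first_diff[OF itin_adm[OF u] a] by metis
    have "u = (\<Sum>i<n. bterm w z (itin u) i) + z * wt w z (itin u) n * (T ^^ Suc n) u"
      using itin_expansion[of u "Suc n"] n(2) by (simp add: bterm_def wt_def ones_Suc mult_ac)
    also have "\<dots> < (\<Sum>i<n. bterm w z (itin u) i) + z * wt w z (itin u) n * 1"
      using T_funpow_bounds(2)[OF u, of "Suc n"] z_pos by (intro add_strict_left_mono mult_strict_left_mono) auto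
    also have "\<dots> = (\<Sum>i<Suc n. bterm w z a i)"
      using n by (subst sum_bterm_Suc_at_1[of n a "itin u"]) auto
    also have "\<dots> \<le> val a"
      unfolding val_def using a by (intro sum_le_suminf summable_bterm) auto
    finally show False using le by simp
  qed
next
  assume "a \<preceq> itin u"
  then show "val a \<le> u"
    using val_mono[OF a itin_adm[OF u]] val_itin[OF u] by simp
qed

lemma val_less_1_finite:
  assumes "a \<in> X" "\<And>i. i \<ge> n \<Longrightarrow> a i = 0"
  shows "val a < 1"
proof -
  have "val a = (\<Sum>i<n. bterm w z a i)"
    unfolding val_def using assms(2) by (intro suminf_finite) (auto simp: bterm_def not_less)
  then show ?thesis using sum_bterm_less[OF assms(1)] by simp
qed

text \<open>\<open>T\<close> acts as the shift on values. The obstruction is a tail of value 1: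
  behind a 0 it would be read as the digit 1 followed by zeros.\<close>

lemma itin_val:
  assumes a: "a \<in> X" and less: "\<And>n. val (\<lambda>i. a (i + n)) < 1"
  shows "itin (val a) = a"
proof -
  have digit: "itin (val b) 0 = b 0 \<and> T (val b) = val (\<lambda>i. b (i + 1))"
    if b: "b \<in> X" "val (\<lambda>i. b (i + 1)) < 1" for b
  proof -
    define v where "v = val (\<lambda>i. b (i + 1))"
    have "val b = real (b 0) * z + w ^ b 0 * z * v"
      using val_split[OF b(1), of 1] by (simp add: bterm_def wt_def ones_Suc v_def)
    moreover have "0 \<le> w * (z * v)" 
      using val_ge_0[OF adm_shift[OF b(1), of 1]] w_pos z_pos by (simp add: v_def)
    moreover have "z * v < z" using b(2) z_pos by (simp add: v_def)
    moreover have "b 0 = 0 \<or> b 0 = 1" by (rule adm_digit[OF b(1)])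
    ultimately have "itin (val b) 0 = b 0 \<and> T (val b) = v"
    proof (elim disjE)
      assume "val b = real (b 0) * z + w ^ b 0 * z * v" "0 \<le> w * (z * v)" "b 0 = 1"
      then have "val b = z + w * (z * v)" "\<not> val b < z" by auto
      then show ?thesis
        using z_pos w_pos \<open>b 0 = 1\<close> by (simp add: itin_def T_def add_divide_distrib)
    qed (use z_pos in \<open>simp add: itin_def T_def\<close>)
    then show ?thesis by (simp add: v_def)
  qed
  have T: "(T ^^ n) (val a) = val (\<lambda>i. a (i + n))" for n
  proof (induction n)
    case (Suc n)
    then show ?case using digit[OF adm_shift[OF a, of n]] less[of "Suc n"] by (simp add: add.assoc)
  qed simp
  show ?thesis
  proof
    fix n
    have "itin (val a) n = itin ((T ^^ n) (val a)) 0" by (simp add: itin_def)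
    also have "\<dots> = a n"
      unfolding T using digit[OF adm_shift[OF a, of n]] less[of "Suc n"] by simp
    finally show "itin (val a) n = a n" .
  qed
qed

lemma itin_val_finite:
  assumes "a \<in> X" "\<And>i. i \<ge> n \<Longrightarrow> a i = 0"
  shows "itin (val a) = a"
proof (rule itin_val[OF assms(1)])
  fix k
  have "a (i + k) = 0" if "i \<ge> n" for i
    using that assms(2) by simp
  then show "val (\<lambda>i. a (i + k)) < 1"
    by (rule val_less_1_finite[OF adm_shift[OF assms(1)]])
qed

text \<open>Needed because eigenfunctions are taken modulo countable sets: a positive function on
  \<open>X\<close> must not count as zero.\<close>

lemma uncountable_adm: "uncountable X"
proof
  assume "countable X"
  then have "countable (itin ` {0<..<1})"
    by (rule countable_subset[rotated]) (auto intro: itin_adm)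
  moreover have "inj_on itin {0<..<1}"
    by (rule inj_on_inverseI[of _ val]) (auto intro: val_itin)
  ultimately have "countable {0<..<1::real}" by (rule countable_image_inj_on)
  then show False using uncountable_open_interval[of "0::real" 1] by simp
qed

end

section \<open>The leading eigenvalue\<close>

context beta_base
begin

text \<open>For w = 1 and z = 1/\<beta> the map \<open>T\<close> is the beta-map on [0,1), so the
  results on itineraries apply to greedy expansions.\<close>

sublocale greedy: weighted q 1 "1 / \<beta>"
proof
  have "bterm 1 (1 / \<beta>) q = (\<lambda>n. real (q n) / \<beta> ^ Suc n)"
    by (simp add: bterm_def fun_eq_iff power_one_over)
  then show "bterm 1 (1 / \<beta>) q sums 1" using q_sums by simp
qed (use beta_gt in auto)

lemma transfer_op_eq:
  assumes x: "x \<in> X"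
  shows "transfer_op \<beta> t f x =
    f (case_nat 0 x) + (if x \<preceq> shift q then of_real (exp t) * f (case_nat 1 x) else 0)"
proof -
  have eq: "{y \<in> X. shift y = x} = (if x \<preceq> shift q then {case_nat 0 x, case_nat 1 x} else {case_nat 0 x})"
    (is "?L = ?R")
  proof (intro equalityI subsetI)
    fix y assume y: "y \<in> ?L"
    then have "y = case_nat (y 0) x" using case_nat_shift[of y] by simp
    moreover have "y 0 = 0 \<or> y 0 = 1" using y adm_digit by auto
    ultimately show "y \<in> ?R" using y case_nat_1_adm_iff[OF x] by (auto split: if_splits)
  next
    fix y assume "y \<in> ?R"
    then show "y \<in> ?L"
      using case_nat_0_adm[OF x] case_nat_1_adm_iff[OF x] by (auto split: if_splits)
  qed
  have "case_nat 0 x \<noteq> case_nat (1::nat) x"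
    by (metis old.nat.simps(4) zero_neq_one)
  then show ?thesis
    unfolding transfer_op_def beta_shift_eq eq
    using case_nat_0_adm[OF x] case_nat_1_adm_iff[OF x]
    by (auto simp: cyl1_def beta_shift_eq indicator_def)
qed

text \<open>The endpoints of the intervals in the eigenfunction are the shifts of \<open>q\<close>, because
  \<open>x \<preceq> shift q\<close> decides whether \<open>x\<close> has a preimage starting with 1.\<close>

lemma case_nat_le_shift_q:
  shows "case_nat 0 x \<preceq> (\<lambda>i. q (i + n)) \<longleftrightarrow> q n = 1 \<or> x \<preceq> (\<lambda>i. q (i + Suc n))"
    and "x \<preceq> shift q \<and> case_nat 1 x \<preceq> (\<lambda>i. q (i + n)) \<longleftrightarrow> q n = 1 \<and> x \<preceq> (\<lambda>i. q (i + Suc n))"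
proof -
  have sh: "shift (\<lambda>i. q (i + n)) = (\<lambda>i. q (i + Suc n))" by (simp add: shift_def)
  have q01: "q n = 0 \<or> q n = 1" using adm_digit[OF q_adm] .
  then show "case_nat 0 x \<preceq> (\<lambda>i. q (i + n)) \<longleftrightarrow> q n = 1 \<or> x \<preceq> (\<lambda>i. q (i + Suc n))"
    by (subst lex_le_Suc) (auto simp: sh)
  have "(\<lambda>i. q (i + Suc n)) \<preceq> shift q" if "q n = 1"
  proof -
    have "(\<lambda>i. q (i + n)) \<preceq> q" using q_adm by (simp add: adm_def)
    then show ?thesis using that q_0 by (subst (asm) lex_le_Suc) (simp add: sh)
  qed
  then show "x \<preceq> shift q \<and> case_nat 1 x \<preceq> (\<lambda>i. q (i + n)) \<longleftrightarrow> q n = 1 \<and> x \<preceq> (\<lambda>i. q (i + Suc n))"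
    using q01 lex_le_trans[of x "\<lambda>i. q (i + Suc n)" "shift q"]
    by (subst (2) lex_le_Suc) (auto simp: sh)
qed

end

section \<open>The explicit eigenfunction\<close>

locale beta_eigen = beta_base +
  fixes t z :: real
  assumes z_pos: "0 < z" and z_less: "z < 1" and root: "bterm (exp t) z q sums 1"
begin

abbreviation "wq \<equiv> wt (exp t) z q"

definition eterm :: "digits \<Rightarrow> nat \<Rightarrow> real" where
  "eterm x n = z * wq n * of_bool (x \<preceq> (\<lambda>i. q (i + n)))"

definition efun :: "digits \<Rightarrow> real" where
  "efun x = (\<Sum>n. eterm x n)"

lemma summable_wq: "summable wq"
proof (rule wt_summable)
  show "(\<Sum>i<n. bterm (exp t) z q i) \<le> 1" for n
    using root sum_le_suminf[of "bterm (exp t) z q" "{..<n}"] bterm_nonneg[of "exp t" z] z_pos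
    by (simp add: sums_iff)
qed (use z_pos z_less in auto)

lemma wq_pos: "0 < wq n"
  using wt_pos z_pos by simp

lemma eterm_bounds: "0 \<le> eterm x n" "eterm x n \<le> z * wq n"
  unfolding eterm_def using wq_pos[of n] z_pos by auto

lemma summable_eterm: "summable (eterm x)"
  by (rule summable_comparison_test'[OF summable_mult[OF summable_wq, of z]])
     (use eterm_bounds in auto)

lemma eterm_0: "x \<in> X \<Longrightarrow> eterm x 0 = z"
  by (simp add: eterm_def adm_le)

lemma efun_ge: "x \<in> X \<Longrightarrow> z \<le> efun x"
  using sum_le_suminf[OF summable_eterm, of "{0}" x] eterm_bounds(1) eterm_0[of x]
  by (simp add: efun_def)

text \<open>Termwise, the operator turns the n-th indicator into the next one plus the constant
  \<open>bterm (exp t) z q n\<close>. By the choice of z these constants sum to 1, which restores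
  the missing term n = 0.\<close>

lemma transfer_efun:
  assumes x: "x \<in> X"
  shows "efun (case_nat 0 x) + (if x \<preceq> shift q then exp t * efun (case_nat 1 x) else 0) = efun x / z"
proof -
  have tm: "eterm (case_nat 0 x) n + of_bool (x \<preceq> shift q) * exp t * eterm (case_nat 1 x) n =
      bterm (exp t) z q n + eterm x (Suc n) / z" for n
  proof -
    have q01: "q n = 0 \<or> q n = 1" using adm_digit[OF q_adm] .
    have 1: "of_bool (x \<preceq> shift q) * exp t * eterm (case_nat 1 x) n =
        exp t * (z * wq n * of_bool (x \<preceq> shift q \<and> case_nat 1 x \<preceq> (\<lambda>i. q (i + n))))"
      by (simp add: eterm_def)
    show ?thesis
      unfolding 1 unfolding case_nat_le_shift_q(2) eterm_def case_nat_le_shift_q(1)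
      using q01 z_pos by (auto simp: bterm_def wt_def ones_Suc)
  qed
  have "(\<lambda>n. eterm (case_nat 0 x) n + of_bool (x \<preceq> shift q) * exp t * eterm (case_nat 1 x) n) sums
     (efun (case_nat 0 x) + of_bool (x \<preceq> shift q) * exp t * efun (case_nat 1 x))"
    unfolding efun_def by (intro sums_add sums_mult summable_sums summable_eterm)
  moreover have "(\<lambda>n. bterm (exp t) z q n + eterm x (Suc n) / z) sums (1 + (efun x - eterm x 0) / z)"
    using summable_sums[OF summable_eterm[of x]]
    by (intro sums_add root sums_divide) (simp add: efun_def sums_Suc_iff)
  ultimately have "efun (case_nat 0 x) + of_bool (x \<preceq> shift q) * exp t * efun (case_nat 1 x) =
      1 + (efun x - eterm x 0) / z"
    unfolding tm by (rule sums_unique2)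
  then show ?thesis using eterm_0[OF x] z_pos by (auto simp: diff_divide_distrib)
qed

text \<open>A tail of the series is non-negative and decreasing in \<open>x\<close>, so its
  variation is bounded by its small supremum.\<close>

lemma efun_in_bv_closure: "(\<lambda>x. complex_of_real (efun x)) \<in> bv_closure \<beta>"
  unfolding bv_closure_def
proof (intro CollectI allI impI)
  fix \<epsilon> :: ennreal assume eps: "0 < \<epsilon>"
  obtain e where e: "0 < e" "ennreal e \<le> \<epsilon>"
  proof (cases \<epsilon>)
    case (real r)
    with eps that[of r] show ?thesis by auto
  qed (use that[of 1] in auto)
  have sm: "summable (\<lambda>n. z * wq n)" by (intro summable_mult summable_wq)
  have "(\<lambda>N. \<Sum>n. z * wq (n + N)) \<longlonglongrightarrow> 0"
    by (rule suminf_exist_split2[OF sm])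
  then have "eventually (\<lambda>N. (\<Sum>n. z * wq (n + N)) < e / 3) sequentially"
    using e by (intro order_tendstoD) auto
  then obtain N where N: "(\<Sum>n. z * wq (n + N)) < e / 3" by (auto simp: eventually_sequentially)
  define R where "R x = (\<Sum>n. eterm x (n + N))" for x
  have R_split: "efun x = R x + (\<Sum>n<N. eterm x n)" for x
    unfolding efun_def R_def by (rule suminf_split_initial_segment[OF summable_eterm])
  have smN: "summable (\<lambda>n. eterm x (n + N))" for x by (rule summable_ignore_initial_segment[OF summable_eterm])
  have R0: "0 \<le> R x" for x
    unfolding R_def by (intro suminf_nonneg smN eterm_bounds)
  have R_le: "R x \<le> e / 3" for x
  proof -
    have "R x \<le> (\<Sum>n. z * wq (n + N))"
      unfolding R_def by (intro suminf_le smN eterm_bounds summable_ignore_initial_segment[OF sm])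
    then show ?thesis using N by simp
  qed
  have R_anti: "R y \<le> R x" if "x \<preceq> y" for x y
    unfolding R_def
  proof (intro suminf_le smN)
    fix n
    show "eterm y (n + N) \<le> eterm x (n + N)"
      unfolding eterm_def using lex_le_trans[OF that] wq_pos[of "n + N"] z_pos by auto
  qed
  define g where "g n = (\<lambda>i::nat. 0::nat, \<lambda>i. q (i + n))" for n
  \<comment> \<open>Different n give the same interval when \<open>q\<close> is eventually periodic.
    The span is indexed by a set of intervals, so coefficients are collected over each fibre of
    \<open>g\<close>.\<close>
  define c where "c a b = (\<Sum>n\<in>{n \<in> {..<N}. g n = (a, b)}. complex_of_real (z * wq n))" for a b
  define s where "s x = (\<Sum>(a, b)\<in>g ` {..<N}. c a b * indicator (seq_interval \<beta> a b) x)" for x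
  have s_span: "s \<in> interval_span \<beta>"
    unfolding interval_span_def
  proof (intro CollectI exI conjI)
    show "g ` {..<N} \<subseteq> beta_shift \<beta> \<times> beta_shift \<beta>"
      unfolding beta_shift_eq g_def using zero_adm adm_shift[OF q_adm] by auto
    show "s = (\<lambda>x. \<Sum>(a, b)\<in>g ` {..<N}. c a b * indicator (seq_interval \<beta> a b) x)"
      by (simp add: s_def fun_eq_iff)
  qed simp
  have s_eq: "s x = complex_of_real (\<Sum>n<N. eterm x n)" if x: "x \<in> X" for x
  proof -
    have "complex_of_real (\<Sum>n<N. eterm x n) =
        (\<Sum>y\<in>g ` {..<N}. \<Sum>n\<in>{n \<in> {..<N}. g n = y}. complex_of_real (eterm x n))"
      unfolding of_real_sum by (rule sum.image_gen) simp
    also have "\<dots> = s x"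
      unfolding s_def
    proof (intro sum.cong refl)
      fix y assume "y \<in> g ` {..<N}"
      obtain a b where y: "y = (a, b)" by (cases y)
      have "complex_of_real (eterm x n) = of_real (z * wq n) * indicator (seq_interval \<beta> a b) x"
        if "g n = y" for n
        using that x zero_lex_le[of x]
        by (auto simp: eterm_def g_def y seq_interval_def beta_shift_eq)
      then show "(\<Sum>n\<in>{n \<in> {..<N}. g n = y}. complex_of_real (eterm x n)) =
          (case y of (a, b) \<Rightarrow> c a b * indicator (seq_interval \<beta> a b) x)"
        unfolding y c_def by (simp add: sum_distrib_right)
    qed
    finally show ?thesis by simp
  qed
  let ?f = "\<lambda>x. complex_of_real (efun x) - s x"
  have f_eq: "?f x = complex_of_real (R x)" if "x \<in> X" for x
    using s_eq[OF that] R_split[of x] by simp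
  have sup: "sup_norm \<beta> ?f \<le> ennreal (e / 3)"
    unfolding sup_norm_def beta_shift_eq
    using R0 R_le by (intro SUP_least) (auto simp: f_eq intro!: ennreal_leI)
  have var: "total_variation \<beta> ?f \<le> ennreal (e / 3)"
    unfolding total_variation_def beta_shift_eq
  proof (intro SUP_least)
    fix xs assume xs: "xs \<in> {xs. set xs \<subseteq> X \<and> sorted_wrt (\<preceq>) xs}"
    have step: "norm (?f (xs ! Suc i) - ?f (xs ! i)) = R (xs ! i) - R (xs ! Suc i)"
      if "i < length xs - 1" for i
    proof -
      have "xs ! i \<in> X" "xs ! Suc i \<in> X" using that xs by (auto simp: subset_iff)
      moreover have "xs ! i \<preceq> xs ! Suc i" using that xs by (intro sorted_wrt_nth_less[of "(\<preceq>)" xs]) auto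
      ultimately show ?thesis
        using R_anti[of "xs ! i" "xs ! Suc i"] by (simp add: f_eq flip: of_real_diff)
    qed
    have "(\<Sum>i<length xs - 1. ennreal (norm (?f (xs ! Suc i) - ?f (xs ! i)))) =
        (\<Sum>i<length xs - 1. ennreal (R (xs ! i) - R (xs ! Suc i)))"
      by (intro sum.cong) (simp_all add: step)
    also have "\<dots> = ennreal (\<Sum>i<length xs - 1. R (xs ! i) - R (xs ! Suc i))"
      by (rule sum_ennreal) (metis lessThan_iff norm_ge_zero step)
    also have "(\<Sum>i<length xs - 1. R (xs ! i) - R (xs ! Suc i)) = R (xs ! 0) - R (xs ! (length xs - 1))"
      by (rule sum_lessThan_telescope')
    \<comment> \<open>\<open>R_le\<close> and \<open>R0\<close> hold for all sequences, which covers
      the unspecified \<open>xs ! 0\<close> of the empty list.\<close>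
    also have "ennreal \<dots> \<le> ennreal (e / 3)"
      using R_le[of "xs ! 0"] R0[of "xs ! (length xs - 1)"] by (intro ennreal_leI) linarith
    finally show "(\<Sum>i<length xs - 1. ennreal (norm (?f (xs ! Suc i) - ?f (xs ! i)))) \<le> ennreal (e / 3)" .
  qed
  have "bv_norm \<beta> ?f \<le> sup_norm \<beta> ?f + total_variation \<beta> ?f"
    unfolding bv_norm_def by (rule INF_lower) (simp add: eq_mod_countable_def)
  also have "\<dots> \<le> ennreal (e / 3) + ennreal (e / 3)"
    using sup var by (rule add_mono)
  also have "\<dots> = ennreal (e / 3 + e / 3)" using e by (intro ennreal_plus[symmetric]) auto
  also have "\<dots> < ennreal e" using e by (intro ennreal_lessI) auto
  also have "\<dots> \<le> \<epsilon>" by (rule e)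
  finally have "bv_norm \<beta> ?f < \<epsilon>" .
  with s_span show "\<exists>s\<in>interval_span \<beta>. bv_norm \<beta> (\<lambda>x. complex_of_real (efun x) - s x) < \<epsilon>"
    by blast
qed

lemma transfer_eigenvalue_root: "transfer_eigenvalue \<beta> t (of_real (1 / z))"
  unfolding transfer_eigenvalue_def
proof (intro bexI conjI)
  have "{x \<in> X. complex_of_real (efun x) \<noteq> 0} = X"
    using efun_ge z_pos by force
  then show "\<not> eq_mod_countable \<beta> (\<lambda>x. complex_of_real (efun x)) (\<lambda>_. 0)"
    using greedy.uncountable_adm by (simp add: eq_mod_countable_def beta_shift_eq)
  have "transfer_op \<beta> t (\<lambda>x. complex_of_real (efun x)) x = of_real (1 / z) * complex_of_real (efun x)"
    if "x \<in> X" for x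
    using transfer_efun[OF that] unfolding transfer_op_eq[OF that] of_real_mult[symmetric]
    by (auto simp flip: of_real_mult of_real_add)
  then have "{x \<in> X. transfer_op \<beta> t (\<lambda>x. complex_of_real (efun x)) x \<noteq>
      of_real (1 / z) * complex_of_real (efun x)} = {}"
    by auto
  then show "eq_mod_countable \<beta> (transfer_op \<beta> t (\<lambda>x. complex_of_real (efun x)))
      (\<lambda>x. of_real (1 / z) * complex_of_real (efun x))"
    unfolding eq_mod_countable_def beta_shift_eq by (simp only: countable_empty)
qed (rule efun_in_bv_closure)

text \<open>Off a countable set f is within 1 of a bounded step function, and \<open>efun\<close> is
  at least z.\<close>

lemma bv_closure_bounded:
  assumes "f \<in> bv_closure \<beta>"
  obtains M where "countable {x \<in> X. \<not> norm (f x) \<le> M * efun x}" "0 \<le> M"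
proof -
  obtain s where s: "s \<in> interval_span \<beta>" "bv_norm \<beta> (\<lambda>x. f x - s x) < 1"
    using assms unfolding bv_closure_def by (auto dest: spec[of _ 1])
  obtain g where g: "eq_mod_countable \<beta> (\<lambda>x. f x - s x) g" "sup_norm \<beta> g + total_variation \<beta> g < 1"
    using s(2) unfolding bv_norm_def INF_less_iff by auto
  have g1: "norm (g x) \<le> 1" if "x \<in> X" for x
  proof -
    have "ennreal (norm (g x)) \<le> sup_norm \<beta> g"
      unfolding sup_norm_def beta_shift_eq using that by (intro SUP_upper)
    also have "\<dots> \<le> sup_norm \<beta> g + total_variation \<beta> g" by simp
    also have "\<dots> < 1" by fact
    finally show ?thesis by simp
  qed
  obtain S c where S: "finite S" "s = (\<lambda>x. \<Sum>(a, b)\<in>S. c a b * indicator (seq_interval \<beta> a b) x)"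
    using s(1) unfolding interval_span_def by auto
  define B where "B = (\<Sum>(a, b)\<in>S. norm (c a b))"
  have B0: "0 \<le> B" unfolding B_def by (intro sum_nonneg) auto
  have sB: "norm (s x) \<le> B" for x
    unfolding S(2) B_def by (intro sum_norm_le) (auto simp: norm_mult indicator_def)
  have "norm (f x) \<le> (B + 1) / z * efun x" if "x \<in> X" "f x - s x = g x" for x
  proof -
    have "f x = s x + g x" using that(2) by (simp add: algebra_simps)
    then have "norm (f x) \<le> B + 1"
      using norm_triangle_ineq[of "s x" "g x"] sB[of x] g1[OF that(1)] by simp
    also have "\<dots> = (B + 1) / z * z" using z_pos by simp
    also have "\<dots> \<le> (B + 1) / z * efun x"
      using efun_ge[OF that(1)] B0 z_pos by (intro mult_left_mono) auto
    finally show ?thesis .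
  qed
  then have "{x \<in> X. \<not> norm (f x) \<le> (B + 1) / z * efun x} \<subseteq> {x \<in> X. f x - s x \<noteq> g x}" by auto
  moreover have "countable {x \<in> X. f x - s x \<noteq> g x}"
    using g(1) by (simp add: eq_mod_countable_def beta_shift_eq)
  ultimately have "countable {x \<in> X. \<not> norm (f x) \<le> (B + 1) / z * efun x}"
    by (rule countable_subset)
  then show ?thesis using that B0 z_pos by fastforce
qed

text \<open>The operator is positive and multiplies \<open>efun\<close> by 1/z, so bounds at the
  preimages of x give a better one at x. The exceptional set moves along under the shift and stays
  countable.\<close>

lemma eigenfunction_bound_step:
  assumes ev: "eq_mod_countable \<beta> (transfer_op \<beta> t f) (\<lambda>x. \<mu> * f x)" and mu: "\<mu> \<noteq> 0"
    and M: "countable {x \<in> X. \<not> norm (f x) \<le> M * efun x}"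
  shows "countable {x \<in> X. \<not> norm (f x) \<le> M / (norm \<mu> * z) * efun x}"
proof (rule countable_subset)
  let ?E = "{x \<in> X. \<not> norm (f x) \<le> M * efun x}"
  let ?C = "{x \<in> X. transfer_op \<beta> t f x \<noteq> \<mu> * f x}"
  show "countable (?C \<union> shift ` ?E)"
    using ev M by (simp add: eq_mod_countable_def beta_shift_eq)
  show "{x \<in> X. \<not> norm (f x) \<le> M / (norm \<mu> * z) * efun x} \<subseteq> ?C \<union> shift ` ?E"
  proof
    fix x assume x: "x \<in> {x \<in> X. \<not> norm (f x) \<le> M / (norm \<mu> * z) * efun x}"
    then have xX: "x \<in> X" by simp
    show "x \<in> ?C \<union> shift ` ?E"
    proof (rule ccontr)
      assume no: "x \<notin> ?C \<union> shift ` ?E"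
      then have eq: "transfer_op \<beta> t f x = \<mu> * f x" using xX by auto
      have pre: "norm (f y) \<le> M * efun y" if "y \<in> X" "shift y = x" for y
        using that no by auto
      have 0: "norm (f (case_nat 0 x)) \<le> M * efun (case_nat 0 x)"
        by (rule pre[OF case_nat_0_adm[OF xX]]) simp
      have 1: "norm (f (case_nat 1 x)) \<le> M * efun (case_nat 1 x)" if "x \<preceq> shift q"
        using that xX by (intro pre) (auto simp: case_nat_1_adm_iff simp del: One_nat_def)
      have "norm \<mu> * norm (f x) = norm (transfer_op \<beta> t f x)" by (simp add: eq norm_mult)
      also have "\<dots> \<le> M * efun (case_nat 0 x) + (if x \<preceq> shift q then exp t * (M * efun (case_nat 1 x)) else 0)"
        unfolding transfer_op_eq[OF xX]
        using 0 1 by (auto intro!: norm_triangle_le add_mono simp: norm_mult)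
      also have "\<dots> = M * (efun (case_nat 0 x) + (if x \<preceq> shift q then exp t * efun (case_nat 1 x) else 0))"
        by (simp add: algebra_simps)
      also have "\<dots> = M * (efun x / z)" by (simp only: transfer_efun[OF xX])
      finally have "norm (f x) \<le> M / (norm \<mu> * z) * efun x"
        using mu z_pos by (simp add: field_simps)
      with x show False by simp
    qed
  qed
qed

text \<open>For \<open>norm \<mu> * z > 1\<close> the iterated bounds tend to 0, so f vanishes off a
  countable union of countable sets.\<close>

lemma eigenvalue_norm_le:
  assumes "transfer_eigenvalue \<beta> t \<mu>"
  shows "norm \<mu> \<le> 1 / z"
proof (rule ccontr)
  assume "\<not> norm \<mu> \<le> 1 / z"
  then have large: "1 < norm \<mu> * z" using z_pos by (simp add: field_simps)
  then have mu: "\<mu> \<noteq> 0" by auto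
  obtain f where f: "f \<in> bv_closure \<beta>" "\<not> eq_mod_countable \<beta> f (\<lambda>_. 0)"
    "eq_mod_countable \<beta> (transfer_op \<beta> t f) (\<lambda>x. \<mu> * f x)"
    using assms unfolding transfer_eigenvalue_def by auto
  obtain M where M: "countable {x \<in> X. \<not> norm (f x) \<le> M * efun x}" "0 \<le> M"
    using bv_closure_bounded[OF f(1)] .
  define c where "c = norm \<mu> * z"
  have cn: "countable {x \<in> X. \<not> norm (f x) \<le> M / c ^ n * efun x}" for n
  proof (induction n)
    case (Suc n)
    then show ?case using eigenfunction_bound_step[OF f(3) mu Suc] by (simp add: c_def mult.commute)
  qed (use M in simp)
  have "{x \<in> X. f x \<noteq> 0} \<subseteq> (\<Union>n. {x \<in> X. \<not> norm (f x) \<le> M / c ^ n * efun x})"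
  proof
    fix x assume x: "x \<in> {x \<in> X. f x \<noteq> 0}"
    obtain n where n: "M * efun x / norm (f x) < c ^ n"
      using real_arch_pow[of c] large by (auto simp: c_def)
    moreover have "0 < c ^ n" using large by (simp add: c_def)
    ultimately have "M / c ^ n * efun x < norm (f x)"
      using x by (simp add: pos_divide_less_eq mult.commute)
    then show "x \<in> (\<Union>n. {x \<in> X. \<not> norm (f x) \<le> M / c ^ n * efun x})"
      using x by (auto intro!: exI[of _ n])
  qed
  then have "countable {x \<in> X. f x \<noteq> 0}"
    by (rule countable_subset) (intro countable_UN cn; simp)
  with f(2) show False by (simp add: eq_mod_countable_def beta_shift_eq)
qed

lemma leading_eigenvalue_eq: "leading_eigenvalue \<beta> t = 1 / z"
  unfolding leading_eigenvalue_def
proof (rule the_equality)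
  show "transfer_eigenvalue \<beta> t (of_real (1 / z)) \<and>
      (\<forall>\<mu>. transfer_eigenvalue \<beta> t \<mu> \<longrightarrow> norm \<mu> \<le> 1 / z)"
    using transfer_eigenvalue_root eigenvalue_norm_le by blast
  fix l assume l: "transfer_eigenvalue \<beta> t (of_real l) \<and> (\<forall>\<mu>. transfer_eigenvalue \<beta> t \<mu> \<longrightarrow> norm \<mu> \<le> l)"
  have "norm (complex_of_real (1 / z)) \<le> l" using l transfer_eigenvalue_root by blast
  moreover have "norm (complex_of_real l) \<le> 1 / z" using l by (intro eigenvalue_norm_le) simp
  moreover have "0 < 1 / z" using z_pos by simp
  ultimately show "l = 1 / z" unfolding norm_of_real by linarith
qed

end

section \<open>The eigenmeasure\<close>

definition below :: "digits \<Rightarrow> digits \<Rightarrow> digits set" where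
  "below q a = {x \<in> adm q. x \<preceq> a}"

text \<open>A down-set is a countable union of sets \<open>below q d\<close>: for every finite word that is a prefix of
  an element of the down-set one such element suffices, and the maximal element, if it exists,
  has to be added.\<close>

lemma down_set_in_sigma_sets:
  assumes E: "E \<subseteq> adm q" and down: "\<And>x y. x \<in> E \<Longrightarrow> y \<in> adm q \<Longrightarrow> y \<preceq> x \<Longrightarrow> y \<in> E"
  shows "E \<in> sigma_sets (adm q) (below q ` adm q)"
proof -
  define d where "d l = (SOME x. x \<in> E \<and> (\<exists>n. map x [0..<n] = l))" for l :: "nat list"
  define K where "K = {l. \<exists>x\<in>E. \<exists>n. map x [0..<n] = l}"
  define D where "D = d ` K \<union> {m \<in> E. \<forall>x\<in>E. x \<preceq> m}"
  have d: "d l \<in> E \<and> (\<exists>n. map (d l) [0..<n] = l)" if "l \<in> K" for l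
    using that someI_ex[of "\<lambda>x. x \<in> E \<and> (\<exists>n. map x [0..<n] = l)"]
    unfolding d_def K_def by blast
  have "countable {m \<in> E. \<forall>x\<in>E. x \<preceq> m}"
  proof (cases "{m \<in> E. \<forall>x\<in>E. x \<preceq> m} = {}")
    case False
    then obtain m where "m \<in> E" "\<forall>x\<in>E. x \<preceq> m" by blast
    then have "{m \<in> E. \<forall>x\<in>E. x \<preceq> m} \<subseteq> {m}" using lex_le_antisym by blast
    then show ?thesis by (rule countable_subset) simp
  next
    case True
    then show ?thesis by (simp only: countable_empty)
  qed
  then have "countable D" unfolding D_def by simp
  have "D \<subseteq> E" using d by (auto simp: D_def)
  have E_eq: "E = (\<Union>a\<in>D. below q a)"
  proof (intro equalityI subsetI)
    fix x assume x: "x \<in> E"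
    show "x \<in> (\<Union>a\<in>D. below q a)"
    proof (cases "\<forall>y\<in>E. y \<preceq> x")
      case True
      then have "x \<in> D" using x by (simp add: D_def)
      moreover have "x \<in> below q x" using x E by (auto simp: below_def)
      ultimately show ?thesis by blast
    next
      case False
      then obtain y n where y: "y \<in> E" "\<forall>i<n. y i = x i" "x n < y n" by (auto simp: not_lex_le_iff)
      define l where "l = map y [0..<Suc n]"
      have l: "l \<in> K" using y(1) unfolding K_def l_def by blast
      then obtain m where m: "map (d l) [0..<m] = map y [0..<Suc n]"
        using d l_def by blast
      have "m = Suc n" using arg_cong[OF m, of length] by simp
      have dy: "d l i = y i" if "i \<le> n" for i
      proof -
        have "map (d l) [0..<m] ! i = map y [0..<Suc n] ! i" by (simp only: m)
        then show ?thesis using that \<open>m = Suc n\<close> by (simp del: upt_Suc)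
      qed
      have "x \<preceq> d l"
        by (rule lex_less_imp_le[of n]) (use dy y in auto)
      moreover have "d l \<in> D" using l by (simp add: D_def)
      ultimately show ?thesis using x E by (auto simp: below_def)
    qed
  next
    fix x assume "x \<in> (\<Union>a\<in>D. below q a)"
    then obtain a where a: "a \<in> D" "x \<in> below q a" by blast
    then show "x \<in> E" using down[of a x] \<open>D \<subseteq> E\<close> by (auto simp: below_def)
  qed
  have U: "(\<Union>a\<in>D. below q a) \<in> sigma_sets (adm q) (below q ` adm q)"
  proof (rule sigma_sets_UNION)
    show "countable (below q ` D)" using \<open>countable D\<close> by (rule countable_image)
    fix A assume "A \<in> below q ` D"
    then show "A \<in> sigma_sets (adm q) (below q ` adm q)"
      using \<open>D \<subseteq> E\<close> E by (intro sigma_sets.Basic) auto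
  qed
  show ?thesis using U unfolding E_eq[symmetric] .
qed

text \<open>A convex set is the difference of two down-sets: its downward closure and the part of it
  outside the set.\<close>

lemma convex_in_sigma_sets:
  assumes C: "C \<subseteq> adm q"
    and conv: "\<And>x y v. x \<in> C \<Longrightarrow> y \<in> C \<Longrightarrow> v \<in> adm q \<Longrightarrow> x \<preceq> v \<Longrightarrow> v \<preceq> y \<Longrightarrow> v \<in> C"
  shows "C \<in> sigma_sets (adm q) (below q ` adm q)"
proof -
  define A where "A = {x \<in> adm q. \<exists>y\<in>C. x \<preceq> y}"
  have A1: "A \<in> sigma_sets (adm q) (below q ` adm q)"
    by (rule down_set_in_sigma_sets) (auto simp: A_def intro: lex_le_trans)
  have A2: "A - C \<in> sigma_sets (adm q) (below q ` adm q)"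
  proof (rule down_set_in_sigma_sets)
    fix x y assume "x \<in> A - C" "y \<in> adm q" "y \<preceq> x"
    then show "y \<in> A - C"
      using C conv[of y] by (auto simp: A_def intro: lex_le_trans)
  qed (auto simp: A_def)
  have "C \<subseteq> A"
  proof
    fix x assume "x \<in> C"
    then show "x \<in> A" using C by (auto simp: A_def intro!: bexI[of _ x])
  qed
  then have eq: "C = A - (A - C)" by auto
  interpret sigma_algebra "adm q" "sigma_sets (adm q) (below q ` adm q)"
    by (rule sigma_algebra_sigma_sets) (auto simp: below_def)
  show ?thesis using Diff[OF A1 A2] unfolding eq[symmetric] .
qed

text \<open>Sequences between two others with a common prefix share that prefix, so cylinders are
  convex.\<close>

lemma prefix_in_sigma_sets:
  "{x \<in> adm q. map x [0..<n] = l} \<in> sigma_sets (adm q) (below q ` adm q)"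
proof (rule convex_in_sigma_sets)
  fix x y v
  assume x: "x \<in> {x \<in> adm q. map x [0..<n] = l}" and y: "y \<in> {x \<in> adm q. map x [0..<n] = l}"
    and v: "v \<in> adm q" "x \<preceq> v" "v \<preceq> y"
  have xy: "x i = y i" if "i < n" for i
    using x y that by (metis (mono_tags, lifting) add_0 diff_zero length_upt mem_Collect_eq nth_map nth_upt)
  have "x i = v i" if "i < n" for i
  proof (rule ccontr)
    assume "x i \<noteq> v i"
    then have "x \<noteq> v" by auto
    then obtain k where k: "\<forall>i<k. x i = v i" "x k < v k" using v(2) by (auto simp: lex_le_def)
    have "k \<le> i" using k \<open>x i \<noteq> v i\<close> by (meson not_le)
    then have "\<forall>i<k. v i = y i" "y k < v k" using k xy that by auto
    then have "\<not> v \<preceq> y" unfolding not_lex_le_iff by blast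
    with v show False by simp
  qed
  then have eq: "map v [0..<n] = map x [0..<n]" by simp
  show "v \<in> {x \<in> adm q. map x [0..<n] = l}"
    using x v(1) unfolding mem_Collect_eq eq by simp
qed auto

lemma below_in_borel: "{x. x \<preceq> a} \<in> sets borel"
proof -
  have [measurable]: "(\<lambda>x::digits. x i) \<in> borel_measurable borel" for i
    by (intro borel_measurable_continuous_onI continuous_on_product_coordinates)
  have "{x \<in> space borel. \<not> (\<exists>n. (\<forall>i<n. x i = a i) \<and> a n < x n)} \<in> sets borel"
    by measurable
  then show ?thesis by (simp flip: not_lex_le_iff)
qed

text \<open>An eigenmeasure lives on the Borel sets of the product topology, while its defining
  identity tests only intervals. This equality lets the values on initial segments determine
  it.\<close>

lemma sets_restrict_borel_adm:
  "sets (restrict_space borel (adm q)) = sigma_sets (adm q) (below q ` adm q)"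
proof
  have sub: "below q ` adm q \<subseteq> Pow (adm q)" by (auto simp: below_def)
  have "below q ` adm q \<subseteq> sets (restrict_space borel (adm q))"
    using below_in_borel by (auto simp: below_def sets_restrict_space Collect_conj_eq)
  moreover have "space (restrict_space borel (adm q)) = adm q" by (simp add: space_restrict_space)
  ultimately show "sigma_sets (adm q) (below q ` adm q) \<subseteq> sets (restrict_space borel (adm q))"
    by (metis sets.sigma_sets_subset)
  let ?M = "sigma (adm q) (below q ` adm q)"
  have M: "space ?M = adm q" "sets ?M = sigma_sets (adm q) (below q ` adm q)"
    using sub by (auto simp: space_measure_of sets_measure_of)
  have "(\<lambda>x. x) \<in> measurable ?M (borel :: digits measure)"
  proof (rule measurable_coordinatewise_then_product)
    fix i
    show "(\<lambda>x. x i) \<in> measurable ?M borel"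
    proof (rule measurableI)
      fix A :: "nat set"
      have "(\<lambda>x. x i) -` A \<inter> space ?M =
          (\<Union>l\<in>{l. length l = Suc i \<and> l ! i \<in> A}. {x \<in> adm q. map x [0..<Suc i] = l})"
        unfolding M by (auto simp del: upt_Suc)
      also have "\<dots> \<in> sets ?M"
        unfolding M by (intro sigma_sets_UNION) (auto intro: prefix_in_sigma_sets simp del: upt_Suc)
      finally show "(\<lambda>x. x i) -` A \<inter> space ?M \<in> sets ?M" .
    qed simp
  qed
  then have "A \<inter> adm q \<in> sigma_sets (adm q) (below q ` adm q)" if "A \<in> sets borel" for A
    using measurable_sets[of "\<lambda>x. x" ?M borel A] that by (simp add: M)
  then show "sets (restrict_space borel (adm q)) \<subseteq> sigma_sets (adm q) (below q ` adm q)"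
    by (auto simp: sets_restrict_space Int_commute)
qed

lemma measure_eqI_below:
  assumes "q \<in> adm q" "prob_space M" "prob_space N"
    "sets M = sets (restrict_space borel (adm q))" "sets N = sets (restrict_space borel (adm q))"
    and eq: "\<And>a. a \<in> adm q \<Longrightarrow> measure M (below q a) = measure N (below q a)"
  shows "M = N"
proof (rule measure_eqI_generator_eq)
  interpret M: prob_space M by fact
  interpret N: prob_space N by fact
  show "Int_stable (below q ` adm q)"
  proof (rule Int_stableI_image)
    fix a b assume ab: "a \<in> adm q" "b \<in> adm q"
    have "below q a \<inter> below q b = below q (if a \<preceq> b then a else b)"
      using lex_le_linear[of a b] by (auto simp: below_def intro: lex_le_trans)
    then show "\<exists>c\<in>adm q. below q a \<inter> below q b = below q c" using ab by (metis (full_types))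
  qed
  show "below q ` adm q \<subseteq> Pow (adm q)" by (auto simp: below_def)
  show "sets M = sigma_sets (adm q) (below q ` adm q)" "sets N = sigma_sets (adm q) (below q ` adm q)"
    using assms sets_restrict_borel_adm by auto
  show "emeasure M A = emeasure N A" if "A \<in> below q ` adm q" for A
    using that eq by (auto simp: M.emeasure_eq_measure N.emeasure_eq_measure)
  show "range (\<lambda>_::nat. below q q) \<subseteq> below q ` adm q" using assms(1) by auto
  show "(\<Union>_::nat. below q q) = adm q" using adm_le by (auto simp: below_def)
  show "emeasure M (below q q) \<noteq> \<infinity>" by simp
qed

section \<open>The image of Lebesgue measure under itineraries\<close>

context weighted
begin

definition itin_measure :: "digits measure" where
  "itin_measure = distr (restrict_space lborel {0..<1}) (restrict_space borel X) itin"

lemma measurable_itin: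
  "itin \<in> measurable (restrict_space lborel {0..<1}) (restrict_space borel X)"
proof (rule measurable_restrict_space2)
  show "itin \<in> space (restrict_space lborel {0..<1}) \<rightarrow> X"
    using itin_adm by (auto simp: space_restrict_space)
  have [measurable]: "T \<in> borel_measurable borel"
    unfolding T_def[abs_def] by measurable
  have [measurable]: "(T ^^ n) \<in> borel_measurable borel" for n
    by (induction n) (auto intro: measurable_comp simp: id_def)
  have "itin \<in> borel_measurable borel"
    unfolding itin_def[abs_def] by (intro measurable_coordinatewise_then_product) measurable
  then show "itin \<in> borel_measurable (restrict_space lborel {0..<1})"
    by (intro measurable_restrict_space1) simp
qed

lemma sets_itin_measure [simp]: "sets itin_measure = sets (restrict_space borel X)"
  by (simp add: itin_measure_def)

lemma space_itin_measure [simp]: "space itin_measure = X"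
  by (simp add: itin_measure_def space_restrict_space)

lemma emeasure_itin_measure:
  assumes "A \<in> sets (restrict_space borel X)"
  shows "{u \<in> {0..<1}. itin u \<in> A} \<in> sets lborel"
    and "emeasure itin_measure A = emeasure lborel {u \<in> {0..<1}. itin u \<in> A}"
proof -
  have eq: "itin -` A \<inter> space (restrict_space lborel {0..<1}) = {u \<in> {0..<1}. itin u \<in> A}"
    by (auto simp: space_restrict_space)
  have *: "{u \<in> {0..<1}. itin u \<in> A} \<in> sets (restrict_space lborel {0..<1})"
    using measurable_sets[OF measurable_itin assms] unfolding eq .
  then show "{u \<in> {0..<1}. itin u \<in> A} \<in> sets lborel"
    by (subst (asm) sets_restrict_space_iff) auto
  show "emeasure itin_measure A = emeasure lborel {u \<in> {0..<1}. itin u \<in> A}"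
    unfolding itin_measure_def emeasure_distr[OF measurable_itin assms] eq
    by (rule emeasure_restrict_space) auto
qed

lemma prob_space_itin_measure: "prob_space itin_measure"
  unfolding itin_measure_def
  by (intro prob_space.prob_space_distr measurable_itin prob_space_restrict_space) auto

lemma below_sets: "a \<in> X \<Longrightarrow> below q a \<in> sets (restrict_space borel X)"
  unfolding sets_restrict_borel_adm by blast

lemma singleton_sets: "a \<in> X \<Longrightarrow> {a} \<in> sets (restrict_space borel X)"
  unfolding sets_restrict_borel_adm
  by (rule convex_in_sigma_sets) (auto intro: lex_le_antisym)

text \<open>The preimage of the initial segment lies between [0, \<open>val a\<close>) and
  [0, \<open>val a\<close>]; whether the endpoint belongs to it depends on \<open>a\<close>, but
  does not affect the measure.\<close>

lemma measure_itin_below: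
  assumes a: "a \<in> X"
  shows "measure itin_measure (below q a) = val a"
proof -
  let ?B = "{u \<in> {0..<1}. itin u \<in> below q a}"
  have B: "?B \<in> sets lborel" by (rule emeasure_itin_measure(1)[OF below_sets[OF a]])
  have "{0..<val a} \<subseteq> ?B"
    using val_le_1[OF a] val_le_iff[OF a] lex_le_linear itin_adm by (force simp: below_def)
  then have "emeasure lborel {0..<val a} \<le> emeasure lborel ?B" using B by (rule emeasure_mono)
  moreover have "?B \<subseteq> {0..val a}"
    using val_mono[OF itin_adm a] val_itin by (force simp: below_def)
  then have "emeasure lborel ?B \<le> emeasure lborel {0..val a}" by (rule emeasure_mono) simp
  ultimately have "emeasure lborel ?B = ennreal (val a)"
    using val_ge_0[OF a] by (simp add: antisym)
  then have "emeasure itin_measure (below q a) = ennreal (val a)"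
    using emeasure_itin_measure(2)[OF below_sets[OF a]] by simp
  then show ?thesis using val_ge_0[OF a] by (simp add: measure_def)
qed

lemma measure_itin_singleton:
  assumes a: "a \<in> X"
  shows "measure itin_measure {a} = 0"
proof -
  let ?B = "{u \<in> {0..<1}. itin u \<in> {a}}"
  have "?B \<subseteq> {val a}" using val_itin by auto
  then have "emeasure lborel ?B \<le> emeasure lborel {val a}" by (rule emeasure_mono) simp
  then have "emeasure itin_measure {a} = 0"
    using emeasure_itin_measure(2)[OF singleton_sets[OF a]] by simp
  then show ?thesis by (simp add: measure_def)
qed

end

section \<open>Uniqueness and existence of the eigenmeasure\<close>

locale beta_measure = beta_eigen +
  assumes wz_less: "exp t * z < 1"
begin

sublocale m: weighted q "exp t" z
  by unfold_locales (use z_pos z_less wz_less root in auto)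

definition is_eigenmeasure :: "digits measure \<Rightarrow> bool" where
  "is_eigenmeasure \<nu> \<longleftrightarrow> prob_space \<nu> \<and> sets \<nu> = sets (restrict_space borel X) \<and>
     (\<forall>f\<in>interval_span \<beta>. (LINT x|\<nu>. transfer_op \<beta> t f x) = of_real (1 / z) * (LINT x|\<nu>. f x))"

lemma has_bochner_integral_of_bool:
  assumes "finite_measure M" "A \<in> sets M"
  shows "has_bochner_integral M (\<lambda>x. of_bool (x \<in> A) :: complex) (of_real (measure M A))"
proof -
  have "has_bochner_integral M (\<lambda>x. indicator A x *\<^sub>R (1::complex)) (measure M A *\<^sub>R 1)"
    using assms finite_measure.emeasure_finite[of M A]
    by (intro has_bochner_integral_indicator) (auto simp: less_top)
  moreover have "(\<lambda>x. indicator A x *\<^sub>R (1::complex)) = (\<lambda>x. of_bool (x \<in> A))"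
    by (auto simp: indicator_def)
  ultimately show ?thesis by (simp add: scaleR_conv_of_real)
qed

text \<open>Indicators of initial segments go to a constant plus a multiple of another such
  indicator, so the eigenvalue identity becomes a recursion along the shift.\<close>

lemma transfer_below:
  assumes x: "x \<in> X" and a: "a \<in> X"
  shows "transfer_op \<beta> t (\<lambda>x. of_bool (x \<in> below q a)) x =
    of_nat (a 0) + of_real (exp t ^ a 0) * of_bool (x \<in> below q (shift a))"
proof -
  have a0: "a 0 = 0 \<or> a 0 = 1" by (rule adm_digit[OF a])
  have "shift a \<preceq> shift q" if "a 0 = 1"
    using adm_le[OF a] that q_0 by (subst (asm) lex_le_Suc) simp
  then have sq: "x \<preceq> shift q" if "a 0 = 1" "x \<preceq> shift a"
    using that lex_le_trans by blast
  have 0: "case_nat 0 x \<in> below q a \<longleftrightarrow> a 0 = 1 \<or> x \<preceq> shift a"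
    using case_nat_0_adm[OF x] a0 lex_le_Suc[of "case_nat 0 x" a] by (auto simp: below_def)
  have 1: "x \<preceq> shift q \<and> case_nat 1 x \<in> below q a \<longleftrightarrow> a 0 = 1 \<and> x \<preceq> shift a"
    using case_nat_1_adm_iff[OF x] a0 sq lex_le_Suc[of "case_nat 1 x" a]
    by (auto simp: below_def simp del: One_nat_def)
  have "transfer_op \<beta> t (\<lambda>x. of_bool (x \<in> below q a)) x =
      of_bool (case_nat 0 x \<in> below q a) + of_real (exp t) * of_bool (x \<preceq> shift q \<and> case_nat 1 x \<in> below q a)"
    unfolding transfer_op_eq[OF x] by simp
  also have "\<dots> = of_nat (a 0) + of_real (exp t ^ a 0) * of_bool (x \<in> below q (shift a))"
    unfolding 0 1 using a0 x by (auto simp: below_def)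
  finally show ?thesis .
qed

lemma integral_transfer_below:
  assumes "prob_space \<nu>" and sets: "sets \<nu> = sets (restrict_space borel X)" and a: "a \<in> X"
  shows "has_bochner_integral \<nu> (transfer_op \<beta> t (\<lambda>x. of_bool (x \<in> below q a)))
    (of_nat (a 0) + of_real (exp t ^ a 0) * of_real (measure \<nu> (below q (shift a))))"
proof -
  interpret prob_space \<nu> by fact
  have sp: "space \<nu> = X" using sets_eq_imp_space_eq[OF sets] by (simp add: space_restrict_space)
  have "has_bochner_integral \<nu> (\<lambda>x. (of_nat (a 0) :: complex) * of_bool (x \<in> X) + of_real (exp t ^ a 0) * of_bool (x \<in> below q (shift a)))
      (of_nat (a 0) * of_real (measure \<nu> X) + of_real (exp t ^ a 0) * of_real (measure \<nu> (below q (shift a))))"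
    using shift_adm[OF a] m.below_sets sets.top[of \<nu>]
    by (intro has_bochner_integral_add has_bochner_integral_mult_right has_bochner_integral_of_bool)
       (auto simp: sets sp finite_measure_axioms)
  also have "of_real (measure \<nu> X) = (1 :: complex)" using prob_space by (simp add: sp)
  finally show ?thesis
    by (rule has_bochner_integral_cong[THEN iffD1, rotated -1])
       (use transfer_below[OF _ a] in \<open>auto simp: sp\<close>)
qed

lemma seq_interval_zero: "a \<in> X \<Longrightarrow> seq_interval \<beta> (\<lambda>_. 0) a = below q a"
  by (auto simp: seq_interval_def below_def beta_shift_eq zero_lex_le)

lemma below_in_interval_span: "a \<in> X \<Longrightarrow> (\<lambda>x. of_bool (x \<in> below q a)) \<in> interval_span \<beta>"
  unfolding interval_span_def
  using zero_adm
  by (intro CollectI exI[of _ "{(\<lambda>_. 0, a)}"] exI[of _ "\<lambda>_ _. 1"])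
     (auto simp: beta_shift_eq seq_interval_zero indicator_def of_bool_def)

text \<open>The measure v(a) of the segment below \<open>a\<close> satisfies v(a) = z (a_0 + w^(a_0)
  v(shift a)) with w = exp t. Iteration unfolds the series \<open>m.val a\<close>, with a remainder
  of at most the weight.\<close>

lemma eigenmeasure_below:
  assumes nu: "is_eigenmeasure \<nu>" and a: "a \<in> X"
  shows "measure \<nu> (below q a) = m.val a"
proof -
  have ps: "prob_space \<nu>" and sets: "sets \<nu> = sets (restrict_space borel X)"
    using nu by (auto simp: is_eigenmeasure_def)
  interpret prob_space \<nu> by fact
  let ?v = "\<lambda>a. measure \<nu> (below q a)"
  have rec: "?v a = z * (real (a 0) + exp t ^ a 0 * ?v (shift a))" if a: "a \<in> X" for a
  proof -
    have "of_real (1 / z) * (LINT x|\<nu>. of_bool (x \<in> below q a)) =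
        (LINT x|\<nu>. transfer_op \<beta> t (\<lambda>x. of_bool (x \<in> below q a)) x)"
      using nu below_in_interval_span[OF a] by (simp add: is_eigenmeasure_def)
    also have "\<dots> = of_nat (a 0) + of_real (exp t ^ a 0) * of_real (?v (shift a))"
      by (rule has_bochner_integral_integral_eq[OF integral_transfer_below[OF ps sets a]])
    also have "(LINT x|\<nu>. of_bool (x \<in> below q a)) = complex_of_real (?v a)"
      using m.below_sets[OF a] 
      by (intro has_bochner_integral_integral_eq has_bochner_integral_of_bool finite_measure_axioms)
         (simp add: sets)
    finally have "complex_of_real (1 / z * ?v a) = of_real (real (a 0) + exp t ^ a 0 * ?v (shift a))"
      by simp
    then have "1 / z * ?v a = real (a 0) + exp t ^ a 0 * ?v (shift a)"
      by (simp only: of_real_eq_iff)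
    then show ?thesis using z_pos by (simp add: field_simps)
  qed
  have exp: "?v a = (\<Sum>i<n. bterm (exp t) z a i) + wt (exp t) z a n * ?v (\<lambda>i. a (i + n))" for n
  proof (induction n)
    case (Suc n)
    show ?case
      unfolding Suc using rec[OF adm_shift[OF a, of n]]
      by (simp add: bterm_def wt_def ones_Suc power_add algebra_simps shift_def)
  qed simp
  have "(\<lambda>n. wt (exp t) z a n * ?v (\<lambda>i. a (i + n))) \<longlonglongrightarrow> 0"
  proof (rule Lim_null_comparison[OF _ m.wt_tendsto_0])
    show "eventually (\<lambda>n. norm (wt (exp t) z a n * ?v (\<lambda>i. a (i + n))) \<le> wt (exp t) z a n) sequentially"
      by (intro always_eventually allI) (auto simp: abs_mult mult_left_le)
  qed (rule adm_digit_le[OF a])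
  then have "(\<lambda>n. ?v a - wt (exp t) z a n * ?v (\<lambda>i. a (i + n))) \<longlonglongrightarrow> ?v a - 0"
    by (intro tendsto_intros)
  moreover have "?v a - wt (exp t) z a n * ?v (\<lambda>i. a (i + n)) = (\<Sum>i<n. bterm (exp t) z a i)" for n
    using exp[of n] by linarith
  ultimately have "bterm (exp t) z a sums ?v a" by (simp add: sums_def)
  then show ?thesis by (simp add: m.val_def sums_iff)
qed

text \<open>The integral of a non-integrable function is 0 by convention, so integrability of
  \<open>f\<close> and of its image is carried along to make the identity linear in
  \<open>f\<close>.\<close>

definition eigen_integrable :: "(digits \<Rightarrow> complex) \<Rightarrow> bool" where
  "eigen_integrable f \<longleftrightarrow> (\<exists>I. has_bochner_integral m.itin_measure f I \<and>
     has_bochner_integral m.itin_measure (transfer_op \<beta> t f) (of_real (1 / z) * I))"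

lemma eigen_integrable_cong:
  assumes "eigen_integrable f" "\<And>x. x \<in> X \<Longrightarrow> f x = g x"
  shows "eigen_integrable g"
proof -
  have "transfer_op \<beta> t f x = transfer_op \<beta> t g x" if "x \<in> X" for x
    unfolding transfer_op_eq[OF that]
    using assms(2) case_nat_0_adm[OF that] case_nat_1_adm_iff[OF that] by auto
  then show ?thesis
    using assms has_bochner_integral_cong[of m.itin_measure m.itin_measure f g]
      has_bochner_integral_cong[of m.itin_measure m.itin_measure "transfer_op \<beta> t f" "transfer_op \<beta> t g"]
    unfolding eigen_integrable_def by simp
qed

lemma eigen_integrable_add:
  assumes "eigen_integrable f" "eigen_integrable g"
  shows "eigen_integrable (\<lambda>x. f x + g x)"
proof -
  obtain I J where I: "has_bochner_integral m.itin_measure f I"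
      "has_bochner_integral m.itin_measure (transfer_op \<beta> t f) (of_real (1 / z) * I)"
    and J: "has_bochner_integral m.itin_measure g J"
      "has_bochner_integral m.itin_measure (transfer_op \<beta> t g) (of_real (1 / z) * J)"
    using assms unfolding eigen_integrable_def by blast
  have "has_bochner_integral m.itin_measure (\<lambda>x. transfer_op \<beta> t f x + transfer_op \<beta> t g x)
      (of_real (1 / z) * (I + J))"
    unfolding distrib_left using I J by (intro has_bochner_integral_add)
  also have "(\<lambda>x. transfer_op \<beta> t f x + transfer_op \<beta> t g x) = transfer_op \<beta> t (\<lambda>x. f x + g x)"
    by (simp add: transfer_op_def fun_eq_iff distrib_left sum.distrib)
  finally show ?thesis
    unfolding eigen_integrable_def using has_bochner_integral_add[OF I(1) J(1)] by blast
qed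

lemma eigen_integrable_cmult:
  assumes "eigen_integrable f"
  shows "eigen_integrable (\<lambda>x. c * f x)"
proof -
  obtain I where I: "has_bochner_integral m.itin_measure f I"
      "has_bochner_integral m.itin_measure (transfer_op \<beta> t f) (of_real (1 / z) * I)"
    using assms unfolding eigen_integrable_def by blast
  have "has_bochner_integral m.itin_measure (\<lambda>x. c * transfer_op \<beta> t f x) (c * (of_real (1 / z) * I))"
    using I by (intro has_bochner_integral_mult_right)
  also have "(\<lambda>x. c * transfer_op \<beta> t f x) = transfer_op \<beta> t (\<lambda>x. c * f x)"
    by (simp add: transfer_op_def fun_eq_iff sum_distrib_left mult_ac)
  also have "c * (of_real (1 / z) * I) = of_real (1 / z) * (c * I)" by (simp add: mult_ac)
  finally show ?thesis
    unfolding eigen_integrable_def using has_bochner_integral_mult_right[OF I(1), of c] by blast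
qed

lemma eigen_integrable_zero: "eigen_integrable (\<lambda>_. 0)"
  using has_bochner_integral_zero[of m.itin_measure] 
  unfolding eigen_integrable_def by (intro exI[of _ 0]) (simp add: transfer_op_def[abs_def])

lemma eigen_integrable_sum: "finite S \<Longrightarrow> (\<And>i. i \<in> S \<Longrightarrow> eigen_integrable (f i)) \<Longrightarrow> eigen_integrable (\<lambda>x. \<Sum>i\<in>S. f i x)"
  by (induction S rule: finite_induct) (auto intro: eigen_integrable_add eigen_integrable_zero)

lemma eigen_integrable_below:
  assumes a: "a \<in> X"
  shows "eigen_integrable (\<lambda>x. of_bool (x \<in> below q a))"
proof -
  interpret N: prob_space m.itin_measure by (rule m.prob_space_itin_measure)
  have I: "has_bochner_integral m.itin_measure (\<lambda>x. of_bool (x \<in> below q a) :: complex) (of_real (m.val a))"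
    using has_bochner_integral_of_bool[of m.itin_measure "below q a"] m.below_sets[OF a]
      m.measure_itin_below[OF a] N.finite_measure_axioms by simp
  have "m.val a = z * (real (a 0) + exp t ^ a 0 * m.val (shift a))"
    using m.val_split[OF a, of 1] by (simp add: bterm_def wt_def ones_Suc shift_def algebra_simps)
  then have eq: "1 / z * m.val a = real (a 0) + exp t ^ a 0 * m.val (shift a)"
    using z_pos by simp
  have eq': "complex_of_real (1 / z) * of_real (m.val a) =
      of_nat (a 0) + of_real (exp t ^ a 0) * of_real (m.val (shift a))"
    unfolding of_real_mult[symmetric] eq by simp
  show ?thesis
    unfolding eigen_integrable_def
    using I integral_transfer_below[OF m.prob_space_itin_measure _ a]
    by (intro exI[of _ "of_real (m.val a)"])
       (simp add: eq' m.measure_itin_below[OF shift_adm[OF a]] del: of_real_divide)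
qed

text \<open>Supplies the left endpoint: [a, b] is the segment below \<open>b\<close> minus the
  segment below \<open>a\<close> plus {a}.\<close>

lemma eigen_integrable_singleton:
  assumes a: "a \<in> X"
  shows "eigen_integrable (\<lambda>x. of_bool (x = a))"
proof -
  interpret N: prob_space m.itin_measure by (rule m.prob_space_itin_measure)
  have I: "has_bochner_integral m.itin_measure (\<lambda>x. of_bool (x \<in> {a}) :: complex) 0" if "a \<in> X" for a
    using has_bochner_integral_of_bool[of m.itin_measure "{a}"] m.singleton_sets[OF that]
      m.measure_itin_singleton[OF that] N.finite_measure_axioms by simp
  have "transfer_op \<beta> t (\<lambda>x. of_bool (x = a)) x = of_real (exp t ^ a 0) * of_bool (x \<in> {shift a})"
    if x: "x \<in> X" for x
  proof -
    have cn: "case_nat d x = a \<longleftrightarrow> d = a 0 \<and> x = shift a" for d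
    proof
      assume "case_nat d x = a"
      then show "d = a 0 \<and> x = shift a" by (metis nat.case(1) shift_case_nat)
    qed (simp del: One_nat_def)
    have le: "x \<preceq> shift q" if "x = shift a" "a 0 = 1"
    proof -
      have "case_nat 1 x = a" using that case_nat_shift[of a] by metis
      then show ?thesis using case_nat_1_adm_iff[OF x] a by simp
    qed
    show ?thesis
    proof (cases "x = shift a")
      case True
      then show ?thesis
        using adm_digit[OF a, of 0] le[OF True] unfolding transfer_op_eq[OF x] cn
        by (elim disjE) simp_all
    next
      case False
      then show ?thesis unfolding transfer_op_eq[OF x] cn by simp
    qed
  qed
  moreover have "has_bochner_integral m.itin_measure
      (\<lambda>x. complex_of_real (exp t ^ a 0) * of_bool (x \<in> {shift a})) (of_real (exp t ^ a 0) * 0)"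
    by (intro has_bochner_integral_mult_right I shift_adm a)
  ultimately have "has_bochner_integral m.itin_measure (transfer_op \<beta> t (\<lambda>x. of_bool (x = a))) 0"
    by (subst has_bochner_integral_cong[OF refl _ refl]) auto
  then show ?thesis
    using I[OF a] unfolding eigen_integrable_def by (intro exI[of _ 0]) simp
qed

lemma eigen_integrable_seq_interval:
  assumes a: "a \<in> X" and b: "b \<in> X"
  shows "eigen_integrable (indicator (seq_interval \<beta> a b))"
proof (cases "a \<preceq> b")
  case True
  have "eigen_integrable (\<lambda>x. of_bool (x \<in> below q b) + ((-1) * of_bool (x \<in> below q a) + of_bool (x = a)))"
    by (intro eigen_integrable_add eigen_integrable_cmult eigen_integrable_below eigen_integrable_singleton a b)
  then show ?thesis
  proof (rule eigen_integrable_cong)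
    fix x assume "x \<in> X"
    then show "of_bool (x \<in> below q b) + ((-1) * of_bool (x \<in> below q a) + of_bool (x = a)) =
        (indicator (seq_interval \<beta> a b) x :: complex)"
      using True a lex_le_antisym[of x a] lex_le_linear[of x a] lex_le_trans[of x a b]
      by (auto simp: seq_interval_def below_def beta_shift_eq indicator_def)
  qed
next
  case False
  then have "seq_interval \<beta> a b = {}"
    by (auto simp: seq_interval_def intro: lex_le_trans)
  then show ?thesis using eigen_integrable_cong[OF eigen_integrable_zero] by simp
qed

lemma is_eigenmeasure_itin: "is_eigenmeasure m.itin_measure"
proof -
  have "eigen_integrable f" if f: "f \<in> interval_span \<beta>" for f
  proof -
    obtain S c where S: "finite S" "S \<subseteq> X \<times> X"
        "f = (\<lambda>x. \<Sum>(a, b)\<in>S. c a b * indicator (seq_interval \<beta> a b) x)"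
      using f by (auto simp: interval_span_def beta_shift_eq)
    show ?thesis
      unfolding S(3)
    proof (rule eigen_integrable_sum[OF S(1)])
      fix y assume "y \<in> S"
      then obtain a b where "y = (a, b)" "a \<in> X" "b \<in> X" using S(2) by auto
      then show "eigen_integrable (\<lambda>x. case y of (a, b) \<Rightarrow> c a b * indicator (seq_interval \<beta> a b) x)"
        using eigen_integrable_cmult[OF eigen_integrable_seq_interval] by simp
    qed
  qed
  then have "(LINT x|m.itin_measure. transfer_op \<beta> t f x) = of_real (1 / z) * (LINT x|m.itin_measure. f x)"
    if "f \<in> interval_span \<beta>" for f
    using that unfolding eigen_integrable_def by (metis has_bochner_integral_integral_eq)
  then show ?thesis
    unfolding is_eigenmeasure_def using m.prob_space_itin_measure by simp
qed

lemma eigenmeasure_eq: "eigenmeasure \<beta> t = m.itin_measure"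
proof -
  have "eigenmeasure \<beta> t = (THE \<nu>. is_eigenmeasure \<nu>)"
    unfolding eigenmeasure_def is_eigenmeasure_def leading_eigenvalue_eq beta_shift_eq ..
  also have "\<dots> = m.itin_measure"
  proof (rule the_equality)
    show "is_eigenmeasure m.itin_measure" by (rule is_eigenmeasure_itin)
    fix \<nu> assume \<nu>: "is_eigenmeasure \<nu>"
    show "\<nu> = m.itin_measure"
      by (rule measure_eqI_below[OF q_adm])
         (use \<nu> eigenmeasure_below m.prob_space_itin_measure m.measure_itin_below
           in \<open>auto simp: is_eigenmeasure_def\<close>)
  qed
  finally show ?thesis .
qed

end

section \<open>The distribution functions\<close>

context beta_base
begin

text \<open>A second 1 of \<open>q\<close> has a 1 before it, so its term increases strictly with t,
  while no term decreases.\<close>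

lemma bterm_exp_inj:
  assumes p: "0 < p" and s: "bterm (exp s) p q sums (1::real)" and t: "bterm (exp t) p q sums 1"
  shows "s = t"
proof (rule ccontr)
  have *: False if less: "s < t" and s: "bterm (exp s) p q sums (1::real)" and t: "bterm (exp t) p q sums 1" for s t
  proof -
    obtain m where m: "m \<ge> 1" "q m = 1" using q_infinitely_many_ones by blast
    have "0 < ones q m"
      using m q_0 by (auto simp: ones_def intro!: sum_pos2[of _ 0])
    have "(\<lambda>n. bterm (exp t) p q n - bterm (exp s) p q n) sums (1 - 1)"
      by (intro sums_diff s t)
    then have "summable (\<lambda>n. bterm (exp t) p q n - bterm (exp s) p q n)"
      "(\<Sum>n. bterm (exp t) p q n - bterm (exp s) p q n) = 0"
      by (auto simp: sums_iff)
    moreover have "0 \<le> bterm (exp t) p q n - bterm (exp s) p q n" for n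
      unfolding bterm_def diff_ge_0_iff_ge using p less by (intro mult_left_mono mult_right_mono power_mono) auto
    moreover have "0 < bterm (exp t) p q m - bterm (exp s) p q m"
      using m p less \<open>0 < ones q m\<close> by (auto simp: bterm_def intro!: power_strict_mono)
    ultimately show False
      using suminf_pos2[of "\<lambda>n. bterm (exp t) p q n - bterm (exp s) p q n" m] by simp
  qed
  assume "s \<noteq> t"
  then show False using *[OF _ s t] *[OF _ t s] by (meson linorder_neqE)
qed

lemma param_eq:
  assumes p: "0 < p" "p < 1" and t: "bterm (exp t) p q sums 1"
  shows "param \<beta> p = t"
  unfolding param_def the_inv_into_def
proof (rule the_equality)
  interpret beta_eigen \<beta> t p by unfold_locales (use p t in auto)
  show "t \<in> UNIV \<and> 1 / leading_eigenvalue \<beta> t = p" by (simp add: leading_eigenvalue_eq)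
next
  fix s assume s: "s \<in> UNIV \<and> 1 / leading_eigenvalue \<beta> s = p"
  \<comment> \<open>The competitor s is an arbitrary real; its leading eigenvalue is known only
    through a root for exp s.\<close>
  obtain z where z: "0 < z" "z < 1" "bterm (exp s) z q sums 1"
    using ex_root[of "exp s"] by auto
  interpret beta_eigen \<beta> s z by unfold_locales (use z in auto)
  have "z = p" using s by (simp add: leading_eigenvalue_eq)
  then show "s = t" using bterm_exp_inj[OF p(1) _ t] z by simp
qed

text \<open>At 1 the value is \<open>q\<close> rather than the greedy expansion: the preimage of
  [0,1] is the whole shift, which is \<open>below q q\<close>.\<close>

definition gdig :: "real \<Rightarrow> digits" where
  "gdig x = (if x < 1 then greedy.itin x else q)"

lemma gdig_adm: "0 \<le> x \<Longrightarrow> gdig x \<in> X"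
  using greedy.itin_adm q_adm by (simp add: gdig_def)

lemma beta_proj_eq: "beta_proj \<beta> = greedy.val"
  unfolding beta_proj_def greedy.val_def bterm_def by (simp add: power_one_over)

lemma beta_proj_le_eq_below:
  assumes x: "0 \<le> x" "x \<le> 1"
  shows "{a \<in> beta_shift \<beta>. beta_proj \<beta> a \<in> {0..x}} = below q (gdig x)"
proof (cases "x < 1")
  case True
  then show ?thesis
    using greedy.val_le_iff[OF _ x(1)] greedy.val_ge_0
    by (auto simp: beta_proj_eq beta_shift_eq below_def gdig_def)
next
  case False
  then show ?thesis
    using greedy.val_le_1 greedy.val_ge_0 adm_le x
    by (force simp: beta_proj_eq beta_shift_eq below_def gdig_def)
qed

lemma F_eq:
  assumes p: "0 < p" "p < 1" and w: "0 < w" "w * p < 1" and root: "bterm w p q sums 1"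
    and x: "0 \<le> x" "x \<le> 1"
  shows "F \<beta> p x = (\<Sum>n. bterm w p (gdig x) n)" "F \<beta> p x \<in> {0..1}"
proof -
  define t where "t = ln w"
  have t: "exp t = w" using w by (simp add: t_def)
  interpret beta_measure \<beta> t p by unfold_locales (use p w root t in auto)
  have "F \<beta> p x = measure m.itin_measure (below q (gdig x))"
    unfolding F_def distr_fun_def beta_proj_le_eq_below[OF x] param_eq[OF p root[folded t]]
      eigenmeasure_eq ..
  also have "\<dots> = m.val (gdig x)" by (rule m.measure_itin_below[OF gdig_adm[OF x(1)]])
  finally have Fv: "F \<beta> p x = m.val (gdig x)" .
  then show "F \<beta> p x = (\<Sum>n. bterm w p (gdig x) n)"
    unfolding m.val_def unfolding t .
  show "F \<beta> p x \<in> {0..1}"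
    unfolding Fv using m.val_ge_0[OF gdig_adm[OF x(1)]] m.val_le_1[OF gdig_adm[OF x(1)]] by simp
qed

end

section \<open>Analytic dependence on the parameter\<close>

definition bsum :: "digits \<Rightarrow> complex \<Rightarrow> complex \<Rightarrow> complex" where
  "bsum a w p = (\<Sum>n. bterm w p a n)"

text \<open>The partial derivative of \<open>bterm\<close> in w. The truncated exponent at
  \<open>ones a n = 0\<close> does no harm, as the factor \<open>ones a n\<close> is then 0.\<close>

definition bterm_dw :: "complex \<Rightarrow> complex \<Rightarrow> digits \<Rightarrow> nat \<Rightarrow> complex" where
  "bterm_dw w p a n = of_nat (a n) * (of_nat (ones a n) * w ^ (ones a n - 1) * p ^ Suc n)"

lemma norm_bterm_le:
  fixes w p :: complex
  assumes a: "\<And>i. a i \<le> 1" and w: "norm w \<le> W" "1 \<le> W" and p: "norm p \<le> \<rho>" "\<rho> \<le> 1"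
  shows "norm (bterm w p a n) \<le> (W * \<rho>) ^ n"
    and "norm (bterm_dw w p a n) \<le> of_nat n * (W * \<rho>) ^ n"
proof -
  have rho: "0 \<le> \<rho>" using p(1) norm_ge_zero order_trans by blast
  have on: "ones a n \<le> n" by (rule ones_le) (rule a)
  have W: "norm w ^ k \<le> W ^ n" if "k \<le> n" for k
  proof -
    have "norm w ^ k \<le> W ^ k" using w by (intro power_mono) auto
    also have "\<dots> \<le> W ^ n" using w that by (intro power_increasing) auto
    finally show ?thesis .
  qed
  have "norm p ^ Suc n \<le> \<rho> ^ Suc n" using p by (intro power_mono) auto
  also have "\<dots> \<le> \<rho> ^ n" using p rho by (simp add: mult_left_le_one_le)
  finally have P: "norm p ^ Suc n \<le> \<rho> ^ n" .
  have "norm (bterm w p a n) \<le> 1 * (W ^ n * \<rho> ^ n)"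
    unfolding bterm_def norm_mult norm_power norm_of_nat using a[of n] W[OF on] P w
    by (intro mult_mono) auto
  then show "norm (bterm w p a n) \<le> (W * \<rho>) ^ n" by (simp add: power_mult_distrib)
  have "norm (bterm_dw w p a n) \<le> 1 * (of_nat n * W ^ n * \<rho> ^ n)"
    unfolding bterm_dw_def norm_mult norm_power norm_of_nat
    using a[of n] W[of "ones a n - 1"] on P w
    by (intro mult_mono) auto
  then show "norm (bterm_dw w p a n) \<le> of_nat n * (W * \<rho>) ^ n"
    by (simp add: power_mult_distrib mult_ac)
qed

lemma summable_nat_times_power:
  fixes x :: real
  assumes "norm x < 1"
  shows "summable (\<lambda>n. of_nat n * x ^ n)"
proof -
  have "summable (\<lambda>n. of_nat (Suc n) * x ^ n - x ^ n)"
    using geometric_deriv_sums[OF assms] summable_geometric[OF assms]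
    by (intro summable_diff) (auto simp: sums_iff)
  then show ?thesis by (simp add: algebra_simps)
qed

lemma bsum_sums:
  fixes w p :: complex
  assumes a: "\<And>i. a i \<le> 1" and "norm w \<le> W" "1 \<le> W" "norm p \<le> \<rho>" "\<rho> \<le> 1" "W * \<rho> < 1"
  shows "bterm w p a sums bsum a w p"
proof -
  have "0 \<le> W * \<rho>" using assms norm_ge_zero[of p] by (intro mult_nonneg_nonneg) linarith+
  then have "summable (bterm w p a)"
    by (intro summable_comparison_test'[OF summable_geometric[of "W * \<rho>"]] norm_bterm_le assms)
       (use assms in auto)
  then show ?thesis by (simp add: bsum_def summable_sums)
qed

lemma holomorphic_on_bsum:
  assumes a: "\<And>i. a i \<le> 1" and W: "1 \<le> W" "\<rho> \<le> 1" "W * \<rho> < 1" "0 \<le> \<rho>"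
    and S: "open S" and v: "v holomorphic_on S"
    and bd: "\<And>p. p \<in> S \<Longrightarrow> norm (v p) \<le> W" "\<And>p. p \<in> S \<Longrightarrow> norm p \<le> \<rho>"
  shows "(\<lambda>p. bsum a (v p) p) holomorphic_on S"
proof (rule holomorphic_uniform_sequence[OF S, where f = "\<lambda>n p. \<Sum>i<n. bterm (v p) p a i"])
  show "(\<lambda>p. \<Sum>i<n. bterm (v p) p a i) holomorphic_on S" for n
    unfolding bterm_def by (intro holomorphic_intros v)
  fix x assume "x \<in> S"
  then obtain d where d: "0 < d" "cball x d \<subseteq> S" using S open_contains_cball by blast
  have "uniform_limit (cball x d) (\<lambda>n p. \<Sum>i<n. bterm (v p) p a i) (\<lambda>p. \<Sum>i. bterm (v p) p a i) sequentially"
  proof (rule Weierstrass_m_test)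
    show "norm (bterm (v p) p a n) \<le> (W * \<rho>) ^ n" if "p \<in> cball x d" for n p
      using that d bd by (intro norm_bterm_le a W) auto
    show "summable (\<lambda>n. (W * \<rho>) ^ n)" using W by (intro summable_geometric) auto
  qed
  then show "\<exists>d>0. cball x d \<subseteq> S \<and>
      uniform_limit (cball x d) (\<lambda>n p. \<Sum>i<n. bterm (v p) p a i) (\<lambda>p. bsum a (v p) p) sequentially"
    using d unfolding bsum_def by blast
qed

text \<open>Joint continuity keeps the derivative in w close to its value at the base point, as the
  contraction estimate of the Newton map requires.\<close>

lemma continuous_on_bsum_dw:
  assumes a: "\<And>i. a i \<le> 1" and W: "1 \<le> W" "\<rho> \<le> 1" "W * \<rho> < 1" "0 \<le> \<rho>"
  shows "continuous_on (cball 0 W \<times> cball 0 \<rho>) (\<lambda>(w, p). \<Sum>n. bterm_dw w p a n)"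
proof (rule uniform_limit_theorem)
  show "uniform_limit (cball 0 W \<times> cball 0 \<rho>) (\<lambda>n (w, p). \<Sum>i<n. bterm_dw w p a i)
      (\<lambda>(w, p). \<Sum>n. bterm_dw w p a n) sequentially"
    unfolding case_prod_unfold
  proof (rule Weierstrass_m_test)
    show "norm (bterm_dw (fst x) (snd x) a n) \<le> of_nat n * (W * \<rho>) ^ n"
      if "x \<in> cball 0 W \<times> cball 0 \<rho>" for n x
      using that W by (intro norm_bterm_le a) auto
    show "summable (\<lambda>n. of_nat n * (W * \<rho>) ^ n)"
      using W by (intro summable_nat_times_power) auto
  qed
  show "\<forall>\<^sub>F n in sequentially. continuous_on (cball 0 W \<times> cball 0 \<rho>) (\<lambda>(w, p). \<Sum>i<n. bterm_dw w p a i)"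
    unfolding case_prod_unfold bterm_dw_def by (intro always_eventually allI continuous_intros)
qed simp

text \<open>Both arguments depend on one parameter, which covers the derivative in w for fixed p as
  well as the derivative along a curve p -> (w(p), p).\<close>

lemma bsum_has_field_derivative:
  assumes a: "\<And>i. a i \<le> 1" and W: "1 \<le> W" "\<rho> \<le> 1" "W * \<rho> < 1" "0 \<le> \<rho>"
    and S: "open S" and x: "x \<in> S"
    and bd: "\<And>u. u \<in> S \<Longrightarrow> norm (v u) \<le> W" "\<And>u. u \<in> S \<Longrightarrow> norm (r u) \<le> \<rho>"
    and D: "\<And>n u. u \<in> S \<Longrightarrow> ((\<lambda>u. bterm (v u) (r u) a n) has_field_derivative D n u) (at u)"
  shows "(\<lambda>n. D n x) sums (\<Sum>n. D n x)"
    "((\<lambda>u. bsum a (v u) (r u)) has_field_derivative (\<Sum>n. D n x)) (at x)"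
proof -
  have sm: "summable (\<lambda>n. (W * \<rho>) ^ n)" using W by (intro summable_geometric) auto
  have ev: "\<forall>\<^sub>F n in sequentially. \<forall>u\<in>S. norm (bterm (v u) (r u) a n) \<le> (W * \<rho>) ^ n"
    using bd W by (intro always_eventually allI ballI norm_bterm_le a)
  obtain g g' where g: "\<forall>u \<in> S. ((\<lambda>n. bterm (v u) (r u) a n) sums g u) \<and>
      ((\<lambda>n. D n u) sums g' u) \<and> (g has_field_derivative g' u) (at u)"
    by (rule series_and_derivative_comparison[OF S sm D ev])
  then show "(\<lambda>n. D n x) sums (\<Sum>n. D n x)" using x by (auto simp: sums_iff)
  have "(g has_field_derivative (\<Sum>n. D n x)) (at x)" using g x by (metis sums_unique)
  then show "((\<lambda>u. bsum a (v u) (r u)) has_field_derivative (\<Sum>n. D n x)) (at x)"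
    by (rule has_field_derivative_transform_within_open[OF _ S x])
       (use g in \<open>auto simp: bsum_def sums_iff\<close>)
qed

lemma bterm_has_field_derivative:
  assumes "(v has_field_derivative v') (at u)" "(r has_field_derivative r') (at u)"
  shows "((\<lambda>u. bterm (v u) (r u) a n) has_field_derivative
    v' * bterm_dw (v u) (r u) a n + r' * (of_nat (a n) * (v u ^ ones a n * (of_nat (Suc n) * r u ^ n)))) (at u)"
  unfolding bterm_def bterm_dw_def
  by (rule derivative_eq_intros assms refl | simp)+ (simp add: algebra_simps)

text \<open>For real p the conjugate of a solution is again a solution; with uniqueness this makes
  the solution real on the real axis.\<close>

lemma cnj_bsum:
  assumes a: "\<And>i. a i \<le> 1" and "norm w \<le> W" "1 \<le> W" "norm p \<le> \<rho>" "\<rho> \<le> 1" "W * \<rho> < 1"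
  shows "bsum a (cnj w) (cnj p) = cnj (bsum a w p)"
proof -
  have "(\<lambda>n. cnj (bterm w p a n)) sums cnj (bsum a w p)"
    using bsum_sums[OF assms] by (simp only: sums_cnj)
  moreover have "(\<lambda>n. cnj (bterm w p a n)) = bterm (cnj w) (cnj p) a"
    by (auto simp: bterm_def)
  ultimately show ?thesis by (simp add: bsum_def sums_iff)
qed

text \<open>The equation \<open>bsum q w p = 1\<close> is solved for \<open>w\<close> near \<open>(1, 1 / \<beta>)\<close> by the
  simplified Newton iteration; the iterates are holomorphic and converge uniformly.\<close>

context beta_base
begin

abbreviation "p0 \<equiv> 1 / complex_of_real \<beta>"

lemma ex_implicit_solution:
  obtains \<delta> W \<rho> :: real and \<omega> :: "complex \<Rightarrow> complex"
  where "0 < \<delta>" "1 \<le> W" "\<rho> \<le> 1" "W * \<rho> < 1" "0 \<le> \<rho>"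
    "\<omega> holomorphic_on ball p0 \<delta>"
    "\<And>p. p \<in> ball p0 \<delta> \<Longrightarrow> norm (\<omega> p) \<le> W"
    "\<And>p. p \<in> ball p0 \<delta> \<Longrightarrow> norm p \<le> \<rho>"
    "\<And>p. p \<in> ball p0 \<delta> \<Longrightarrow> bsum q (\<omega> p) p = 1"
    "\<omega> p0 = 1"
    "\<And>p. complex_of_real p \<in> ball p0 \<delta> \<Longrightarrow> \<exists>u>0. \<omega> (of_real p) = of_real u \<and> 0 < p \<and> p < 1 \<and> u * p < 1"
proof -
  define b where "b = 1 / \<beta>"
  have b: "0 < b" "b < 1" using beta_gt by (auto simp: b_def)
  have p0: "p0 = of_real b" by (simp add: b_def)
  \<comment> \<open>\<open>\<rho>\<close> and \<open>W\<close> exceed the moduli b and 1 of the base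
    point and still satisfy \<open>W * \<rho> < 1\<close>, so one geometric series dominates all
    terms nearby.\<close>
  define \<rho> where "\<rho> = (1 + b) / 2"
  have rho: "b < \<rho>" "\<rho> < 1" "0 < \<rho>" using b by (auto simp: \<rho>_def)
  define W where "W = (1 + 1 / \<rho>) / 2"
  have W: "1 < W" "W * \<rho> < 1" using rho by (auto simp: W_def field_simps)
  note WR = less_imp_le[OF W(1)] less_imp_le[OF rho(2)] W(2) less_imp_le[OF rho(3)]
  have q1: "q i \<le> 1" for i by (rule adm_digit_le[OF q_adm])
  define dw where "dw = (\<lambda>(w, p). \<Sum>n. bterm_dw w p q n)"
  have dw_cont: "continuous_on (cball 0 W \<times> cball 0 \<rho>) dw"
    unfolding dw_def by (rule continuous_on_bsum_dw[OF q1 WR])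
  have norm_p0: "norm p0 = b" using b by (simp add: p0)
  define D where "D = dw (1, p0)"
  have D0: "D \<noteq> 0"
  proof -
    define c where "c n = real (q n) * (real (ones q n) * b ^ Suc n)" for n
    have eq': "bterm_dw 1 p0 q n = of_real (c n)" for n
      by (simp add: bterm_dw_def p0 c_def)
    then have eq: "bterm_dw 1 p0 q = (\<lambda>n. of_real (c n))" by blast
    have "norm (c n) \<le> of_nat n * (W * \<rho>) ^ n" for n
    proof -
      have "norm (bterm_dw 1 p0 q n) \<le> of_nat n * (W * \<rho>) ^ n"
        using W rho norm_p0 by (intro norm_bterm_le q1) auto
      then show ?thesis unfolding eq by simp
    qed
    then have sm: "summable c"
      using WR by (intro summable_comparison_test'[OF summable_nat_times_power[of "W * \<rho>"]]) auto
    obtain m where m: "m \<ge> 1" "q m = 1" using q_infinitely_many_ones by blast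
    have "0 < ones q m" using m q_0 by (auto simp: ones_def intro!: sum_pos2[of _ 0])
    then have "0 < suminf c"
      using b m by (intro suminf_pos2[OF sm, of m]) (auto simp: c_def)
    moreover have "D = of_real (suminf c)"
      unfolding D_def dw_def by (simp add: eq suminf_of_real[OF sm])
    ultimately show ?thesis by simp
  qed
  have p0_in: "(1 :: complex, p0) \<in> cball 0 W \<times> cball 0 \<rho>" using W rho norm_p0 by (auto simp: dist_norm)
  obtain d where d: "0 < d" "\<And>x. x \<in> cball 0 W \<times> cball 0 \<rho> \<Longrightarrow> dist x (1, p0) < d \<Longrightarrow>
      dist (dw x) D < norm D / 2"
    using dw_cont p0_in D0 unfolding continuous_on_iff D_def
    by (metis half_gt_zero zero_less_norm_iff)
  \<comment> \<open>The bound d/3 leaves room for p, W - 1 keeps norms at most W, and 1/2 makes real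
    solutions positive.\<close>
  define \<eta> where "\<eta> = min (d / 3) (min (W - 1) (1 / 2))"
  have eta: "0 < \<eta>" "\<eta> \<le> d / 3" "\<eta> \<le> W - 1" "\<eta> \<le> 1 / 2"
    unfolding \<eta>_def using d(1) W(1) by linarith+
  have hol1: "(\<lambda>p. bsum q 1 p) holomorphic_on ball 0 \<rho>"
    using W by (intro holomorphic_on_bsum[OF q1 WR, where v = "\<lambda>_. 1"]) auto
  have one: "bsum q 1 p0 = 1"
  proof -
    have "(\<lambda>n. of_real (bterm 1 (1 / \<beta>) q n)) sums (of_real 1 :: complex)"
      using greedy.root by (simp only: sums_of_real_iff)
    moreover have "(\<lambda>n. of_real (bterm 1 (1 / \<beta>) q n)) = bterm 1 p0 q"
      by (auto simp: bterm_def)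
    ultimately show ?thesis by (simp add: bsum_def sums_iff)
  qed
  have "isCont (\<lambda>p. bsum q 1 p) p0"
    using holomorphic_on_imp_continuous_on[OF hol1] rho norm_p0
    by (auto simp: continuous_on_eq_continuous_at)
  then obtain e where e: "0 < e" "\<And>p. dist p p0 < e \<Longrightarrow> dist (bsum q 1 p) 1 < norm D * \<eta> / 2"
    using D0 eta one unfolding continuous_at_eps_delta
    by (metis mult_pos_pos half_gt_zero zero_less_norm_iff)
  \<comment> \<open>The radius e makes the first Newton step at most \<open>\<eta> / 2\<close>,
    \<rho> - b keeps norms at most \<rho>, and b and 1 - b keep real p in (0,1).\<close>
  define \<delta> where "\<delta> = min (min e (d / 3)) (min (\<rho> - b) (min b (1 - b)))"
  have delta: "0 < \<delta>" "\<delta> \<le> e" "\<delta> \<le> d / 3" "\<delta> \<le> \<rho> - b" "\<delta> \<le> b" "\<delta> \<le> 1 - b"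
    unfolding \<delta>_def using e(1) d(1) rho b by linarith+
  have p_norm: "norm p \<le> \<rho>" if "p \<in> ball p0 \<delta>" for p
    using that delta norm_p0 norm_triangle_sub[of p p0] by (auto simp: dist_norm norm_minus_commute)
  have w_norm: "norm w \<le> W" if "w \<in> cball 1 \<eta>" for w :: complex
    using that eta norm_triangle_sub[of w 1] by (auto simp: dist_norm norm_minus_commute)
  define T where "T p w = w - (bsum q w p - 1) / D" for p w
  have lip: "dist (T p w) (T p w') \<le> 1 / 2 * dist w w'"
    if p: "p \<in> ball p0 \<delta>" and w: "w \<in> cball 1 \<eta>" "w' \<in> cball 1 \<eta>" for p w w'
  proof -
    have "norm (T p w - T p w') \<le> 1 / 2 * norm (w - w')"
    proof (rule field_differentiable_bound[OF convex_cball _ _ w])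
      fix u assume u: "u \<in> cball (1::complex) \<eta>"
      have *: "((\<lambda>u. bsum q u p) has_field_derivative (\<Sum>n. 1 * bterm_dw u p q n + 0 * (of_nat (q n) * (u ^ ones q n * (of_nat (Suc n) * p ^ n))))) (at u)"
      \<comment> \<open>An open disc is needed around u, whose norm may equal W. The mean of W and
        1/\<rho> exceeds W, and its product with \<rho> is still below 1.\<close>
      proof (rule bsum_has_field_derivative(2)[where S = "ball 0 ((W + 1 / \<rho>) / 2)" and W = "(W + 1 / \<rho>) / 2" and \<rho> = \<rho> and v = "\<lambda>u. u" and r = "\<lambda>_. p"])
        have "W < 1 / \<rho>" using W rho by (simp add: field_simps)
        then show "1 \<le> (W + 1 / \<rho>) / 2" "u \<in> ball 0 ((W + 1 / \<rho>) / 2)"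
          using W w_norm[OF u] by auto
        show "(W + 1 / \<rho>) / 2 * \<rho> < 1" using W rho by (simp add: field_simps)
        show "((\<lambda>u. bterm u p q n) has_field_derivative
            1 * bterm_dw u p q n + 0 * (of_nat (q n) * (u ^ ones q n * (of_nat (Suc n) * p ^ n)))) (at u)" for n u
          by (rule bterm_has_field_derivative[OF DERIV_ident DERIV_const])
      qed (use q1 WR p_norm[OF p] in auto)
      then have "((\<lambda>u. bsum q u p) has_field_derivative dw (u, p)) (at u)"
        by (simp add: dw_def)
      then have "(T p has_field_derivative 1 - dw (u, p) / D) (at u)"
        unfolding T_def[abs_def] by (auto intro!: derivative_eq_intros simp: D0)
      then show "(T p has_field_derivative 1 - dw (u, p) / D) (at u within cball 1 \<eta>)"
        by (rule has_field_derivative_at_within)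
      have "dist (u, p) (1, p0) \<le> dist u 1 + dist p p0"
        unfolding dist_Pair_Pair by (rule sqrt_sum_squares_le_sum) auto
      also have "\<dots> < d" using u p eta delta d by (simp add: dist_commute)
      finally have "dist (dw (u, p)) D < norm D / 2"
        using w_norm[OF u] p_norm[OF p] by (intro d(2)) auto
      then have "norm (D - dw (u, p)) / norm D \<le> 1 / 2"
        using D0 by (simp add: dist_norm norm_minus_commute field_simps)
      moreover have "1 - dw (u, p) / D = (D - dw (u, p)) / D" using D0 by (simp add: diff_divide_distrib)
      ultimately show "norm (1 - dw (u, p) / D) \<le> 1 / 2" by (simp add: norm_divide)
    qed
    then show ?thesis by (simp add: dist_norm)
  qed
  have one_in: "1 \<in> cball (1::complex) \<eta>" using eta by simp
  have self: "T p w \<in> cball 1 \<eta>" if p: "p \<in> ball p0 \<delta>" and w: "w \<in> cball 1 \<eta>" for p w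
  proof -
    have "dist (T p 1) 1 = norm (bsum q 1 p - 1) / norm D"
      by (simp add: T_def dist_norm norm_divide)
    also have "\<dots> \<le> \<eta> / 2"
      using e(2)[of p] p delta D0 by (auto simp: dist_norm norm_minus_commute field_simps)
    finally have "dist (T p 1) 1 \<le> \<eta> / 2" .
    moreover have "dist (T p w) (T p 1) \<le> \<eta> / 2"
      using lip[OF p w one_in] w by (simp add: dist_commute)
    ultimately show ?thesis using dist_triangle[of "T p w" 1 "T p 1"] by (simp add: dist_commute)
  qed
  have ex1: "\<exists>!w\<in>cball 1 \<eta>. T p w = w" if p: "p \<in> ball p0 \<delta>" for p
    by (rule Banach_fix[where c = "1 / 2"])
       (use self[OF p] lip[OF p] eta in \<open>auto simp: complete_eq_closed\<close>)
  define \<omega> where "\<omega> p = (THE w. w \<in> cball 1 \<eta> \<and> T p w = w)" for p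
  have om: "\<omega> p \<in> cball 1 \<eta>" "T p (\<omega> p) = \<omega> p" if p: "p \<in> ball p0 \<delta>" for p
    using theI'[OF ex1[OF p]] by (auto simp: \<omega>_def)
  have om_unique: "w = \<omega> p" if "p \<in> ball p0 \<delta>" "w \<in> cball 1 \<eta>" "T p w = w" for p w
    using ex1[OF that(1)] om[OF that(1)] that by blast
  have om_eq: "bsum q (\<omega> p) p = 1" if p: "p \<in> ball p0 \<delta>" for p
    using om(2)[OF p] D0 by (simp add: T_def)
  define it where "it n p = (T p ^^ n) 1" for n p
  have it_Suc: "it (Suc n) p = T p (it n p)" for n p by (simp add: it_def)
  have it_in: "it n p \<in> cball 1 \<eta>" if "p \<in> ball p0 \<delta>" for n p
    by (induction n) (use one_in self[OF that] in \<open>auto simp: it_def\<close>)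
  have it_hol: "it n holomorphic_on ball p0 \<delta>" for n
  proof (induction n)
    case (Suc n)
    have "(\<lambda>p. bsum q (it n p) p) holomorphic_on ball p0 \<delta>"
      by (rule holomorphic_on_bsum[OF q1 WR open_ball Suc]) (use it_in w_norm p_norm in auto)
    then have "(\<lambda>p. T p (it n p)) holomorphic_on ball p0 \<delta>"
      unfolding T_def by (intro holomorphic_intros Suc) (use D0 in auto)
    also have "(\<lambda>p. T p (it n p)) = it (Suc n)" by (rule ext) (rule it_Suc[symmetric])
    finally show ?case .
  qed (simp add: it_def[abs_def])
  have it_conv: "dist (it n p) (\<omega> p) \<le> (1 / 2) ^ n * \<eta>" if p: "p \<in> ball p0 \<delta>" for n p
  proof (induction n)
    case (Suc n)
    have "dist (it (Suc n) p) (\<omega> p) = dist (T p (it n p)) (T p (\<omega> p))"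
      using om(2)[OF p] by (simp add: it_Suc)
    also have "\<dots> \<le> 1 / 2 * dist (it n p) (\<omega> p)"
      by (rule lip[OF p it_in[OF p] om(1)[OF p]])
    finally show ?case using Suc by simp
  qed (use om(1)[OF p] in \<open>simp add: it_def\<close>)
  have om_hol: "\<omega> holomorphic_on ball p0 \<delta>"
  proof (rule holomorphic_uniform_sequence[OF open_ball it_hol])
    fix x assume "x \<in> ball p0 \<delta>"
    then obtain k where k: "0 < k" "cball x k \<subseteq> ball p0 \<delta>" using open_contains_cball open_ball by metis
    have "uniform_limit (cball x k) it \<omega> sequentially"
    proof (rule uniform_limitI)
      fix \<epsilon> :: real assume "0 < \<epsilon>"
      have "(\<lambda>n. (1 / 2) ^ n * \<eta>) \<longlonglongrightarrow> 0 * \<eta>"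
        by (intro tendsto_mult tendsto_const LIMSEQ_power_zero) auto
      then have "eventually (\<lambda>n. (1 / 2) ^ n * \<eta> < \<epsilon>) sequentially"
        using \<open>0 < \<epsilon>\<close> by (intro order_tendstoD) auto
      then show "\<forall>\<^sub>F n in sequentially. \<forall>p\<in>cball x k. dist (it n p) (\<omega> p) < \<epsilon>"
      proof eventually_elim
        case (elim n)
        show ?case
        proof
          fix p assume "p \<in> cball x k"
          then have "p \<in> ball p0 \<delta>" using k(2) by blast
          from it_conv[OF this, of n] elim show "dist (it n p) (\<omega> p) < \<epsilon>" by linarith
        qed
      qed
    qed
    with k show "\<exists>k>0. cball x k \<subseteq> ball p0 \<delta> \<and> uniform_limit (cball x k) it \<omega> sequentially" by blast
  qed
  have om_p0: "\<omega> p0 = 1"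
    using om_unique[of p0 1] one delta eta by (auto simp: T_def)
  have real: "\<exists>u>0. \<omega> (of_real p) = of_real u \<and> 0 < p \<and> p < 1 \<and> u * p < 1"
    if p: "complex_of_real p \<in> ball p0 \<delta>" for p
  proof -
    let ?p = "complex_of_real p"
    have "\<bar>p - b\<bar> < \<delta>"
      using p unfolding p0 by (simp add: dist_norm norm_minus_commute flip: of_real_diff)
    then have p01: "0 < p" "p < 1" using delta by auto
    have "cnj (\<omega> ?p) = \<omega> ?p"
    proof (rule om_unique[OF p])
      show "cnj (\<omega> ?p) \<in> cball 1 \<eta>"
        using om(1)[OF p] complex_mod_cnj[of "1 - \<omega> ?p"] by (simp add: dist_norm)
      have "bsum q (cnj (\<omega> ?p)) (cnj ?p) = cnj (bsum q (\<omega> ?p) ?p)"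
        using w_norm[OF om(1)[OF p]] p_norm[OF p] WR by (intro cnj_bsum[of _ _ W _ \<rho>] q1)
      then show "T ?p (cnj (\<omega> ?p)) = cnj (\<omega> ?p)" by (simp add: T_def om_eq[OF p])
    qed
    then obtain u where u: "\<omega> ?p = of_real u" by (metis Reals_cases Reals_cnj_iff)
    have "norm (complex_of_real (1 - u)) \<le> \<eta>" using om(1)[OF p] unfolding u by (simp add: dist_norm)
    then have "\<bar>1 - u\<bar> \<le> \<eta>" unfolding norm_of_real .
    then have "0 < u" "u \<le> W" using eta by auto
    moreover have "p \<le> \<rho>" using p_norm[OF p] p01 by simp
    then have "u * p \<le> W * \<rho>" using \<open>u \<le> W\<close> p01 W by (intro mult_mono) auto
    ultimately show ?thesis using u p01 W by auto
  qed
  show ?thesis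
    by (rule that[OF delta(1) WR om_hol _ _ om_eq om_p0 real])
       (use w_norm om(1) p_norm in auto)
qed

end

text \<open>The Taylor coefficients of \<open>f\<close> may be complex, but the increments h are
  real, so their real parts are the coefficients of \<open>g\<close>.\<close>

lemma Re_holomorphic_fps_expansion:
  assumes f: "f holomorphic_on ball c \<delta>" and p: "complex_of_real p \<in> ball c \<delta>"
    and g: "\<And>x. complex_of_real x \<in> ball c \<delta> \<Longrightarrow> g x = Re (f (of_real x))"
  shows "\<exists>A. (\<lambda>h. g (p + h)) has_fps_expansion A"
    "(g has_field_derivative Re (deriv f (of_real p))) (at p)"
proof -
  obtain r where r: "0 < r" "ball (of_real p) r \<subseteq> ball c \<delta>"
    using p open_ball open_contains_ball by metis
  define d where "d n = (deriv ^^ n) f (of_real p) / fact n" for n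
  define A where "A = Abs_fps (\<lambda>n. Re (d n))"
  have sums: "(\<lambda>n. fps_nth A n * h ^ n) sums g (p + h)" if h: "\<bar>h\<bar> < r" for h
  proof -
    have ball: "complex_of_real (p + h) \<in> ball (of_real p) r" using h by (simp add: dist_norm)
    have "(\<lambda>n. d n * (of_real (p + h) - of_real p) ^ n) sums f (of_real (p + h))"
      unfolding d_def by (rule holomorphic_power_series[OF holomorphic_on_subset[OF f r(2)] ball])
    then have "(\<lambda>n. Re (d n * (of_real (p + h) - of_real p) ^ n)) sums Re (f (of_real (p + h)))"
      by (rule sums_Re)
    also have "(\<lambda>n. Re (d n * (of_real (p + h) - of_real p) ^ n)) = (\<lambda>n. fps_nth A n * h ^ n)"
      by (simp add: A_def fun_eq_iff flip: of_real_power)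
    also have "Re (f (of_real (p + h))) = g (p + h)"
      using g[of "p + h"] ball r(2) by auto
    finally show ?thesis .
  qed
  have "(\<lambda>h. g (p + h)) has_fps_expansion A"
    unfolding has_fps_expansion_def
  proof
    have "norm (r / 2) \<le> fps_conv_radius A"
      unfolding fps_conv_radius_def using sums[of "r / 2"] r by (intro conv_radius_geI) (auto simp: sums_iff)
    moreover have "(0::ereal) < norm (r / 2)" using r by simp
    ultimately show "0 < fps_conv_radius A" by (rule less_le_trans[rotated])
    have "eventually (\<lambda>h. h \<in> ball 0 r) (nhds (0::real))"
      using r by (intro eventually_nhds_in_open) auto
    then show "\<forall>\<^sub>F h in nhds 0. eval_fps A h = g (p + h)"
      by eventually_elim (use sums in \<open>auto simp: eval_fps_def sums_iff\<close>)
  qed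
  then show "\<exists>A. (\<lambda>h. g (p + h)) has_fps_expansion A" ..
  have "(f has_field_derivative deriv f (of_real p)) (at (of_real p))"
    by (rule holomorphic_derivI[OF f open_ball p])
  then have "((\<lambda>x. Re (f (of_real x))) has_field_derivative Re (deriv f (of_real p))) (at p)"
    by (intro has_field_derivative_Re has_vector_derivative_real_field)
  moreover have "eventually (\<lambda>x. x \<in> ball p r) (nhds p)"
    using r by (intro eventually_nhds_in_open) auto
  then have "eventually (\<lambda>x. Re (f (of_real x)) = g x) (nhds p)"
    by eventually_elim (use g r(2) in \<open>force simp: dist_norm simp flip: of_real_diff\<close>)
  ultimately show "(g has_field_derivative Re (deriv f (of_real p))) (at p)"
    by (subst (asm) DERIV_cong_ev[OF refl _ refl])
qed

section \<open>The derivative at \<open>1 / \<beta>\<close>\<close>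

context beta_base
begin

text \<open>With \<open>\<omega>\<close> the solution w as a function of p, b = 1/\<beta> and
  \<kappa> = b \<omega>'(b), this is b times the derivative at b of the n-th summand of
  \<open>bsum a (\<omega> p) p\<close>.\<close>

definition kterm :: "real \<Rightarrow> digits \<Rightarrow> nat \<Rightarrow> real" where
  "kterm \<kappa> a n = real (a n) * (1 / \<beta>) ^ Suc n * (real (Suc n) + \<kappa> * real (ones a n))"

definition K :: "real \<Rightarrow> digits \<Rightarrow> real" where
  "K \<kappa> a = (\<Sum>n. kterm \<kappa> a n)"

lemma gdig_le_1: "gdig x i \<le> 1"
  using greedy.itin_digit[of x i] adm_digit_le[OF q_adm, of i] by (auto simp: gdig_def)

text \<open>The digits \<open>gdig x\<close> do not depend on p, so \<open>F \<beta> p x\<close> is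
  for fixed x the trace on the real axis of one holomorphic function; analyticity and termwise
  differentiation come from there.\<close>

lemma G_eq_K:
  obtains U \<kappa> where "open U" "U \<subseteq> {0<..<1}" "1 / \<beta> \<in> U"
    "\<And>x p. x \<in> {0..1} \<Longrightarrow> p \<in> U \<Longrightarrow> F \<beta> p x \<in> {0..1}"
    "\<And>x. x \<in> {0..1} \<Longrightarrow> real_analytic_on (\<lambda>p. F \<beta> p x) U"
    "\<And>x. x \<in> {0..1} \<Longrightarrow> G \<beta> x = K \<kappa> (gdig x)"
    "K \<kappa> q = 0"
proof (rule ex_implicit_solution)
  fix \<delta> W \<rho> :: real and \<omega> :: "complex \<Rightarrow> complex"
  assume delta: "0 < \<delta>" and W: "1 \<le> W" "\<rho> \<le> 1" "W * \<rho> < 1" "0 \<le> \<rho>"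
    and hol: "\<omega> holomorphic_on ball p0 \<delta>"
    and om_le: "\<And>p. p \<in> ball p0 \<delta> \<Longrightarrow> norm (\<omega> p) \<le> W"
    and p_le: "\<And>p. p \<in> ball p0 \<delta> \<Longrightarrow> norm p \<le> \<rho>"
    and om_eq: "\<And>p. p \<in> ball p0 \<delta> \<Longrightarrow> bsum q (\<omega> p) p = 1"
    and om_p0: "\<omega> p0 = 1"
    and om_real: "\<And>p. complex_of_real p \<in> ball p0 \<delta> \<Longrightarrow>
      \<exists>u>0. \<omega> (of_real p) = of_real u \<and> 0 < p \<and> p < 1 \<and> u * p < 1"
  define b where "b = 1 / \<beta>"
  have p0: "p0 = of_real b" by (simp add: b_def)
  define U where "U = {p. complex_of_real p \<in> ball p0 \<delta>}"
  have U_eq: "U = ball b \<delta>"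
    unfolding U_def p0 by (auto simp: dist_norm simp flip: of_real_diff)
  have b_in: "b \<in> U" using delta by (simp add: U_eq)
  define g where "g a p = bsum a (\<omega> p) p" for a p
  define \<omega>' where "\<omega>' = deriv \<omega> p0"
  define \<kappa> where "\<kappa> = b * Re \<omega>'"
  have g_hol: "g a holomorphic_on ball p0 \<delta>" if "\<And>i. a i \<le> 1" for a
    unfolding g_def[abs_def] by (rule holomorphic_on_bsum[OF that W open_ball hol om_le p_le])
  have q1: "q i \<le> 1" for i by (rule adm_digit_le[OF q_adm])
  have F_g: "F \<beta> p x = Re (g (gdig x) (of_real p))" "F \<beta> p x \<in> {0..1}"
    if x: "x \<in> {0..1}" and p: "complex_of_real p \<in> ball p0 \<delta>" for x p
  proof -
    obtain u where u: "0 < u" "\<omega> (of_real p) = of_real u" "0 < p" "p < 1" "u * p < 1"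
      using om_real[OF p] by blast
    have of_real_bterm: "bterm (of_real u) (of_real p) a = (\<lambda>n. complex_of_real (bterm u p a n))" for a
      by (auto simp: bterm_def)
    have sums: "bterm (complex_of_real u) (of_real p) a sums g a (of_real p)" if "\<And>i. a i \<le> 1" for a
      unfolding g_def u(2)[symmetric] by (rule bsum_sums[OF that om_le[OF p] W(1) p_le[OF p] W(2,3)])
    have "(\<lambda>n. complex_of_real (bterm u p q n)) sums of_real 1"
      using sums[of q, OF q1] om_eq[OF p] by (simp add: of_real_bterm g_def)
    then have root: "bterm u p q sums 1" by (simp only: sums_of_real_iff)
    have "(\<lambda>n. Re (complex_of_real (bterm u p (gdig x) n))) sums Re (g (gdig x) (of_real p))"
      using sums[of "gdig x", OF gdig_le_1] unfolding of_real_bterm by (rule sums_Re)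
    then have "bterm u p (gdig x) sums Re (g (gdig x) (of_real p))" by simp
    then show "F \<beta> p x = Re (g (gdig x) (of_real p))" "F \<beta> p x \<in> {0..1}"
      using F_eq[OF u(3,4,1,5) root, of x] x by (auto simp: sums_iff)
  qed
  have deriv_g: "K \<kappa> a = b * Re (deriv (g a) p0)" if a: "\<And>i. a i \<le> 1" for a
  proof -
    define D where "D n u = deriv \<omega> u * bterm_dw (\<omega> u) u a n +
        1 * (of_nat (a n) * (\<omega> u ^ ones a n * (of_nat (Suc n) * u ^ n)))" for n u
    have p0_in: "p0 \<in> ball p0 \<delta>" using delta by simp
    have D: "((\<lambda>u. bterm (\<omega> u) u a n) has_field_derivative D n u) (at u)" if "u \<in> ball p0 \<delta>" for n u
      unfolding D_def
      by (rule bterm_has_field_derivative[OF holomorphic_derivI[OF hol open_ball that] DERIV_ident])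
    have "(g a has_field_derivative (\<Sum>n. D n p0)) (at p0)"
      unfolding g_def[abs_def]
      by (rule bsum_has_field_derivative(2)[OF a W open_ball p0_in om_le p_le D])
    then have "deriv (g a) p0 = (\<Sum>n. D n p0)" by (rule DERIV_imp_deriv)
    moreover have "(\<lambda>n. D n p0) sums (\<Sum>n. D n p0)"
      by (rule bsum_has_field_derivative(1)[OF a W open_ball p0_in om_le p_le D])
    ultimately have "(\<lambda>n. D n p0) sums deriv (g a) p0" by simp
    then have "(\<lambda>n. b * Re (D n p0)) sums (b * Re (deriv (g a) p0))"
      by (intro sums_mult sums_Re)
    moreover have "b * Re (D n p0) = kterm \<kappa> a n" for n
    proof -
      have "D n p0 = \<omega>' * of_real (real (a n) * (real (ones a n) * b ^ Suc n)) +
          of_real (real (a n) * (real (Suc n) * b ^ n))"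
        unfolding D_def om_p0 bterm_dw_def \<omega>'_def unfolding p0 by simp
      then have "Re (D n p0) = Re \<omega>' * (real (a n) * (real (ones a n) * b ^ Suc n)) +
          real (a n) * (real (Suc n) * b ^ n)"
        by simp
      then show ?thesis
        unfolding kterm_def \<kappa>_def b_def[symmetric] by (simp add: algebra_simps)
    qed
    ultimately show ?thesis by (simp add: K_def sums_iff)
  qed
  have "deriv (g q) p0 = 0"
  proof (rule DERIV_imp_deriv)
    have "((\<lambda>_. 1) has_field_derivative 0) (at p0)" by (rule DERIV_const)
    then show "(g q has_field_derivative 0) (at p0)"
      by (rule has_field_derivative_transform_within_open[OF _ open_ball, of _ _ _ p0 \<delta>])
         (use delta om_eq in \<open>auto simp: g_def\<close>)
  qed
  then have Kq: "K \<kappa> q = 0" using deriv_g[OF q1] by simp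
  have GK: "G \<beta> x = K \<kappa> (gdig x)" if x: "x \<in> {0..1}" for x
  proof -
    have "((\<lambda>p. F \<beta> p x) has_field_derivative Re (deriv (g (gdig x)) (of_real b))) (at b)"
      by (rule Re_holomorphic_fps_expansion(2)[OF g_hol[OF gdig_le_1]])
         (use F_g(1)[OF x] b_in in \<open>auto simp: U_def\<close>)
    then have "deriv (\<lambda>p. F \<beta> p x) b = Re (deriv (g (gdig x)) (of_real b))"
      by (rule DERIV_imp_deriv)
    then show ?thesis
      unfolding G_def deriv_g[OF gdig_le_1] b_def[symmetric] p0 by simp
  qed
  have an: "real_analytic_on (\<lambda>p. F \<beta> p x) U" if x: "x \<in> {0..1}" for x
    unfolding real_analytic_on_def
  proof
    fix p assume "p \<in> U"
    then have p: "complex_of_real p \<in> ball p0 \<delta>" by (simp add: U_def)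
    show "\<exists>A. (\<lambda>h. F \<beta> (p + h) x) has_fps_expansion A"
      by (rule Re_holomorphic_fps_expansion(1)[OF g_hol[OF gdig_le_1] p, where g = "\<lambda>p. F \<beta> p x"])
         (rule F_g(1)[OF x])
  qed
  show thesis
  proof (rule that[of U \<kappa>])
    show "open U" by (simp add: U_eq)
    show "U \<subseteq> {0<..<1}" using om_real by (force simp: U_def)
    show "1 / \<beta> \<in> U" using b_in by (simp add: b_def)
  qed (use F_g(2) an GK Kq in \<open>auto simp: U_def\<close>)
qed

section \<open>Continuity\<close>

lemma summable_kterm_bound: "summable (\<lambda>n. (1 + \<bar>\<kappa>\<bar>) * (real (Suc n) * (1 / \<beta>) ^ n))"
  using geometric_deriv_sums[of "1 / \<beta>"] beta_gt by (intro summable_mult) (auto simp: sums_iff)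

lemma norm_kterm_le:
  assumes "\<And>i. a i \<le> 1"
  shows "norm (kterm \<kappa> a n) \<le> (1 + \<bar>\<kappa>\<bar>) * (real (Suc n) * (1 / \<beta>) ^ n)"
proof -
  have "real (ones a n) \<le> real (Suc n)" using ones_le[of a n, OF assms] by simp
  then have "\<bar>\<kappa>\<bar> * real (ones a n) \<le> \<bar>\<kappa>\<bar> * real (Suc n)" by (intro mult_left_mono) auto
  then have "\<bar>real (Suc n) + \<kappa> * real (ones a n)\<bar> \<le> (1 + \<bar>\<kappa>\<bar>) * real (Suc n)"
    using abs_triangle_ineq[of "real (Suc n)" "\<kappa> * real (ones a n)"]
    by (simp add: abs_mult algebra_simps)
  moreover have "(1 / \<beta>) ^ Suc n \<le> (1 / \<beta>) ^ n"
    using beta_gt by (intro power_decreasing) auto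
  ultimately have "real (a n) * (1 / \<beta>) ^ Suc n * \<bar>real (Suc n) + \<kappa> * real (ones a n)\<bar> \<le>
      1 * (1 / \<beta>) ^ n * ((1 + \<bar>\<kappa>\<bar>) * real (Suc n))"
    using assms[of n] beta_gt by (intro mult_mono) auto
  then show ?thesis
    using beta_gt by (simp add: kterm_def abs_mult mult_ac)
qed

lemma summable_kterm: "(\<And>i. a i \<le> 1) \<Longrightarrow> summable (kterm \<kappa> a)"
  by (rule summable_comparison_test'[OF summable_kterm_bound norm_kterm_le])

lemma kterm_cong: "(\<And>i. i \<le> n \<Longrightarrow> a i = b i) \<Longrightarrow> kterm \<kappa> a n = kterm \<kappa> b n"
  unfolding kterm_def using ones_cong[of n a b] by simp

text \<open>Each summand is eventually constant, and the common summable majorant allows the limit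
  to be taken under the sum.\<close>

lemma tendsto_K:
  assumes le: "\<And>y i. A y i \<le> 1" and ev: "\<And>n. eventually (\<lambda>y. A y n = a n) Q" and Q: "Q \<noteq> bot"
  shows "((\<lambda>y. K \<kappa> (A y)) \<longlongrightarrow> K \<kappa> a) Q"
proof -
  have lim: "((\<lambda>y. kterm \<kappa> (A y) n) \<longlongrightarrow> kterm \<kappa> a n) Q" for n
  proof (rule tendsto_eventually)
    have "eventually (\<lambda>y. \<forall>i\<in>{..n}. A y i = a i) Q"
      by (intro eventually_ball_finite ballI ev) simp
    then show "eventually (\<lambda>y. kterm \<kappa> (A y) n = kterm \<kappa> a n) Q"
      by eventually_elim (intro kterm_cong, simp)
  qed
  have bound: "eventually (\<lambda>(n, y). norm (kterm \<kappa> (A y) n) \<le> (1 + \<bar>\<kappa>\<bar>) * (real (Suc n) * (1 / \<beta>) ^ n)) (at_top \<times>\<^sub>F Q)"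
    using norm_kterm_le[OF le] by (intro always_eventually) auto
  show ?thesis
    using tannerys_theorem[OF lim bound summable_kterm_bound Q] by (simp add: K_def)
qed

section \<open>One-sided limits of the greedy digits\<close>

lemma greedy_T: "greedy.T u = (if \<beta> * u < 1 then \<beta> * u else \<beta> * u - 1)"
  using beta_gt by (simp add: greedy.T_def field_simps)

lemma itin_eq: "greedy.itin u n = (if \<beta> * (greedy.T ^^ n) u < 1 then 0 else 1)"
  using beta_gt by (simp add: greedy.itin_def field_simps)

text \<open>The branches of the greedy map are closed on the left, so it is right-continuous and,
  being increasing on each branch, preserves approach from the right.\<close>

lemma filterlim_T_right:
  "filterlim greedy.T (at_right (greedy.T u)) (at_right u)"
  "eventually (\<lambda>y. \<beta> * y < 1 \<longleftrightarrow> \<beta> * u < 1) (at_right u)"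
proof -
  show ev: "eventually (\<lambda>y. \<beta> * y < 1 \<longleftrightarrow> \<beta> * u < 1) (at_right u)"
  proof (cases "\<beta> * u < 1")
    case True
    then have "eventually (\<lambda>y. y \<in> {u<..<1 / \<beta>}) (at_right u)"
      using beta_gt by (intro eventually_at_right_real) (simp add: field_simps)
    then show ?thesis
      by eventually_elim (use True beta_gt in \<open>auto simp: field_simps\<close>)
  next
    case False
    have "eventually (\<lambda>y. u < y) (at_right u)" by (rule eventually_at_right_less)
    then show ?thesis
    proof eventually_elim
      case (elim y)
      then have "\<beta> * u < \<beta> * y" using beta_gt by simp
      with False show ?case by simp
    qed
  qed
  have "eventually (\<lambda>y. greedy.T y = \<beta> * (y - u) + greedy.T u) (at_right u)"
    using ev by eventually_elim (auto simp: greedy_T algebra_simps)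
  moreover have "filterlim (\<lambda>y. \<beta> * (y - u) + greedy.T u) (at_right (greedy.T u)) (at_right u)"
    unfolding filterlim_at
  proof
    have "((\<lambda>y. \<beta> * (y - u) + greedy.T u) \<longlongrightarrow> \<beta> * (u - u) + greedy.T u) (at_right u)"
      by (intro tendsto_intros)
    then show "((\<lambda>y. \<beta> * (y - u) + greedy.T u) \<longlongrightarrow> greedy.T u) (at_right u)" by simp
    show "eventually (\<lambda>y. \<beta> * (y - u) + greedy.T u \<in> {greedy.T u<..} \<and>
        \<beta> * (y - u) + greedy.T u \<noteq> greedy.T u) (at_right u)"
      using eventually_at_right_less[of u]
      by eventually_elim (use beta_gt in auto)
  qed
  ultimately show "filterlim greedy.T (at_right (greedy.T u)) (at_right u)"
    by (simp add: filterlim_cong)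
qed

lemma gdig_at_right:
  assumes "x < 1"
  shows "eventually (\<lambda>y. gdig y n = gdig x n) (at_right x)"
proof -
  have "filterlim (greedy.T ^^ n) (at_right ((greedy.T ^^ n) x)) (at_right x)"
  proof (induction n)
    case (Suc n)
    have "filterlim (\<lambda>y. greedy.T ((greedy.T ^^ n) y)) (at_right (greedy.T ((greedy.T ^^ n) x))) (at_right x)"
      using filterlim_T_right(1) Suc by (rule filterlim_compose)
    then show ?case by (simp add: o_def)
  qed (simp add: filterlim_ident)
  then have "eventually (\<lambda>y. \<beta> * (greedy.T ^^ n) y < 1 \<longleftrightarrow> \<beta> * (greedy.T ^^ n) x < 1) (at_right x)"
    by (rule eventually_compose_filterlim[OF filterlim_T_right(2)])
  moreover have "eventually (\<lambda>y. y \<in> {x<..<1}) (at_right x)"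
    using assms by (rule eventually_at_right_real)
  ultimately show ?thesis
    by eventually_elim (use assms in \<open>auto simp: gdig_def itin_eq\<close>)
qed

lemma greedy_eq_itin:
  assumes "0 \<le> u" "u < 1"
  shows "greedy \<beta> u n = greedy.itin u n"
proof -
  have fl: "\<lfloor>\<beta> * v\<rfloor> = (if \<beta> * v < 1 then 0 else 1)" if "0 \<le> v" "v < 1" for v
  proof -
    have "\<beta> * v < 2" using that beta_gt beta_lt mult_strict_mono[of \<beta> 2 v 1] by simp
    moreover have "0 \<le> \<beta> * v" using that beta_gt by simp
    ultimately show ?thesis by (auto simp: floor_eq_iff)
  qed
  have map: "beta_map \<beta> v = greedy.T v" if "0 \<le> v" "v < 1" for v
    using fl[OF that] by (simp add: beta_map_def greedy_T)
  have "(beta_map \<beta> ^^ n) u = (greedy.T ^^ n) u" for n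
  proof (induction n)
    case (Suc n)
    have "(beta_map \<beta> ^^ Suc n) u = beta_map \<beta> ((greedy.T ^^ n) u)" using Suc by simp
    also have "\<dots> = greedy.T ((greedy.T ^^ n) u)"
      by (rule map[OF greedy.T_funpow_bounds[OF assms]])
    finally show ?case by simp
  qed simp
  then have "greedy \<beta> u n = nat \<lfloor>\<beta> * (greedy.T ^^ n) u\<rfloor>" by (simp add: greedy_def)
  also have "\<dots> = greedy.itin u n"
    unfolding fl[OF greedy.T_funpow_bounds[OF assms]] itin_eq by simp
  finally show ?thesis .
qed

lemma gdig_at_left:
  assumes "0 < x" "x \<le> 1"
  shows "eventually (\<lambda>y. gdig y n = ldigits x n) (at_left x)"
  using eventually_at_left_real[OF assms(1)] greedy_at_left[OF assms, of n]
  by eventually_elim (use assms greedy_eq_itin in \<open>auto simp: gdig_def\<close>)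

text \<open>The vanishing of \<open>K\<close> at \<open>q\<close> identifies the two expansions of a number with a finite
  greedy expansion.\<close>

lemma K_finite_eq_quasi:
  assumes Kq: "K \<kappa> q = 0"
    and eq: "\<And>i. i < m \<Longrightarrow> a i = b i" and a: "a m = 1" "\<And>i. a (i + Suc m) = 0"
    and b: "b m = 0" "\<And>i. b (i + Suc m) = q i" and b1: "\<And>i. b i \<le> 1"
  shows "K \<kappa> a = K \<kappa> b"
proof -
  define P where "P = (\<Sum>i<m. kterm \<kappa> b i)"
  define c where "c = real (Suc m) + \<kappa> * real (ones b m)"
  have "kterm \<kappa> a i = 0" if "i \<notin> {..<Suc m}" for i
    using a(2)[of "i - Suc m"] that by (simp add: kterm_def)
  then have "K \<kappa> a = (\<Sum>i<Suc m. kterm \<kappa> a i)"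
    unfolding K_def by (intro suminf_finite) auto
  also have "\<dots> = P + (1 / \<beta>) ^ Suc m * c"
    unfolding P_def c_def using eq kterm_cong[of _ a b] ones_cong[of m a b] a(1)
    by (simp add: kterm_def[of \<kappa> a m])
  finally have Ka: "K \<kappa> a = P + (1 / \<beta>) ^ Suc m * c" .
  have ones_b: "ones b (Suc m + i) = ones b m + ones q i" for i
    unfolding ones_add[of b "Suc m"] b(2) by (simp add: ones_Suc b(1))
  have tail: "kterm \<kappa> b (i + Suc m) =
      (1 / \<beta>) ^ Suc m * (c * (real (q i) / \<beta> ^ Suc i) + kterm \<kappa> q i)" for i
  proof -
    have o: "ones b (i + Suc m) = ones b m + ones q i"
      using ones_b[of i] by (simp only: add.commute)
    have p: "(1 / \<beta>) ^ Suc (i + Suc m) = (1 / \<beta>) ^ Suc m * (1 / \<beta>) ^ Suc i"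
      by (subst power_add[symmetric]) (simp add: add.commute)
    have s: "real (Suc (i + Suc m)) = real (Suc m) + real (Suc i)" by simp
    have d: "real (q i) / \<beta> ^ Suc i = real (q i) * (1 / \<beta>) ^ Suc i" by (simp add: power_one_over)
    show ?thesis
      unfolding kterm_def c_def o p s d b(2) of_nat_add
      by (simp add: algebra_simps del: power_Suc of_nat_Suc)
  qed
  have "(\<lambda>i. (1 / \<beta>) ^ Suc m * (c * (real (q i) / \<beta> ^ Suc i) + kterm \<kappa> q i)) sums
      ((1 / \<beta>) ^ Suc m * (c * 1 + K \<kappa> q))"
    unfolding K_def
    by (intro sums_mult sums_add q_sums summable_sums summable_kterm adm_digit_le[OF q_adm])
  then have "(\<Sum>i. kterm \<kappa> b (i + Suc m)) = (1 / \<beta>) ^ Suc m * c"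
    unfolding tail by (simp add: sums_iff Kq)
  moreover have "K \<kappa> b = (\<Sum>i. kterm \<kappa> b (i + Suc m)) + (\<Sum>i<Suc m. kterm \<kappa> b i)"
    unfolding K_def by (rule suminf_split_initial_segment[OF summable_kterm[OF b1]])
  moreover have "kterm \<kappa> b m = 0" using b(1) by (simp add: kterm_def)
  ultimately show ?thesis by (simp add: Ka P_def)
qed

text \<open>For x < 1 the two expansions differ exactly when the orbit under \<open>lmap\<close>
  reaches 1. Its first hitting time m + 1 gives a common prefix of length m, followed by 0 and
  \<open>q\<close> in one and by 1000... in the other.\<close>

lemma K_ldigits:
  assumes x: "0 < x" "x \<le> 1" and Kq: "K \<kappa> q = 0"
  shows "K \<kappa> (ldigits x) = K \<kappa> (gdig x)"
proof (cases "x = 1")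
  case True
  then show ?thesis by (simp add: gdig_def q_def)
next
  case False
  then have x1: "x < 1" using x by simp
  have ld1: "ldigits x i \<le> 1" for i using ldigits_eq[OF x, of i] by simp
  have step: "\<beta> * (lmap ^^ i) x \<noteq> 1" if "(lmap ^^ Suc i) x \<noteq> 1" for i
    using that ldigits_eq[OF x, of i] lmap_Suc[OF x, of i] by auto
  have same: "(lmap ^^ i) x = (greedy.T ^^ i) x" if "\<And>j. j \<le> i \<Longrightarrow> (lmap ^^ j) x \<noteq> 1" for i
    using that
  proof (induction i)
    case (Suc i)
    have "(lmap ^^ i) x = (greedy.T ^^ i) x" using Suc by simp
    moreover have "\<beta> * (lmap ^^ i) x \<noteq> 1" using Suc.prems by (intro step) blast
    ultimately show ?case
      using lmap_Suc[OF x, of i] ldigits_eq[OF x, of i] greedy_T[of "(greedy.T ^^ i) x"] by auto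
  qed simp
  have dig: "ldigits x i = gdig x i" if "\<And>j. j \<le> Suc i \<Longrightarrow> (lmap ^^ j) x \<noteq> 1" for i
  proof -
    have "\<beta> * (lmap ^^ i) x \<noteq> 1" using that by (intro step) blast
    moreover have "(lmap ^^ i) x = (greedy.T ^^ i) x" using that by (intro same) simp
    ultimately show ?thesis using ldigits_eq[OF x, of i] x1 by (simp add: gdig_def itin_eq)
  qed
  show ?thesis
  proof (cases "\<exists>n. (lmap ^^ n) x = 1")
    case False
    then have "ldigits x = gdig x" using dig by blast
    then show ?thesis by simp
  next
    case True
    define n where "n = (LEAST n. (lmap ^^ n) x = 1)"
    have n: "(lmap ^^ n) x = 1" unfolding n_def using True by (rule LeastI_ex)
    have less: "(lmap ^^ j) x \<noteq> 1" if "j < n" for j using that not_less_Least unfolding n_def by blast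
    have "n \<noteq> 0" using n x1 by (intro notI) simp
    then obtain m where m: "n = Suc m" using not0_implies_Suc by blast
    have vm: "(lmap ^^ m) x < 1"
      using less[of m] lmap_funpow_bounds[OF x, of m] m by simp
    \<comment> \<open>The orbit enters 1 with digit 0: digit 1 would need \<beta> v = 2 at a point v
      < 1, impossible for \<beta> < 2.\<close>
    have "\<beta> * (lmap ^^ m) x = 1" and ldm: "ldigits x m = 0"
      using n lmap_Suc[OF x, of m] ldigits_eq[OF x, of m] vm beta_lt lmap_funpow_bounds(1)[OF x, of m]
        mult_strict_mono[of \<beta> 2 "(lmap ^^ m) x" 1] unfolding m by (auto split: if_splits)
    moreover have "(lmap ^^ m) x = (greedy.T ^^ m) x" using less m by (intro same) simp
    ultimately have T1: "\<beta> * (greedy.T ^^ m) x = 1" by simp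
    have T0: "(greedy.T ^^ (i + Suc m)) x = 0" for i
      by (induction i) (use T1 greedy_T[of 0] greedy_T[of "(greedy.T ^^ m) x"] in simp_all)
    show ?thesis
    proof (rule K_finite_eq_quasi[OF Kq, symmetric])
      show "gdig x i = ldigits x i" if "i < m" for i
        using that less m by (intro dig[symmetric]) auto
      show "gdig x m = 1" using T1 x1 by (simp add: gdig_def itin_eq)
      show "gdig x (i + Suc m) = 0" for i using T0[of i] x1 by (simp add: gdig_def itin_eq del: funpow.simps)
      show "ldigits x (i + Suc m) = q i" for i
      proof -
        have "(lmap ^^ (i + Suc m)) x = (lmap ^^ i) 1"
          by (simp only: funpow_add o_apply n[unfolded m])
        then show ?thesis by (simp only: ldigits_def q_def)
      qed
    qed (use ldm ld1 in auto)
  qed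
qed

lemma continuous_on_K_gdig:
  assumes Kq: "K \<kappa> q = 0"
  shows "continuous_on {0..1} (\<lambda>x. K \<kappa> (gdig x))"
  unfolding continuous_on_def
proof
  fix x :: real assume x: "x \<in> {0..1}"
  let ?f = "\<lambda>x. K \<kappa> (gdig x)"
  have right: "(?f \<longlongrightarrow> ?f x) (at_right x)" if "x < 1"
    by (rule tendsto_K[OF gdig_le_1 gdig_at_right[OF that]]) simp
  have left: "(?f \<longlongrightarrow> ?f x) (at_left x)" if "0 < x"
  proof -
    have "(?f \<longlongrightarrow> K \<kappa> (ldigits x)) (at_left x)"
      by (rule tendsto_K[OF gdig_le_1 gdig_at_left[OF that]]) (use x in auto)
    then show ?thesis using K_ldigits[OF that _ Kq] x by simp
  qed
  consider "x = 0" | "x = 1" | "0 < x" "x < 1" using x by fastforce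
  then show "(?f \<longlongrightarrow> ?f x) (at x within {0..1})"
  proof cases
    case 1
    then show ?thesis using right by (simp add: at_within_Icc_at_right)
  next
    case 2
    then show ?thesis using left by (simp add: at_within_Icc_at_left)
  next
    case 3
    then show ?thesis using left right by (simp add: at_within_Icc_at filterlim_split_at)
  qed
qed

section \<open>Non-differentiability\<close>

text \<open>Behind a full prefix of \<open>gdig x\<close> the tail has value less than 1, so it
  differs from \<open>q\<close>; it copies \<open>q\<close> up to a 0 in place of a 1, and the
  prefix extended to this position is again full by \<open>adm_drop_digit\<close>. At x = 1 a digit
  of \<open>q\<close> is lowered instead, so only the first m of the m + 1 digits of
  \<open>u\<close> need to agree with \<open>gdig x\<close>.\<close>

lemma ex_full_word:
  assumes x: "x \<in> {0..1}"
  obtains m u where "m \<ge> M" "\<And>b. b \<in> X \<Longrightarrow> cat (Suc m) u b \<in> X" "\<And>i. i < m \<Longrightarrow> u i = gdig x i"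
proof (cases "x < 1")
  case False
  obtain k where k: "k \<ge> M" "q k = 1" using q_infinitely_many_ones by blast
  show ?thesis
    by (rule that[of k "q(k := 0)"])
       (use k False adm_drop_digit[OF q_adm k(2)] in \<open>auto simp: gdig_def\<close>)
next
  case True
  let ?c = "gdig x"
  define full where "full m \<longleftrightarrow> (\<forall>b\<in>X. cat m ?c b \<in> X)" for m
  have c: "?c \<in> X" using gdig_adm x by simp
  have step: "\<exists>m'>m. full m'" if m: "full m" for m
  proof -
    let ?d = "\<lambda>i. ?c (i + m)"
    have d: "?d = greedy.itin ((greedy.T ^^ m) x)"
      using True greedy.itin_shift[of x m] by (simp add: gdig_def)
    have "greedy.val ?d = (greedy.T ^^ m) x"
      unfolding d using x True by (intro greedy.val_itin greedy.T_funpow_bounds) auto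
    also have "\<dots> < 1" using x True by (intro greedy.T_funpow_bounds) auto
    finally have "?d \<noteq> q" using greedy.val_q by auto
    then obtain k where k: "\<And>i. i < k \<Longrightarrow> ?d i = q i" "?d k = 0" "q k = 1"
      using adm_first_diff[OF adm_shift[OF c] q_adm adm_le[OF adm_shift[OF c]]] by metis
    have "full (m + Suc k)"
      unfolding full_def
    proof
      fix b assume b: "b \<in> X"
      have "cat m ?c (cat (Suc k) (q(k := 0)) b) \<in> X"
        using m adm_drop_digit[OF q_adm k(3) b] by (auto simp: full_def)
      also have "cat m ?c (cat (Suc k) (q(k := 0)) b) = cat (m + Suc k) ?c b"
      proof
        fix i
        consider "i < m" | "m \<le> i" "i < m + k" | "i = m + k" | "m + k < i" by linarith
        then show "cat m ?c (cat (Suc k) (q(k := 0)) b) i = cat (m + Suc k) ?c b i"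
        proof cases
          case 2
          then have "i - m < k" by linarith
          then show ?thesis using 2 k(1)[of "i - m"] by (auto simp: cat_def)
        next
          case 3
          then show ?thesis using k(2) by (simp add: cat_def add.commute)
        qed (auto simp: cat_def)
      qed
      finally show "cat (m + Suc k) ?c b \<in> X" .
    qed
    then show ?thesis by (intro exI[of _ "m + Suc k"]) simp
  qed
  have "\<exists>m\<ge>M. full m"
  proof (induction M)
    case 0
    have "full 0" by (simp add: full_def cat_def)
    then show ?case by blast
  next
    case (Suc M)
    then obtain m where "m \<ge> M" "full m" by blast
    then obtain m' where "m' > m" "full m'" using step by blast
    with \<open>m \<ge> M\<close> show ?case by (intro exI[of _ m']) auto
  qed
  then obtain m where m: "m \<ge> M" "full m" by blast
  then obtain m' where m': "m' > m" "full m'" using step by blast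
  then have "Suc (m' - 1) = m'" by simp
  then show ?thesis
    using that[of "m' - 1" ?c] m m' by (auto simp: full_def)
qed

section \<open>Test points behind a full word\<close>

definition unit_digits :: "nat \<Rightarrow> digits" where
  "unit_digits j = (\<lambda>i. of_bool (i = j))"

lemma unit_digits_adm: "unit_digits j \<in> X"
proof -
  have "(\<lambda>i. unit_digits j (i + n)) \<preceq> q" for n
  proof -
    consider "j = n" | "j \<noteq> n" by blast
    then show ?thesis
    proof cases
      case 1
      obtain m where m: "m \<ge> 1" "q m = 1" using q_infinitely_many_ones by blast
      show ?thesis
      proof (rule ccontr)
        assume "\<not> ?thesis"
        then obtain k where k: "\<forall>i<k. unit_digits j (i + n) = q i" "q k < unit_digits j (k + n)"
          by (auto simp: not_lex_le_iff)
        then have "k = 0" using 1 by (auto simp: unit_digits_def of_bool_def split: if_splits)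
        then show False using k q_0 1 by (simp add: unit_digits_def)
      qed
    next
      case 2
      then show ?thesis
        using q_0 by (intro lex_less_imp_le[of 0]) (auto simp: unit_digits_def)
    qed
  qed
  then show ?thesis by (auto simp: adm_def unit_digits_def)
qed

lemma suminf_cat_unit:
  fixes f :: "nat \<Rightarrow> real"
  assumes "\<And>i. cat m u (unit_digits j) i = 0 \<Longrightarrow> f i = 0"
  shows "suminf f = (\<Sum>i<m. f i) + f (m + j)"
proof -
  have 0: "f i = 0" if "i \<ge> m" "i \<noteq> m + j" for i
    using that by (intro assms) (auto simp: cat_def unit_digits_def)
  have "suminf f = sum f (insert (m + j) {..<m})"
    using 0 by (intro suminf_finite) (auto simp: not_less)
  then show ?thesis by simp
qed

lemma suminf_cat_zero:
  fixes f :: "nat \<Rightarrow> real"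
  assumes "\<And>i. cat m u (\<lambda>_. 0) i = 0 \<Longrightarrow> f i = 0"
  shows "suminf f = (\<Sum>i<m. f i)"
  using assms by (intro suminf_finite) (auto simp: cat_def not_less)

lemma ones_cat_unit: "ones (cat m u (unit_digits j)) (m + j) = ones u m"
proof -
  have "ones (cat m u (unit_digits j)) m = ones u m" by (intro ones_cong) (simp add: cat_def)
  moreover have "ones (\<lambda>i. cat m u (unit_digits j) (i + m)) j = 0"
    by (simp add: ones_def cat_def unit_digits_def)
  ultimately show ?thesis by (simp add: ones_add)
qed

lemma val_cat_unit:
  "greedy.val (cat m u (unit_digits j)) - greedy.val (cat m u (\<lambda>_. 0)) = (1 / \<beta>) ^ Suc (m + j)"
proof -
  have "bterm 1 (1 / \<beta>) (cat m u (unit_digits j)) i = bterm 1 (1 / \<beta>) (cat m u (\<lambda>_. 0)) i" if "i < m" for i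
    using that by (intro bterm_cong) (simp add: cat_def)
  then have eq: "(\<Sum>i<m. bterm 1 (1 / \<beta>) (cat m u (unit_digits j)) i) =
      (\<Sum>i<m. bterm 1 (1 / \<beta>) (cat m u (\<lambda>_. 0)) i)"
    by (intro sum.cong) auto
  have "cat m u (unit_digits j) (m + j) = 1" by (simp add: cat_def unit_digits_def)
  then have "bterm 1 (1 / \<beta>) (cat m u (unit_digits j)) (m + j) = (1 / \<beta>) ^ Suc (m + j)"
    by (simp add: bterm_def)
  moreover have "greedy.val (cat m u (unit_digits j)) =
      (\<Sum>i<m. bterm 1 (1 / \<beta>) (cat m u (unit_digits j)) i) + bterm 1 (1 / \<beta>) (cat m u (unit_digits j)) (m + j)"
    unfolding greedy.val_def by (rule suminf_cat_unit[of m u j]) (simp add: bterm_def)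
  moreover have "greedy.val (cat m u (\<lambda>_. 0)) = (\<Sum>i<m. bterm 1 (1 / \<beta>) (cat m u (\<lambda>_. 0)) i)"
    unfolding greedy.val_def by (rule suminf_cat_zero[of m u]) (simp add: bterm_def)
  ultimately show ?thesis using eq by simp
qed

text \<open>Divided by the difference in \<open>val_cat_unit\<close> this is the slope m + j + 1 +
  \<kappa> \<open>ones u m\<close>. Raising j moves the last 1 without changing the number of ones
  before it, so the slope grows by exactly 1.\<close>

lemma K_cat_unit:
  "K \<kappa> (cat m u (unit_digits j)) - K \<kappa> (cat m u (\<lambda>_. 0)) =
    (1 / \<beta>) ^ Suc (m + j) * (real (Suc (m + j)) + \<kappa> * real (ones u m))"
proof -
  have "kterm \<kappa> (cat m u (unit_digits j)) i = kterm \<kappa> (cat m u (\<lambda>_. 0)) i" if "i < m" for i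
    using that by (intro kterm_cong) (simp add: cat_def)
  then have eq: "(\<Sum>i<m. kterm \<kappa> (cat m u (unit_digits j)) i) = (\<Sum>i<m. kterm \<kappa> (cat m u (\<lambda>_. 0)) i)"
    by (intro sum.cong) auto
  have "cat m u (unit_digits j) (m + j) = 1" by (simp add: cat_def unit_digits_def)
  then have "kterm \<kappa> (cat m u (unit_digits j)) (m + j) =
      (1 / \<beta>) ^ Suc (m + j) * (real (Suc (m + j)) + \<kappa> * real (ones u m))"
    by (simp add: kterm_def ones_cat_unit)
  moreover have "K \<kappa> (cat m u (unit_digits j)) = (\<Sum>i<m. kterm \<kappa> (cat m u (unit_digits j)) i) +
      kterm \<kappa> (cat m u (unit_digits j)) (m + j)"
    unfolding K_def by (rule suminf_cat_unit[of m u j]) (simp add: kterm_def)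
  moreover have "K \<kappa> (cat m u (\<lambda>_. 0)) = (\<Sum>i<m. kterm \<kappa> (cat m u (\<lambda>_. 0)) i)"
    unfolding K_def by (rule suminf_cat_zero[of m u]) (simp add: kterm_def)
  ultimately show ?thesis using eq by simp
qed

lemma val_diff_le:
  assumes a: "a \<in> X" and b: "b \<in> X" and eq: "\<And>i. i < n \<Longrightarrow> a i = b i"
  shows "\<bar>greedy.val a - greedy.val b\<bar> \<le> (1 / \<beta>) ^ n"
proof -
  have "(\<Sum>i<n. bterm 1 (1 / \<beta>) a i) = (\<Sum>i<n. bterm 1 (1 / \<beta>) b i)"
    using eq by (intro sum.cong bterm_cong) auto
  moreover have "wt 1 (1 / \<beta>) a n = (1 / \<beta>) ^ n" for a by (simp add: wt_def)
  ultimately have "greedy.val a - greedy.val b =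
      (1 / \<beta>) ^ n * (greedy.val (\<lambda>i. a (i + n)) - greedy.val (\<lambda>i. b (i + n)))"
    using greedy.val_split[OF a, of n] greedy.val_split[OF b, of n] by (simp only: right_diff_distrib)
  moreover have "\<bar>greedy.val (\<lambda>i. a (i + n)) - greedy.val (\<lambda>i. b (i + n))\<bar> \<le> 1"
    using greedy.val_le_1[OF adm_shift[OF a, of n]] greedy.val_ge_0[OF adm_shift[OF a, of n]]
      greedy.val_le_1[OF adm_shift[OF b, of n]] greedy.val_ge_0[OF adm_shift[OF b, of n]]
    by linarith
  then have "(1 / \<beta>) ^ n * \<bar>greedy.val (\<lambda>i. a (i + n)) - greedy.val (\<lambda>i. b (i + n))\<bar> \<le> (1 / \<beta>) ^ n * 1"
    using beta_gt by (intro mult_left_mono) auto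
  ultimately show ?thesis using beta_gt by (simp add: abs_mult)
qed

lemma val_gdig: "x \<in> {0..1} \<Longrightarrow> greedy.val (gdig x) = x"
  using greedy.val_itin[of x] greedy.val_q by (auto simp: gdig_def)

lemma gdig_val_finite:
  assumes "a \<in> X" "\<And>i. i \<ge> n \<Longrightarrow> a i = 0"
  shows "gdig (greedy.val a) = a" "greedy.val a \<in> {0..1}"
  using greedy.itin_val_finite[of a n, OF assms] greedy.val_less_1_finite[of a n, OF assms] greedy.val_ge_0[OF assms(1)]
  by (auto simp: gdig_def)

text \<open>Behind a word \<open>u\<close> of length \<open>m\<close> that any admissible sequence may follow, the difference
  quotients between \<open>u000...\<close> and \<open>u1000...\<close> and between \<open>u000...\<close> and
  \<open>u0100...\<close> differ by 1.\<close>

lemma K_gdig_not_differentiable: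
  assumes x: "x \<in> {0..1}" and eq: "\<And>x. x \<in> {0..1} \<Longrightarrow> g x = K \<kappa> (gdig x)"
  shows "\<not> g differentiable (at x within {0..1})"
proof
  assume "g differentiable (at x within {0..1})"
  then obtain D where "(g has_real_derivative D) (at x within {0..1})"
    by (auto simp: real_differentiable_def)
  \<comment> \<open>The error 1/100 doubles for two test points. Their distance is at least b^m / 8,
    since b = 1/\<beta> > 1/2 and at most three further digits are involved. Both slopes are thus
    within 4/25 of D, although they differ by 1.\<close>
  then have "\<exists>d>0. \<forall>y\<in>{0..1}. norm (y - x) < d \<longrightarrow>
      norm (g y - g x - D * (y - x)) \<le> 1 / 100 * norm (y - x)"
    unfolding has_field_derivative_def has_derivative_within_alt
    by (metis zero_less_divide_1_iff zero_less_numeral)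
  then obtain d where d: "0 < d" "\<And>y. y \<in> {0..1} \<Longrightarrow> \<bar>y - x\<bar> < d \<Longrightarrow>
      \<bar>g y - g x - D * (y - x)\<bar> \<le> 1 / 100 * \<bar>y - x\<bar>"
    by auto
  define b where "b = 1 / \<beta>"
  have b: "1 / 2 < b" "b < 1" using beta_gt beta_lt by (auto simp: b_def field_simps)
  obtain M where M: "b ^ M < d" using real_arch_pow_inv[OF d(1)] b by auto
  obtain m u where m: "m \<ge> M" and full: "\<And>b. b \<in> X \<Longrightarrow> cat (Suc m) u b \<in> X"
      and u: "\<And>i. i < m \<Longrightarrow> u i = gdig x i"
    using ex_full_word[OF x, of M] by blast
  have "b ^ m \<le> b ^ M" using m b by (intro power_decreasing) auto
  with M have bm: "b ^ m < d" by linarith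
  have gX: "gdig x \<in> X" using gdig_adm x by simp
  have near: "\<bar>g y - g x - D * (y - x)\<bar> \<le> 1 / 100 * b ^ m" "g y = K \<kappa> (cat (Suc m) u a)"
    if a: "a \<in> X" "\<And>i. i \<ge> n \<Longrightarrow> a i = 0" and y: "y = greedy.val (cat (Suc m) u a)" for a n y
  proof -
    have fin: "cat (Suc m) u a i = 0" if "i \<ge> Suc m + n" for i
      using that a(2)[of "i - Suc m"] by (auto simp: cat_def)
    note y01 = gdig_val_finite[of "cat (Suc m) u a" "Suc m + n", OF full[OF a(1)] fin, folded y]
    have "\<bar>y - x\<bar> \<le> b ^ m"
      using val_diff_le[OF full[OF a(1)] gX, of m] u val_gdig[OF x]
      by (simp add: y b_def cat_def)
    moreover from this have "\<bar>g y - g x - D * (y - x)\<bar> \<le> 1 / 100 * \<bar>y - x\<bar>"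
      using bm y01 by (intro d(2)) auto
    ultimately show "\<bar>g y - g x - D * (y - x)\<bar> \<le> 1 / 100 * b ^ m" by simp
    show "g y = K \<kappa> (cat (Suc m) u a)" using eq[OF y01(2)] y01(1) by simp
  qed
  define y where "y = greedy.val (cat (Suc m) u (\<lambda>_. 0))"
  define y' where "y' j = greedy.val (cat (Suc m) u (unit_digits j))" for j
  define c where "c = real (Suc m) + \<kappa> * real (ones u (Suc m))"
  have n0: "\<bar>g y - g x - D * (y - x)\<bar> \<le> 1 / 100 * b ^ m" "g y = K \<kappa> (cat (Suc m) u (\<lambda>_. 0))"
    by (rule near[OF zero_adm _ y_def, of 0], simp)+
  have n1: "\<bar>g (y' j) - g x - D * (y' j - x)\<bar> \<le> 1 / 100 * b ^ m"
      "g (y' j) = K \<kappa> (cat (Suc m) u (unit_digits j))" for j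
    by (rule near[OF unit_digits_adm _ y'_def, of "Suc j"], simp add: unit_digits_def)+
  have quot: "\<bar>b ^ Suc (Suc m + j) * (c + 1 + real j - D)\<bar> \<le> 1 / 50 * b ^ m" for j
  proof -
    have "y' j - y = b ^ Suc (Suc m + j)"
      unfolding y'_def y_def b_def by (rule val_cat_unit)
    moreover have "g (y' j) - g y = b ^ Suc (Suc m + j) * (c + 1 + real j)"
      unfolding n0(2) n1(2) K_cat_unit b_def[symmetric] c_def by (simp add: algebra_simps)
    moreover have "g (y' j) - g y - D * (y' j - y) =
        (g (y' j) - g x - D * (y' j - x)) - (g y - g x - D * (y - x))"
      by (simp add: algebra_simps)
    ultimately have "b ^ Suc (Suc m + j) * (c + 1 + real j - D) =
        (g (y' j) - g x - D * (y' j - x)) - (g y - g x - D * (y - x))"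
      by (simp add: algebra_simps)
    then show ?thesis using n0(1) n1(1)[of j] by linarith
  qed
  have quot': "b ^ Suc (Suc j) * \<bar>c + 1 + real j - D\<bar> \<le> 1 / 50" for j
  proof -
    have "b ^ m * (b ^ Suc (Suc j) * \<bar>c + 1 + real j - D\<bar>) = \<bar>b ^ Suc (Suc m + j) * (c + 1 + real j - D)\<bar>"
      using b by (simp add: abs_mult power_add)
    also have "\<dots> \<le> b ^ m * (1 / 50)" using quot[of j] by simp
    finally show ?thesis using b by (simp del: power_Suc)
  qed
  have small: "1 / 8 * \<bar>c + 1 + real j - D\<bar> \<le> 1 / 50" if "j \<le> 1" for j
  proof -
    have "(1 / 2) ^ 3 \<le> b ^ 3" using b by (intro power_mono) auto
    also have "\<dots> \<le> b ^ Suc (Suc j)" using b that by (intro power_decreasing) auto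
    finally have "1 / 8 * \<bar>c + 1 + real j - D\<bar> \<le> b ^ Suc (Suc j) * \<bar>c + 1 + real j - D\<bar>"
      by (intro mult_right_mono) (auto simp: power3_eq_cube)
    also have "\<dots> \<le> 1 / 50" by (rule quot')
    finally show ?thesis .
  qed
  have "\<bar>c + 1 - D\<bar> \<le> 4 / 25" using small[of 0] by simp
  moreover have "\<bar>2 + c - D\<bar> \<le> 4 / 25" using small[of 1] by simp
  ultimately show False unfolding abs_le_iff by linarith
qed

end

theorem theorem6p1:
  fixes \<beta> :: real
  assumes "1 < \<beta>" and "\<beta> < 2"
  shows "(\<exists>U. open U \<and> U \<subseteq> {0<..<1} \<and> 1 / \<beta> \<in> U \<and>
            (\<forall>x\<in>{0..1}. (\<forall>p\<in>U. F \<beta> p x \<in> {0..1}) \<and> real_analytic_on (\<lambda>p. F \<beta> p x) U))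
       \<and> continuous_on {0..1} (G \<beta>)
       \<and> (\<forall>x\<in>{0..1}. \<not> G \<beta> differentiable (at x within {0..1}))"
proof -
  interpret beta_base \<beta> by unfold_locales fact+
  obtain U \<kappa> where U: "open U" "U \<subseteq> {0<..<1}" "1 / \<beta> \<in> U"
      "\<And>x p. x \<in> {0..1} \<Longrightarrow> p \<in> U \<Longrightarrow> F \<beta> p x \<in> {0..1}"
      "\<And>x. x \<in> {0..1} \<Longrightarrow> real_analytic_on (\<lambda>p. F \<beta> p x) U"
    and GK: "\<And>x. x \<in> {0..1} \<Longrightarrow> G \<beta> x = K \<kappa> (gdig x)" and Kq: "K \<kappa> q = 0"
    using G_eq_K by blast
  have "continuous_on {0..1} (G \<beta>)"
    by (rule continuous_on_eq[OF continuous_on_K_gdig[OF Kq]]) (simp add: GK)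
  moreover have "\<forall>x\<in>{0..1}. \<not> G \<beta> differentiable (at x within {0..1})"
    using K_gdig_not_differentiable[OF _ GK] by blast
  moreover have "\<exists>U. open U \<and> U \<subseteq> {0<..<1} \<and> 1 / \<beta> \<in> U \<and>
      (\<forall>x\<in>{0..1}. (\<forall>p\<in>U. F \<beta> p x \<in> {0..1}) \<and> real_analytic_on (\<lambda>p. F \<beta> p x) U)"
    by (intro exI[of _ U] conjI ballI U)
  ultimately show ?thesis by (intro conjI)
qed

end
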